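(* Let $n\ge1$ and let $\eta,\nu\in\mathbb{Z}_{\ge0}^n$ be compositions with $|\nu|=|\eta|+1$. If $\nu=c_I(\eta)$ for some $I\subseteq\{1,\dots,n\}$ that is maximal with respect to $\eta$, then $$\binom{\nu}{\eta}_{q,t}=-\frac{A_I(\overline\eta)\,\widetilde B_I(\overline\eta)}{t-1}.$$ If there is no $I$ maximal with respect to $\eta$ such that $\nu=c_I(\eta)$, then $\binom{\nu}{\eta}_{q,t}=0$.
   Context: Polynomials are in $z=(z_1,\dots,z_n)$ over $\mathbb{Q}(q,t)$, with $q,t$ indeterminates. A composition is $\eta=(\eta_1,\dots,\eta_n)\in\mathbb{Z}_{\ge0}^n$; $|\eta|=\sum_i\eta_i$; $z^\eta=z_1^{\eta_1}\cdots z_n^{\eta_n}$. Put $$l'_\eta(i)=\#\{j<i:\eta_j\ge\eta_i\}+\#\{j>i:\eta_j>\eta_i\},\quad \overline\eta_i=q^{\eta_i}t^{-l'_\eta(i)},\quad \overline\eta=(\overline\eta_1,\dots,\overline\eta_n).$$ Empty products equal 1. Nonsymmetric Macdonald polynomials: let $s_i$ exchange $z_i$ and $z_{i+1}$ in a function, $(\tau_1f)(z)=f(qz_1,z_2,\dots,z_n)$, $\omega=s_{n-1}\cdots s_1\tau_1$, $T_i=t+\frac{tz_i-z_{i+1}}{z_i-z_{i+1}}(s_i-1)$, $Y_i=t^{-n+i}T_i\cdots T_{n-1}\,\omega\, T_1^{-1}\cdots T_{i-1}^{-1}$ ($1\le i\le n$). $E_\eta(z;q,t)$ is the unique polynomial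 with $Y_iE_\eta=\overline\eta_iE_\eta$ for all $i$ and of the form $z^\eta+\sum_{\nu\prec\eta}b_{\eta\nu}z^\nu$. Here, for $|\mu|=|\eta|$, $\mu\prec\eta$ iff $\mu^+<\eta^+$, or $\mu^+=\eta^+$ and $\mu<\eta$; $\eta^+$ is the partition obtained by permuting the parts of $\eta$, and $\mu<\eta$ means $\mu\neq\eta$ and $\sum_{i=1}^p(\eta_i-\mu_i)\ge0$ for all $1\le p\le n$. $E_\eta(z;q^{-1},t^{-1})$ is obtained by replacing $q,t$ by $q^{-1},t^{-1}$ in the coefficients. Generalised binomial coefficients: for a composition $\eta$, the coefficients $\binom{\nu}{\eta}_{q,t}$ are defined by the generating function identity (of formal power series in $z$) $$E_\eta(z;q^{-1},t^{-1})\prod_{i=1}^n\frac1{(z_i;q)_\infty}=\sum_\nu\binom{\nu}{\eta}_{q,t}\,t^{\,l(\nu)-l(\eta)}\,\frac{d'_\eta(q,t)}{d'_\nu(q,t)}\,E_\nu(z;q^{-1},t^{-1}),$$ the sum being over all compositions $\nu\in\mathbb{Z}_{\ge0}^n$, where $(u;q)_\infty=\prod_{j=1}^\infty(1-uq^{j-1})$ (so $\frac1{(u;q)_\infty}=\sum_{k\ge0}\frac{u^k}{(1-q)(1-q^2)\cdots(1-q^k)}$). Here, with $(i,j)$ ranging over $1\le i\le n$, $1\le j\le\eta_i$: $d'_\eta(q,t)=\prod_{(i,j)}\left(1-q^{a_\eta(i,j)+1}t^{l_\eta(i,j)}\right)$, $l(\eta)=\sum_{(i,j)}l_\eta(i,j)$,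 $a_\eta(i,j)=\eta_i-j$, $l_\eta(i,j)=\#\{k>i: j\le\eta_k\le\eta_i\}+\#\{k<i: j\le\eta_k+1\le\eta_i\}$. Functions: $\widehat a(x,y)=\frac{(t-1)x}{x-y}$, $\widehat b(x,y)=\frac{x-ty}{x-y}$, and for $I=\{t_1<\dots<t_s\}\ne\emptyset$, $$A_I(z)=\widehat a\left(\tfrac{z_{t_s}}q,z_{t_1}\right)\prod_{u=1}^{s-1}\widehat a(z_{t_u},z_{t_{u+1}}),$$ $$\widetilde B_I(z)=\left(qz_{t_1}-t^{-n+1}\right)\prod_{u=1}^{s}\prod_{j=t_{u-1}+1}^{t_u-1}\widehat b(z_{t_u},z_j)\prod_{j=t_s+1}^{n}\widehat b(qz_{t_1},z_j),\quad t_0:=0.$$ Maximal sets: a nonempty $I=\{t_1<\dots<t_s\}\subseteq\{1,\dots,n\}$ is maximal with respect to $\eta$ iff (1) $\eta_j\ne\eta_{t_u}$ for $j=t_{u-1}+1,\dots,t_u-1$ and $u=1,\dots,s$ (with $t_0:=0$), and (2) $\eta_j\neq\eta_{t_1}+1$ for $j=t_s+1,\dots,n$. The composition $c_I(\eta)$ is defined by $(c_I(\eta))_{t_k}=\eta_{t_{k+1}}$ for $k=1,\dots,s-1$, $(c_I(\eta))_{t_s}=\eta_{t_1}+1$, $(c_I(\eta))_j=\eta_j$ for $j\notin I$. *)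

theory Defs
  imports
    "HOL-Computational_Algebra.Computational_Algebra"
    "HOL-Computational_Algebra.Field_as_Ring"
    "HOL-Library.Poly_Mapping"
    "HOL-Combinatorics.Transposition"
begin

abbreviation lookup :: "('a \<Rightarrow>\<^sub>0 'b::zero) \<Rightarrow> 'a \<Rightarrow> 'b" where
  "lookup \<equiv> Poly_Mapping.lookup"

abbreviation keys :: "('a \<Rightarrow>\<^sub>0 'b::zero) \<Rightarrow> 'a set" where
  "keys \<equiv> Poly_Mapping.keys"

abbreviation single :: "'a \<Rightarrow> 'b \<Rightarrow> 'a \<Rightarrow>\<^sub>0 'b::zero" where
  "single \<equiv> Poly_Mapping.single"


section \<open>The field of rational functions in two indeterminates\<close>

text \<open>The inner polynomial variable is \<open>q\<close>, the outer one is \<open>t\<close>.\<close>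

type_synonym qt_field = "rat poly poly fract"

definition qq :: qt_field where "qq = Fract [:[:0, 1:]:] 1"

definition tt :: qt_field where "tt = Fract [:0, 1:] 1"

definition qt_eval :: "rat poly poly \<Rightarrow> qt_field \<Rightarrow> qt_field \<Rightarrow> qt_field" where
  "qt_eval p x y = poly (map_poly (\<lambda>c. poly (map_poly (\<lambda>r. Fract [:[:r:]:] 1) c) x) p) y"

text \<open>The substitution of \<open>1/q\<close>, \<open>1/t\<close> for \<open>q\<close>, \<open>t\<close>.\<close>

definition invert_qt :: "qt_field \<Rightarrow> qt_field" where
  "invert_qt r = (case quot_of_fract r of (a, b) \<Rightarrow>
     qt_eval a (inverse qq) (inverse tt) / qt_eval b (inverse qq) (inverse tt))"

lemma qq_power: "qq ^ k = Fract [:[:0, 1:] ^ k:] 1"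
  by (induction k) (simp_all add: qq_def One_fract_def one_pCons mult.commute)

lemma qq_power_neq_1: "qq ^ k \<noteq> 1" if "k > 0"
proof
  assume "qq ^ k = 1"
  hence "[:0, 1::rat:] ^ k = 1"
    by (simp add: qq_power One_fract_def eq_fract one_pCons)
  hence "poly ([:0, 1::rat:] ^ k) 0 = poly 1 0" by simp
  thus False using that by (simp add: poly_power power_0_left)
qed


section \<open>Compositions\<close>

text \<open>
  Compositions of length \<open>n\<close>, like exponents of monomials in \<open>z\<^sub>1, \<dots>, z\<^sub>n\<close>, are finitely supported
  functions on \<open>nat\<close> with support in \<open>{1..n}\<close>.
\<close>

type_synonym expo = "nat \<Rightarrow>\<^sub>0 nat"

definition composition :: "nat \<Rightarrow> expo \<Rightarrow> bool" where
  "composition n \<eta> \<longleftrightarrow> keys \<eta> \<subseteq> {1..n}"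

definition csize :: "nat \<Rightarrow> expo \<Rightarrow> nat" where
  "csize n \<eta> = (\<Sum>i=1..n. lookup \<eta> i)"

definition leg' :: "nat \<Rightarrow> expo \<Rightarrow> nat \<Rightarrow> nat" where
  "leg' n \<eta> i = card {j\<in>{1..n}. j < i \<and> lookup \<eta> j \<ge> lookup \<eta> i}
              + card {j\<in>{1..n}. j > i \<and> lookup \<eta> j > lookup \<eta> i}"

definition spectral :: "nat \<Rightarrow> expo \<Rightarrow> nat \<Rightarrow> qt_field" where
  "spectral n \<eta> i = qq ^ lookup \<eta> i * tt powi (- int (leg' n \<eta> i))"

definition arm :: "expo \<Rightarrow> nat \<Rightarrow> nat \<Rightarrow> nat" where
  "arm \<eta> i j = lookup \<eta> i - j"

definition leg :: "nat \<Rightarrow> expo \<Rightarrow> nat \<Rightarrow> nat \<Rightarrow> nat" where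
  "leg n \<eta> i j =
     card {k\<in>{1..n}. k > i \<and> j \<le> lookup \<eta> k \<and> lookup \<eta> k \<le> lookup \<eta> i}
   + card {k\<in>{1..n}. k < i \<and> j \<le> lookup \<eta> k + 1 \<and> lookup \<eta> k + 1 \<le> lookup \<eta> i}"

definition total_leg :: "nat \<Rightarrow> expo \<Rightarrow> nat" where
  "total_leg n \<eta> = (\<Sum>i=1..n. \<Sum>j=1..lookup \<eta> i. leg n \<eta> i j)"

definition d_prime :: "nat \<Rightarrow> expo \<Rightarrow> qt_field" where
  "d_prime n \<eta> = (\<Prod>i=1..n. \<Prod>j=1..lookup \<eta> i. 1 - qq ^ (arm \<eta> i j + 1) * tt ^ leg n \<eta> i j)"

definition dominated :: "nat \<Rightarrow> (nat \<Rightarrow> nat) \<Rightarrow> (nat \<Rightarrow> nat) \<Rightarrow> bool" where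
  "dominated n \<mu> \<eta> \<longleftrightarrow> (\<exists>i\<in>{1..n}. \<mu> i \<noteq> \<eta> i) \<and>
     (\<forall>p\<in>{1..n}. (\<Sum>i=1..p. int (\<eta> i) - int (\<mu> i)) \<ge> 0)"

text \<open>Only the values at \<open>1, \<dots>, n\<close> of the following function are used.\<close>

definition parts_desc :: "nat \<Rightarrow> expo \<Rightarrow> nat \<Rightarrow> nat" where
  "parts_desc n \<eta> i = rev (sort (map (lookup \<eta>) [1..<Suc n])) ! (i - 1)"

definition comp_prec :: "nat \<Rightarrow> expo \<Rightarrow> expo \<Rightarrow> bool" where
  "comp_prec n \<mu> \<eta> \<longleftrightarrow> composition n \<mu> \<and> csize n \<mu> = csize n \<eta> \<and>
     (dominated n (parts_desc n \<mu>) (parts_desc n \<eta>) \<or>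
      (\<forall>i\<in>{1..n}. parts_desc n \<mu> i = parts_desc n \<eta> i) \<and> dominated n (lookup \<mu>) (lookup \<eta>))"


section \<open>Polynomials and the operators acting on them\<close>

type_synonym mpoly = "expo \<Rightarrow>\<^sub>0 qt_field"

abbreviation Const :: "qt_field \<Rightarrow> mpoly" where
  "Const c \<equiv> single 0 c"

abbreviation Var :: "nat \<Rightarrow> mpoly" where
  "Var i \<equiv> single (single i 1) 1"

definition msubst :: "(nat \<Rightarrow> mpoly) \<Rightarrow> mpoly \<Rightarrow> mpoly" where
  "msubst \<sigma> f = (\<Sum>\<mu>\<in>keys f.
     Const (lookup f \<mu>) * (\<Prod>i\<in>keys \<mu>. \<sigma> i ^ lookup \<mu> i))"

definition swap :: "nat \<Rightarrow> mpoly \<Rightarrow> mpoly" where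
  "swap i = msubst (\<lambda>k. Var (transpose i (Suc i) k))"

definition q_shift :: "mpoly \<Rightarrow> mpoly" where
  "q_shift = msubst (\<lambda>k. if k = 1 then Const qq * Var 1 else Var k)"

definition omega_op :: "nat \<Rightarrow> mpoly \<Rightarrow> mpoly" where
  "omega_op n = foldr (\<circ>) (map swap (rev [1..<n])) q_shift"

text \<open>
  The quotient \<open>(s\<^sub>i f - f) / (z\<^sub>i - z\<^sub>i\<^sub>+\<^sub>1)\<close> exists and is unique by \<open>swap_quotient\<close> below.
  The operators satisfy \<open>T\<^sub>i\<^sup>2 = (t - 1) T\<^sub>i + t\<close>, hence are bijective on polynomials, so
  \<^const>\<open>inv\<close> in \<open>cherednik_Y\<close> is the inverse operator.
\<close>

definition hecke_T :: "nat \<Rightarrow> mpoly \<Rightarrow> mpoly" where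
  "hecke_T i f = Const tt * f
     + (Const tt * Var i - Var (Suc i)) * (THE g. (Var i - Var (Suc i)) * g = swap i f - f)"

definition cherednik_Y :: "nat \<Rightarrow> nat \<Rightarrow> mpoly \<Rightarrow> mpoly" where
  "cherednik_Y n i f = Const (tt powi (int i - int n)) *
     (foldr (\<circ>) (map hecke_T [i..<n]) id \<circ> omega_op n
        \<circ> foldr (\<circ>) (map (\<lambda>j. inv (hecke_T j)) [1..<i]) id) f"

lemma sum_single_keys: "(\<Sum>i\<in>keys p. single i (lookup p i)) = (p :: 'a \<Rightarrow>\<^sub>0 'b::comm_monoid_add)"
  by (rule poly_mapping_eqI)
     (auto simp: lookup_sum lookup_single when_def in_keys_iff sum.delta')

lemma msubst_Var: "msubst Var f = f"
proof -
  have mono: "(\<Prod>i\<in>A. Var i ^ lookup \<mu> i)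
      = single (\<Sum>i\<in>A. single i (lookup \<mu> i)) 1"
    if "finite A" for A and \<mu> :: expo
    using that
  proof (induction A)
    case (insert a A)
    have "Var a ^ k = single (single a k) 1" for k
      by (induction k) (simp_all add: mult_single single_add [symmetric])
    with insert show ?case by (simp add: mult_single)
  qed simp
  have "(\<Sum>i\<in>keys \<mu>. single i (lookup \<mu> i)) = \<mu>" for \<mu> :: expo
    by (rule sum_single_keys)
  with mono show ?thesis
    by (simp add: msubst_def mult_single sum_single_keys)
qed

lemma dvd_diff_prod:
  fixes d :: "'a :: comm_ring_1"
  assumes "\<And>i. i \<in> A \<Longrightarrow> d dvd a i - b i"
  shows "d dvd (\<Prod>i\<in>A. a i) - (\<Prod>i\<in>A. b i)"
  using assms
proof (induction A rule: infinite_finite_induct)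
  case (insert x A)
  have "(\<Prod>i\<in>insert x A. a i) - (\<Prod>i\<in>insert x A. b i)
      = (a x - b x) * (\<Prod>i\<in>A. a i) + b x * ((\<Prod>i\<in>A. a i) - (\<Prod>i\<in>A. b i))"
    using insert by (simp add: algebra_simps)
  with insert show ?case by simp
qed simp_all

lemma swap_quotient: "\<exists>!g. (Var i - Var (Suc i)) * g = swap i f - f"
proof -
  let ?d = "Var i - Var (Suc i)"
  have "lookup ?d (single i 1) \<noteq> 0"
    by (auto simp: lookup_minus lookup_single when_def dest: arg_cong [of _ _ "\<lambda>\<mu>. lookup \<mu> i"])
  hence nz: "?d \<noteq> 0" by (metis lookup_zero)
  have pow: "?d dvd Var (transpose i (Suc i) k) ^ m - Var k ^ m" for k m
  proof -
    have "?d dvd Var (transpose i (Suc i) k) - Var k"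
      using dvd_minus_iff [of ?d "Var (Suc i) - Var i"] by (auto simp: transpose_def)
    thus ?thesis
      using dvd_diff_prod [of "{..<m}" ?d "\<lambda>_. Var (transpose i (Suc i) k)" "\<lambda>_. Var k"] by simp
  qed
  have "?d dvd swap i f - msubst Var f"
    unfolding swap_def msubst_def sum_subtractf [symmetric] right_diff_distrib [symmetric]
    by (intro dvd_sum dvd_mult dvd_diff_prod pow)
  then obtain g where "swap i f - f = ?d * g"
    unfolding msubst_Var by (auto elim: dvdE)
  with nz show ?thesis by (metis mult_left_cancel)
qed


section \<open>Nonsymmetric Macdonald polynomials\<close>

definition is_macdonald :: "nat \<Rightarrow> expo \<Rightarrow> mpoly \<Rightarrow> bool" where
  "is_macdonald n \<eta> P \<longleftrightarrow>
     (\<forall>i\<in>{1..n}. cherednik_Y n i P = Const (spectral n \<eta> i) * P) \<and>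
     lookup P \<eta> = 1 \<and> (\<forall>\<nu>. lookup P \<nu> \<noteq> 0 \<longrightarrow> \<nu> = \<eta> \<or> comp_prec n \<nu> \<eta>)"

definition macdonald_E :: "nat \<Rightarrow> expo \<Rightarrow> mpoly" where
  "macdonald_E n \<eta> = (THE P. is_macdonald n \<eta> P)"

definition macdonald_E_inv :: "nat \<Rightarrow> expo \<Rightarrow> mpoly" where
  "macdonald_E_inv n \<eta> = Poly_Mapping.map invert_qt (macdonald_E n \<eta>)"


section \<open>Generalised binomial coefficients\<close>

text \<open>
  The series of \<open>1 / (u; q)\<^sub>\<infinity>\<close> in \<open>u\<close>. Lemma \<open>inv_qpoch_times_partial\<close> relates it to the infinite
  product: multiplied by the partial product of \<open>(u; q)\<^sub>\<infinity>\<close> with \<open>N\<close> factors, it has constant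
  coefficient \<open>1\<close>, and its coefficient at \<open>u\<^sup>k\<close> is divisible by \<open>q\<^bsup>N k\<^esup>\<close>.
\<close>

definition inv_qpoch :: "qt_field fps" where
  "inv_qpoch = Abs_fps (\<lambda>k. 1 / (\<Prod>j=1..k. 1 - qq ^ j))"

lemma inv_qpoch_times_partial:
  "fps_nth (inv_qpoch * (\<Prod>j=1..N. 1 - fps_const (qq ^ (j - 1)) * fps_X)) k
     = qq ^ (N * k) * fps_nth inv_qpoch k"
proof (induction N arbitrary: k)
  case (Suc N)
  let ?F = "inv_qpoch * (\<Prod>j=1..N. 1 - fps_const (qq ^ (j - 1)) * fps_X)"
  have "fps_nth (inv_qpoch * (\<Prod>j=1..Suc N. 1 - fps_const (qq ^ (j - 1)) * fps_X)) k
      = fps_nth (?F - fps_const (qq ^ N) * (fps_X * ?F)) k"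
    by (simp add: algebra_simps)
  also have "\<dots> = fps_nth ?F k - qq ^ N * (if k = 0 then 0 else fps_nth ?F (k - 1))"
    by (simp only: fps_sub_nth fps_mult_left_const_nth fps_X_mult_nth)
  also have "\<dots> = qq ^ (Suc N * k) * fps_nth inv_qpoch k"
  proof (cases k)
    case (Suc m)
    have "1 - qq ^ Suc m \<noteq> 0" using qq_power_neq_1 [of "Suc m"] by simp
    hence eq: "fps_nth inv_qpoch m = (1 - qq ^ Suc m) * fps_nth inv_qpoch (Suc m)"
      by (simp add: inv_qpoch_def)
    show ?thesis unfolding Suc.IH by (simp add: Suc eq algebra_simps power_add)
  qed (simp only: Suc.IH, simp)
  finally show ?case .
qed simp

text \<open>
  Formal power series in \<open>z\<close> are coefficient functions on exponents; \<^const>\<open>prod_fun\<close> is their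
  Cauchy product (every exponent has finitely many decompositions \<open>\<alpha> + \<beta>\<close>).
\<close>

type_synonym mseries = "expo \<Rightarrow> qt_field"

definition series_in_var :: "qt_field fps \<Rightarrow> nat \<Rightarrow> mseries" where
  "series_in_var F i \<mu> = (if keys \<mu> \<subseteq> {i} then fps_nth F (lookup \<mu> i) else 0)"

definition prod_inv_qpoch :: "nat \<Rightarrow> mseries" where
  "prod_inv_qpoch n = foldr prod_fun (map (series_in_var inv_qpoch) [1..<Suc n]) (lookup (1 :: mpoly))"

definition series_sums :: "('a \<Rightarrow> mseries) \<Rightarrow> 'a set \<Rightarrow> mseries \<Rightarrow> bool" where
  "series_sums F A S \<longleftrightarrow> (\<forall>\<mu>. finite {\<nu>\<in>A. F \<nu> \<mu> \<noteq> 0} \<and> S \<mu> = (\<Sum>\<nu>\<in>{\<nu>\<in>A. F \<nu> \<mu> \<noteq> 0}. F \<nu> \<mu>))"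

definition is_qt_binomials :: "nat \<Rightarrow> expo \<Rightarrow> (expo \<Rightarrow> qt_field) \<Rightarrow> bool" where
  "is_qt_binomials n \<eta> c \<longleftrightarrow>
     series_sums
       (\<lambda>\<nu> \<mu>. c \<nu> * tt powi (int (total_leg n \<nu>) - int (total_leg n \<eta>))
                * (d_prime n \<eta> / d_prime n \<nu>) * lookup (macdonald_E_inv n \<nu>) \<mu>)
       {\<nu>. composition n \<nu>}
       (prod_fun (lookup (macdonald_E_inv n \<eta>)) (prod_inv_qpoch n))"

text \<open>The family \<open>c\<close> is determined by the identity only on compositions, hence the normalisation.\<close>

definition qt_binomial :: "nat \<Rightarrow> expo \<Rightarrow> expo \<Rightarrow> qt_field" where
  "qt_binomial n \<nu> \<eta> =
     (THE c. is_qt_binomials n \<eta> c \<and> (\<forall>\<nu>. \<not> composition n \<nu> \<longrightarrow> c \<nu> = 0)) \<nu>"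


section \<open>The functions attached to a set of indices\<close>

definition a_hat :: "qt_field \<Rightarrow> qt_field \<Rightarrow> qt_field" where
  "a_hat x y = (tt - 1) * x / (x - y)"

definition b_hat :: "qt_field \<Rightarrow> qt_field \<Rightarrow> qt_field" where
  "b_hat x y = (x - tt * y) / (x - y)"

text \<open>\<open>elt I u\<close> is \<open>t\<^sub>u\<close> for \<open>I = {t\<^sub>1 < \<dots> < t\<^sub>s}\<close>, with \<open>t\<^sub>0 = 0\<close>.\<close>

definition elt :: "nat set \<Rightarrow> nat \<Rightarrow> nat" where
  "elt I u = (if u = 0 then 0 else sorted_list_of_set I ! (u - 1))"

definition A_fun :: "nat set \<Rightarrow> (nat \<Rightarrow> qt_field) \<Rightarrow> qt_field" where
  "A_fun I z = (let s = card I in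
     a_hat (z (elt I s) / qq) (z (elt I 1)) * (\<Prod>u\<in>{1..<s}. a_hat (z (elt I u)) (z (elt I (u + 1)))))"

definition B_tilde :: "nat \<Rightarrow> nat set \<Rightarrow> (nat \<Rightarrow> qt_field) \<Rightarrow> qt_field" where
  "B_tilde n I z = (let s = card I in
     (qq * z (elt I 1) - tt powi (- int n + 1))
     * (\<Prod>u=1..s. \<Prod>j\<in>{elt I (u - 1)<..<elt I u}. b_hat (z (elt I u)) (z j))
     * (\<Prod>j\<in>{elt I s<..n}. b_hat (qq * z (elt I 1)) (z j)))"

definition maximal_set :: "nat \<Rightarrow> expo \<Rightarrow> nat set \<Rightarrow> bool" where
  "maximal_set n \<eta> I \<longleftrightarrow> I \<noteq> {} \<and> I \<subseteq> {1..n} \<and>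
     (\<forall>u\<in>{1..card I}. \<forall>j\<in>{elt I (u - 1)<..<elt I u}. lookup \<eta> j \<noteq> lookup \<eta> (elt I u)) \<and>
     (\<forall>j\<in>{elt I (card I)<..n}. lookup \<eta> j \<noteq> lookup \<eta> (elt I 1) + 1)"

text \<open>
  For \<open>j = t\<^sub>k\<close> the index \<open>k\<close> is the number of elements of \<open>I\<close> up to \<open>j\<close>; the lemmas below give
  the values in terms of \<open>t\<^sub>k\<close>.
\<close>

definition c_set :: "nat set \<Rightarrow> expo \<Rightarrow> expo" where
  "c_set I \<eta> = Abs_poly_mapping (\<lambda>j.
     if j \<notin> I then lookup \<eta> j
     else if j = elt I (card I) then lookup \<eta> (elt I 1) + 1
     else lookup \<eta> (elt I (card {i\<in>I. i \<le> j} + 1)))"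

lemma lookup_c_set:
  assumes "finite I"
  shows "lookup (c_set I \<eta>) j =
     (if j \<notin> I then lookup \<eta> j
      else if j = elt I (card I) then lookup \<eta> (elt I 1) + 1
      else lookup \<eta> (elt I (card {i\<in>I. i \<le> j} + 1)))"
proof -
  have "finite (I \<union> keys \<eta>)" using assms by simp
  hence "finite {j. (if j \<notin> I then lookup \<eta> j
      else if j = elt I (card I) then lookup \<eta> (elt I 1) + 1
      else lookup \<eta> (elt I (card {i\<in>I. i \<le> j} + 1))) \<noteq> 0}"
    by (rule rev_finite_subset) (auto simp: in_keys_iff split: if_splits)
  thus ?thesis unfolding c_set_def by (simp add: lookup_Abs_poly_mapping)
qed

lemma elt_in: "elt I k \<in> I" if "finite I" "k \<in> {1..card I}"
proof -
  have "sorted_list_of_set I ! (k - 1) \<in> set (sorted_list_of_set I)"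
    using that by (intro nth_mem) auto
  with that show ?thesis by (simp add: elt_def)
qed

lemma elt_less: "elt I k < elt I m" if "finite I" "1 \<le> k" "k < m" "m \<le> card I"
  using that sorted_wrt_nth_less [OF strict_sorted_list_of_set [of I], of "k - 1" "m - 1"]
  by (simp add: elt_def)

lemma card_le_elt: "card {i\<in>I. i \<le> elt I k} = k" if "finite I" "k \<in> {1..card I}"
proof -
  have "\<exists>m\<in>{1..card I}. i = elt I m" if "i \<in> I" for i
  proof -
    from that \<open>finite I\<close> have "i \<in> set (sorted_list_of_set I)" by simp
    then obtain m where "m < card I" "i = sorted_list_of_set I ! m"
      by (auto simp: in_set_conv_nth)
    thus ?thesis by (intro bexI [of _ "Suc m"]) (auto simp: elt_def)
  qed
  moreover have "elt I m \<le> elt I k \<longleftrightarrow> m \<le> k" if "m \<in> {1..card I}" for m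
    using that \<open>k \<in> _\<close> elt_less [OF \<open>finite I\<close>, of m k] elt_less [OF \<open>finite I\<close>, of k m]
    by (cases m k rule: linorder_cases) auto
  ultimately have "{i\<in>I. i \<le> elt I k} = elt I ` {1..k}"
    using that elt_in [OF \<open>finite I\<close>] by (fastforce simp: image_iff)
  moreover have "inj_on (elt I) {1..k}"
  proof (rule linorder_inj_onI)
    fix x y assume "x < y" "x \<in> {1..k}" "y \<in> {1..k}"
    with elt_less [of I x y] that show "elt I x \<noteq> elt I y" by auto
  qed auto
  ultimately show ?thesis by (simp add: card_image)
qed

lemma lookup_c_set_inner:
  assumes "finite I" "k \<in> {1..<card I}"
  shows "lookup (c_set I \<eta>) (elt I k) = lookup \<eta> (elt I (k + 1))"
  using assms elt_in [of I k] elt_less [of I k "card I"] card_le_elt [of I k]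
  by (auto simp: lookup_c_set)

lemma lookup_c_set_last:
  assumes "finite I" "I \<noteq> {}"
  shows "lookup (c_set I \<eta>) (elt I (card I)) = lookup \<eta> (elt I 1) + 1"
proof -
  from assms have "card I \<in> {1..card I}" by (simp add: Suc_le_eq card_gt_0_iff)
  with assms elt_in [of I "card I"] show ?thesis by (simp add: lookup_c_set)
qed

lemma lookup_c_set_outside:
  assumes "finite I" "j \<notin> I"
  shows "lookup (c_set I \<eta>) j = lookup \<eta> j"
  using assms by (simp add: lookup_c_set)

end

theory Submission
  imports Defs
begin

text \<open>
  Let \<open>F\<^sub>\<nu>\<close> be \<open>E\<^sub>\<nu>\<close> divided by the factor that turns into \<open>t\<^bsup>- l(\<nu>)\<^esup> d'\<^sub>\<nu>\<close> when \<open>q\<close> and \<open>t\<close> are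
  inverted. In degree \<open>|\<eta>| + 1\<close> the defining identity says that the binomial coefficients are, up to
  this inversion and the factor \<open>1 / (1 - q)\<close>, the coefficients \<open>C\<^sub>\<nu>\<close> of \<open>e\<^sub>1 F\<^sub>\<eta>\<close>, where
  \<open>e\<^sub>1 = z\<^sub>1 + \<dots> + z\<^sub>n\<close>. Since \<open>e\<^sub>1\<close> commutes with the \<open>T\<^sub>i\<close> and \<open>\<omega> e\<^sub>1 = (e\<^sub>1 + (q - 1) z\<^sub>n) \<omega>\<close>,
  one has \<open>Y\<^sub>i e\<^sub>1 = e\<^sub>1 Y\<^sub>i + (q - 1) L\<^sub>i\<close> with
  \<open>L\<^sub>i = t\<^bsup>i - n\<^esup> T\<^sub>i \<dots> T\<^sub>n\<^sub>-\<^sub>1 z\<^sub>n \<omega> T\<^sub>1\<^sup>-\<^sup>1 \<dots> T\<^sub>i\<^sub>-\<^sub>1\<^sup>-\<^sup>1\<close>, so that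
  \<open>(\<nu>\<^sub>i - \<eta>\<^sub>i) C\<^sub>\<nu> = (q - 1) [F\<^sub>\<nu>] L\<^sub>i F\<^sub>\<eta>\<close>, with spectral values on the left. On the basis \<open>F\<close>
  every \<open>T\<^sub>j\<close> either keeps a composition or exchanges two neighbouring entries, and \<open>z\<^sub>n \<omega>\<close> shifts
  cyclically and adds \<open>1\<close>. For \<open>i\<close> the last place where the spectra of \<open>\<eta>\<close> and \<open>\<nu>\<close> differ,
  at most one sequence of such choices leads from \<open>\<eta>\<close> to \<open>\<nu>\<close>; the places where the composition is
  kept, together with \<open>i\<close>, form the set \<open>I\<close>, and the exchanges are possible iff \<open>I\<close> is maximal.
\<close>

text \<open>The values of a spectrum are pairwise distinct even if the composition has equal parts,
  so they label its parts. An exchange of two unequal parts carries the labels along, the diagonal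
  term leaves them in place, and the labels of \<nu> therefore reveal which term was used. In the
  steps from \<open>i\<close> on, a diagonal term would leave a wrong label at a place that no later
  step touches; so all of them are exchanges, and only the steps below \<open>i\<close> offer a
  choice.

  The divisor of E_\<nu> makes T_i^{-1} act at ascents and descents by the same two functions of
  neighbouring spectral values. On E_\<nu> itself a descent would show a product of two such
  functions. Inverting q and t turns the functions into \<open>a_hat\<close> and
  \<open>b_hat\<close>.

  As \<open>macdonald_E\<close> is a definite description, existence and uniqueness have to be
  proved for triangularity in the dominance order. Since the inductive construction by T_i and z_n
  \<omega> needs an order that these operators respect, it is carried out with a stronger one of
  Bruhat type.\<close>

declare One_nat_def [simp del]


section \<open>Substitutions\<close>

lemma Const_add: "Const (a + b) = Const a + Const b"
  by (rule single_add)

lemma Const_diff: "Const (a - b) = Const a - Const b"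
  by (rule single_diff)

lemma Const_mult: "Const (a * b) = Const a * Const b"
  by (subst mult_single) simp

lemma Const_power: "Const (a ^ k) = Const a ^ k"
  by (induction k) (simp_all add: Const_mult)

lemma lookup_Const_mult: "lookup (Const c * f) \<mu> = c * lookup f \<mu>"
  unfolding mult_map_scale_conv_mult [symmetric] by (simp add: Poly_Mapping.map.rep_eq when_def)

text \<open>Zero is covered as the monomial with coefficient 0, so additive identities reduce to
  monomials.\<close>

lemma mpoly_induct [case_names monomial add]:
  fixes f :: "'a \<Rightarrow>\<^sub>0 'b::comm_monoid_add"
  assumes mono: "\<And>\<mu> c. P (single \<mu> c)" and add: "\<And>f g. P f \<Longrightarrow> P g \<Longrightarrow> P (f + g)"
  shows "P f"
proof -
  have zero: "P 0" using mono [of undefined 0] by simp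
  have "P (\<Sum>\<mu>\<in>A. single \<mu> (lookup f \<mu>))" if "finite A" for A
    using that by (induction A) (auto simp: zero intro: mono add)
  from this [of "keys f"] show ?thesis by (simp add: sum_single_keys)
qed

definition subst_mono :: "(nat \<Rightarrow> mpoly) \<Rightarrow> expo \<Rightarrow> mpoly" where
  "subst_mono \<sigma> \<mu> = (\<Prod>i\<in>keys \<mu>. \<sigma> i ^ lookup \<mu> i)"

text \<open>Allows monomials with different supports to be multiplied factor by factor over one
  index set.\<close>

lemma subst_mono_superset:
  assumes "finite A" "keys \<mu> \<subseteq> A"
  shows "subst_mono \<sigma> \<mu> = (\<Prod>i\<in>A. \<sigma> i ^ lookup \<mu> i)"
  unfolding subst_mono_def using assms
  by (intro prod.mono_neutral_left) (auto simp: in_keys_iff)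

lemma subst_mono_add: "subst_mono \<sigma> (\<mu> + \<nu>) = subst_mono \<sigma> \<mu> * subst_mono \<sigma> \<nu>"
proof -
  let ?A = "keys \<mu> \<union> keys \<nu>"
  have "subst_mono \<sigma> \<mu>' = (\<Prod>i\<in>?A. \<sigma> i ^ lookup \<mu>' i)" if "\<mu>' \<in> {\<mu>, \<nu>, \<mu> + \<nu>}" for \<mu>'
    using that keys_add [of \<mu> \<nu>] by (intro subst_mono_superset) auto
  thus ?thesis by (simp add: lookup_add power_add prod.distrib)
qed

lemma subst_mono_0 [simp]: "subst_mono \<sigma> 0 = 1"
  by (simp add: subst_mono_def)

lemma subst_mono_single [simp]: "subst_mono \<sigma> (single i k) = \<sigma> i ^ k"
  by (cases "k = 0") (simp_all add: subst_mono_def)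

lemma msubst_superset:
  assumes "finite A" "keys f \<subseteq> A"
  shows "msubst \<sigma> f = (\<Sum>\<mu>\<in>A. Const (lookup f \<mu>) * subst_mono \<sigma> \<mu>)"
  unfolding msubst_def subst_mono_def [symmetric] using assms
  by (intro sum.mono_neutral_left) (auto simp: in_keys_iff)

lemma msubst_monomial: "msubst \<sigma> (single \<mu> c) = Const c * subst_mono \<sigma> \<mu>"
  by (subst msubst_superset [of "{\<mu>}"]) auto

lemma msubst_add: "msubst \<sigma> (f + g) = msubst \<sigma> f + msubst \<sigma> g"
proof -
  let ?A = "keys f \<union> keys g"
  have "msubst \<sigma> h = (\<Sum>\<mu>\<in>?A. Const (lookup h \<mu>) * subst_mono \<sigma> \<mu>)" if "h \<in> {f, g, f + g}" for h
    using that keys_add [of f g] by (intro msubst_superset) auto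
  thus ?thesis by (simp add: lookup_add Const_add algebra_simps sum.distrib)
qed

lemma msubst_mult: "msubst \<sigma> (f * g) = msubst \<sigma> f * msubst \<sigma> g"
proof (induction f rule: mpoly_induct)
  case (monomial \<mu> c)
  show ?case
  proof (induction g rule: mpoly_induct)
    case (monomial \<nu> d)
    have "msubst \<sigma> (single \<mu> c * single \<nu> d) = Const (c * d) * (subst_mono \<sigma> \<mu> * subst_mono \<sigma> \<nu>)"
      by (simp only: mult_single msubst_monomial subst_mono_add)
    thus ?case unfolding msubst_monomial Const_mult by (simp only: ac_simps)
  qed (simp add: distrib_left msubst_add)
qed (simp add: distrib_right msubst_add)

lemma msubst_0 [simp]: "msubst \<sigma> 0 = 0"
  by (simp add: msubst_def)

lemma msubst_Const [simp]: "msubst \<sigma> (Const c) = Const c"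
  by (simp add: msubst_monomial)

lemma msubst_1 [simp]: "msubst \<sigma> 1 = 1"
  using msubst_Const [of \<sigma> 1] by simp

lemma msubst_of_Var [simp]: "msubst \<sigma> (Var i) = \<sigma> i"
  by (simp add: msubst_monomial)

lemma msubst_uminus: "msubst \<sigma> (- f) = - msubst \<sigma> f"
  using msubst_add [of \<sigma> f "- f"] by (simp add: eq_neg_iff_add_eq_0 add.commute)

lemma msubst_diff: "msubst \<sigma> (f - g) = msubst \<sigma> f - msubst \<sigma> g"
  using msubst_add [of \<sigma> f "- g"] by (simp add: msubst_uminus)

lemma msubst_power: "msubst \<sigma> (f ^ k) = msubst \<sigma> f ^ k"
  by (induction k) (simp_all add: msubst_mult)

lemma msubst_sum: "msubst \<sigma> (\<Sum>i\<in>A. f i) = (\<Sum>i\<in>A. msubst \<sigma> (f i))"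
  by (induction A rule: infinite_finite_induct) (simp_all add: msubst_add)

lemma msubst_prod: "msubst \<sigma> (\<Prod>i\<in>A. f i) = (\<Prod>i\<in>A. msubst \<sigma> (f i))"
  by (induction A rule: infinite_finite_induct) (simp_all add: msubst_mult)

lemmas msubst_hom = msubst_add msubst_diff msubst_mult msubst_uminus msubst_power

text \<open>Makes substitutions compose on indices, so that the Coxeter relations of the s_i and
  their relations with \<omega> reduce to identities of maps on the indices.\<close>

lemma msubst_msubst: "msubst \<sigma> (msubst \<rho> f) = msubst (\<lambda>i. msubst \<sigma> (\<rho> i)) f"
proof (induction f rule: mpoly_induct)
  case (monomial \<mu> c)
  show ?case
    by (simp add: msubst_monomial msubst_mult subst_mono_def msubst_prod msubst_power)
qed (simp add: msubst_add)

lemma subst_mono_Var: "subst_mono Var \<mu> = single \<mu> 1"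
  using msubst_Var [of "single \<mu> 1"] by (simp add: msubst_monomial)

lemma swap_swap [simp]: "swap i (swap i f) = f"
  by (simp add: swap_def msubst_msubst msubst_Var)

lemma swap_Const [simp]: "swap i (Const c) = Const c"
  by (simp add: swap_def)

lemma swap_Var: "swap i (Var k) = Var (transpose i (Suc i) k)"
  by (simp add: swap_def)

lemma swap_1 [simp]: "swap i 1 = 1"
  by (simp add: swap_def)

lemma swap_add: "swap i (f + g) = swap i f + swap i g"
  and swap_mult: "swap i (f * g) = swap i f * swap i g"
  and swap_diff: "swap i (f - g) = swap i f - swap i g"
  and swap_uminus: "swap i (- f) = - swap i f"
  and swap_sum: "swap i (\<Sum>a\<in>A. h a) = (\<Sum>a\<in>A. swap i (h a))"
  by (simp_all add: swap_def msubst_hom msubst_sum)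

lemma swap_braid: "swap i (swap (Suc i) (swap i f)) = swap (Suc i) (swap i (swap (Suc i) f))"
proof -
  have "transpose i (Suc i) (transpose (Suc i) (Suc (Suc i)) (transpose i (Suc i) k))
     = transpose (Suc i) (Suc (Suc i)) (transpose i (Suc i) (transpose (Suc i) (Suc (Suc i)) k))" for k
    by (auto simp: transpose_def)
  thus ?thesis by (simp add: swap_def msubst_msubst)
qed

lemma swap_commute: "Suc i < j \<Longrightarrow> swap i (swap j f) = swap j (swap i f)"
proof -
  assume "Suc i < j"
  hence "transpose i (Suc i) (transpose j (Suc j) k) = transpose j (Suc j) (transpose i (Suc i) k)" for k
    by (auto simp: transpose_def)
  thus ?thesis by (simp add: swap_def msubst_msubst)
qed


section \<open>The Hecke operators\<close>

lemma Var_neq: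
  assumes "i \<noteq> j"
  shows "Var i - Var j \<noteq> 0"
proof
  assume eq: "Var i - Var j = 0"
  have "lookup (single i (1::nat)) i \<noteq> lookup (single j (1::nat)) i"
    using assms by (simp add: lookup_single_not_eq)
  hence "single j (1::nat) \<noteq> single i 1" by metis
  hence "lookup (Var i - Var j) (single i 1) = 1"
    by (simp add: lookup_minus lookup_single_not_eq)
  with eq show False by simp
qed

lemma Var_noteq: "i \<noteq> j \<Longrightarrow> Var i \<noteq> Var j"
  using Var_neq [of i j] by simp

text \<open>Clearing the denominator z_i - z_(i+1) replaces the quotient in the definition by a
  polynomial identity. As there are no zero divisors, this identity characterises T_i f
  (\<open>hecke_T_unique\<close>), and the relations below are checked in this form.\<close>

lemma hecke_T_eq:
  "(Var i - Var (Suc i)) * hecke_T i f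
     = (Const tt * Var i - Var (Suc i)) * swap i f - (Const tt - 1) * Var (Suc i) * f"
proof -
  let ?g = "THE g. (Var i - Var (Suc i)) * g = swap i f - f"
  have g: "(Var i - Var (Suc i)) * ?g = swap i f - f"
    by (rule theI' [OF swap_quotient])
  have "(Var i - Var (Suc i)) * hecke_T i f
     = Const tt * (Var i - Var (Suc i)) * f
       + (Const tt * Var i - Var (Suc i)) * ((Var i - Var (Suc i)) * ?g)"
    unfolding hecke_T_def by (simp add: algebra_simps)
  thus ?thesis unfolding g by (simp add: algebra_simps)
qed

lemma hecke_T_unique:
  assumes "(Var i - Var (Suc i)) * g
     = (Const tt * Var i - Var (Suc i)) * swap i f - (Const tt - 1) * Var (Suc i) * f"
  shows "hecke_T i f = g"
  using assms hecke_T_eq [of i f] Var_neq [of i "Suc i"] by (metis mult_left_cancel n_not_Suc_n)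

lemma hecke_T_add: "hecke_T i (f + g) = hecke_T i f + hecke_T i g"
proof (rule hecke_T_unique)
  show "(Var i - Var (Suc i)) * (hecke_T i f + hecke_T i g)
     = (Const tt * Var i - Var (Suc i)) * swap i (f + g) - (Const tt - 1) * Var (Suc i) * (f + g)"
    unfolding distrib_left [of _ "hecke_T i f"] hecke_T_eq by (simp add: swap_add algebra_simps)
qed

text \<open>A factor fixed by s_i can be pulled out of the characterising identity. Constants,
  variables other than z_i and z_(i+1), and e_1 are the instances used later.\<close>

lemma hecke_T_mult_symmetric:
  assumes "swap i p = p"
  shows "hecke_T i (p * f) = p * hecke_T i f"
proof (rule hecke_T_unique)
  have "(Var i - Var (Suc i)) * (p * hecke_T i f) = p * ((Var i - Var (Suc i)) * hecke_T i f)"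
    by (rule mult.left_commute)
  thus "(Var i - Var (Suc i)) * (p * hecke_T i f)
     = (Const tt * Var i - Var (Suc i)) * swap i (p * f) - (Const tt - 1) * Var (Suc i) * (p * f)"
    unfolding hecke_T_eq by (simp add: swap_mult assms algebra_simps)
qed

lemma hecke_T_Const: "hecke_T i (Const c * f) = Const c * hecke_T i f"
  by (rule hecke_T_mult_symmetric) simp

lemma hecke_T_1: "hecke_T i 1 = Const tt"
  by (rule hecke_T_unique) (simp add: algebra_simps)

text \<open>The image of \<open>hecke_T_eq\<close> under s_i; it controls s_i T_i f, which appears
  whenever T_i is applied twice.\<close>

lemma hecke_T_swap_eq:
  "(Var (Suc i) - Var i) * swap i (hecke_T i f)
     = (Const tt * Var (Suc i) - Var i) * f - (Const tt - 1) * Var i * swap i f"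
  using arg_cong [OF hecke_T_eq [of i f], of "swap i"] by (simp add: swap_mult swap_diff swap_Var)

lemma hecke_T_quadratic: "hecke_T i (hecke_T i f) = (Const tt - 1) * hecke_T i f + Const tt * f"
proof (rule hecke_T_unique)
  \<comment> \<open>Here u and v stand for T_i f and s_i T_i f, and g for s_i f. With a further
    factor x - y they occur only in the two products known from the hypotheses, which leaves a
    polynomial identity in f and g.\<close>
  have aux: "(x - y) * ((x - y) * ((t - 1) * u + t * f) - ((t * x - y) * v - (t - 1) * y * u)) = 0"
    if u: "(x - y) * u = (t * x - y) * g - (t - 1) * y * f"
      and v: "(y - x) * v = (t * y - x) * f - (t - 1) * x * g" for x y t u v f g :: mpoly
  proof -
    have "(x - y) * ((x - y) * ((t - 1) * u + t * f) - ((t * x - y) * v - (t - 1) * y * u))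
      = ((x - y) * (t - 1) + (t - 1) * y) * ((x - y) * u) + (x - y)\<^sup>2 * t * f
        + (t * x - y) * ((y - x) * v)"
      by algebra
    also have "\<dots> = 0" unfolding u v by algebra
    finally show ?thesis .
  qed
  show "(Var i - Var (Suc i)) * ((Const tt - 1) * hecke_T i f + Const tt * f)
    = (Const tt * Var i - Var (Suc i)) * swap i (hecke_T i f) - (Const tt - 1) * Var (Suc i) * hecke_T i f"
    using aux [OF hecke_T_eq hecke_T_swap_eq, of i f] Var_neq [of i "Suc i"] by simp
qed

lemma hecke_T_Var_commute:
  assumes "k \<noteq> i" "k \<noteq> Suc i"
  shows "hecke_T i (Var k * f) = Var k * hecke_T i f"
  using assms by (intro hecke_T_mult_symmetric) (simp add: swap_Var)

text \<open>An affine Hecke relation. It carries a variable through a chain of T's and trades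
  inverses for T's or conversely, as in \<open>hecke_dn_Var\<close> and
  \<open>Y_1_raise\<close>.\<close>

lemma hecke_T_Var: "hecke_T i (Var i * hecke_T i f) = Const tt * (Var (Suc i) * f)"
proof (rule hecke_T_unique)
  have aux: "(x - y) * ((x - y) * (t * (y * f)) - ((t * x - y) * (y * v) - (t - 1) * y * (x * u))) = 0"
    if u: "(x - y) * u = (t * x - y) * g - (t - 1) * y * f"
      and v: "(y - x) * v = (t * y - x) * f - (t - 1) * x * g" for x y t u v f g :: mpoly
  proof -
    have "(x - y) * ((x - y) * (t * (y * f)) - ((t * x - y) * (y * v) - (t - 1) * y * (x * u)))
      = (x - y)\<^sup>2 * (t * y * f) + (t * x - y) * y * ((y - x) * v) + (t - 1) * y * x * ((x - y) * u)"
      by algebra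
    also have "\<dots> = 0" unfolding u v by algebra
    finally show ?thesis .
  qed
  show "(Var i - Var (Suc i)) * (Const tt * (Var (Suc i) * f))
    = (Const tt * Var i - Var (Suc i)) * swap i (Var i * hecke_T i f)
      - (Const tt - 1) * Var (Suc i) * (Var i * hecke_T i f)"
    using aux [OF hecke_T_eq hecke_T_swap_eq, of i f] Var_neq [of i "Suc i"]
    by (simp add: swap_mult swap_Var)
qed

lemma hecke_T_commute:
  assumes "Suc i < j"
  shows "hecke_T i (hecke_T j f) = hecke_T j (hecke_T i f)"
proof (rule hecke_T_unique)
  let ?x = "Var i" and ?y = "Var (Suc i)" and ?t = "Const tt"
  have c: "swap j (?x - ?y) = ?x - ?y" "swap j (?t * ?x - ?y) = ?t * ?x - ?y"
    "swap j ((?t - 1) * ?y) = (?t - 1) * ?y"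
    using assms by (simp_all add: swap_mult swap_diff swap_Var)
  \<comment> \<open>The transposition s_i fixes z_j and z_(j+1) and commutes with s_j, hence it
    commutes with T_j.\<close>
  have T: "hecke_T j (swap i f) = swap i (hecke_T j f)"
  proof (rule hecke_T_unique)
    show "(Var j - Var (Suc j)) * swap i (hecke_T j f) = (Const tt * Var j - Var (Suc j)) * swap j (swap i f)
       - (Const tt - 1) * Var (Suc j) * swap i f"
      using arg_cong [OF hecke_T_eq [of j f], of "swap i"] assms
      by (simp add: swap_mult swap_diff swap_Var swap_commute [OF assms])
  qed
  have "(?x - ?y) * hecke_T j (hecke_T i f) = hecke_T j ((?x - ?y) * hecke_T i f)"
    by (simp add: hecke_T_mult_symmetric c)
  also have "\<dots> = hecke_T j ((?t * ?x - ?y) * swap i f + (- ((?t - 1) * ?y)) * f)"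
    unfolding hecke_T_eq by simp
  also have "\<dots> = (?t * ?x - ?y) * hecke_T j (swap i f) + (- ((?t - 1) * ?y)) * hecke_T j f"
    unfolding hecke_T_add
    by (intro arg_cong2 [where f = "(+)"] hecke_T_mult_symmetric) (simp_all only: c swap_uminus)
  finally show "(?x - ?y) * hecke_T j (hecke_T i f)
     = (?t * ?x - ?y) * swap i (hecke_T j f) - (?t - 1) * ?y * hecke_T j f"
    by (simp add: T)
qed

text \<open>Both sides of the braid relation, multiplied by
  \<open>(z\<^sub>1 - z\<^sub>2)\<^sup>2 (z\<^sub>1 - z\<^sub>3) (z\<^sub>2 - z\<^sub>3)\<^sup>2\<close>, are the same combination of the six images of \<open>f\<close>
  under the symmetric group.\<close>

lemma hecke_T_braid:
  "hecke_T i (hecke_T (Suc i) (hecke_T i f)) = hecke_T (Suc i) (hecke_T i (hecke_T (Suc i) f))"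
proof -
  let ?j = "Suc i"
  define x y z t where "x = Var i" and "y = Var (Suc i)" and "z = Var (Suc (Suc i))" and "t = Const tt"
  define a b where "a = swap i" and "b = swap (Suc i)"
  define S T where "S = hecke_T i" and "T = hecke_T (Suc i)"
  have S: "(x - y) * S g = (t * x - y) * a g - (t - 1) * y * g" for g
    unfolding S_def x_def y_def t_def a_def by (rule hecke_T_eq)
  have T: "(y - z) * T g = (t * y - z) * b g - (t - 1) * z * g" for g
    unfolding T_def z_def y_def t_def b_def by (rule hecke_T_eq)
  have hom: "a (u * v) = a u * a v" "a (u - v) = a u - a v" "b (u * v) = b u * b v" "b (u - v) = b u - b v" for u v
    by (simp_all add: a_def b_def swap_mult swap_diff)
  have val: "a x = y" "a y = x" "a z = z" "b x = x" "b y = z" "b z = y" "a t = t" "b t = t" "a 1 = 1" "b 1 = 1"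
    by (simp_all add: a_def b_def x_def y_def z_def t_def swap_Var)
  have inv: "a (a g) = g" "b (b g) = g" for g by (simp_all add: a_def b_def)
  have br: "b (a (b g)) = a (b (a g))" for g by (simp add: a_def b_def swap_braid)
  have aS: "(y - x) * a (S g) = (t * y - x) * g - (t - 1) * x * a g" for g
    using arg_cong [OF S [of g], of a] by (simp add: hom val inv)
  have bS: "(x - z) * b (S g) = (t * x - z) * b (a g) - (t - 1) * z * b g" for g
    using arg_cong [OF S [of g], of b] by (simp add: hom val inv)
  have abS: "(y - z) * a (b (S g)) = (t * y - z) * a (b (a g)) - (t - 1) * z * a (b g)" for g
    using arg_cong [OF bS [of g], of a] by (simp add: hom val inv)
  have bT: "(z - y) * b (T g) = (t * z - y) * g - (t - 1) * y * b g" for g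
    using arg_cong [OF T [of g], of b] by (simp add: hom val inv)
  have aT: "(x - z) * a (T g) = (t * x - z) * a (b g) - (t - 1) * z * a g" for g
    using arg_cong [OF T [of g], of a] by (simp add: hom val inv)
  have baT: "(x - y) * b (a (T g)) = (t * x - y) * a (b (a g)) - (t - 1) * y * b (a g)" for g
    using arg_cong [OF aT [of g], of b] by (simp add: hom val inv br)
  let ?D = "(x - y) * (x - y) * (x - z) * (y - z) * (y - z)"
  define f0 f1 f2 f3 f4 f5 where "f0 = f" and "f1 = a f" and "f2 = b f" and "f3 = a (b f)"
    and "f4 = b (a f)" and "f5 = a (b (a f))"
  have "?D * S (T (S f)) = (x - y) * (y - z) * (y - z) * (x - z) * ((x - y) * S (T (S f)))"
    by (simp add: algebra_simps)
  also have "\<dots> = (x - y) * (y - z) * (y - z) * (t * x - y) * ((x - z) * a (T (S f)))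
      - (t - 1) * y * (x - y) * (x - z) * (y - z) * ((y - z) * T (S f))"
    unfolding S [of "T (S f)"] by (simp add: algebra_simps)
  also have "\<dots> = (x - y) * (y - z) * (t * x - y) * (t * x - z) * ((y - z) * a (b (S f)))
       + (y - z) * (y - z) * (t * x - y) * (t - 1) * z * ((y - x) * a (S f))
      - (t - 1) * y * (x - y) * (y - z) * (t * y - z) * ((x - z) * b (S f))
      + (t - 1) * (t - 1) * y * z * (x - z) * (y - z) * ((x - y) * S f)"
    unfolding aT T by (simp add: algebra_simps)
  finally have 1: "?D * S (T (S f)) = (x - y) * (y - z) * (t * x - y) * (t * x - z)
          * ((t * y - z) * f5 - (t - 1) * z * f3)
       + (y - z) * (y - z) * (t * x - y) * (t - 1) * z * ((t * y - x) * f0 - (t - 1) * x * f1)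
      - (t - 1) * y * (x - y) * (y - z) * (t * y - z) * ((t * x - z) * f4 - (t - 1) * z * f2)
      + (t - 1) * (t - 1) * y * z * (x - z) * (y - z) * ((t * x - y) * f1 - (t - 1) * y * f0)"
    unfolding abS aS bS S f0_def f1_def f2_def f3_def f4_def f5_def .
  have "?D * T (S (T f)) = (x - y) * (x - y) * (x - z) * (y - z) * ((y - z) * T (S (T f)))"
    by (simp add: algebra_simps)
  also have "\<dots> = (x - y) * (x - y) * (y - z) * (t * y - z) * ((x - z) * b (S (T f)))
      - (t - 1) * z * (x - y) * (x - z) * (y - z) * ((x - y) * S (T f))"
    unfolding T [of "S (T f)"] by (simp add: algebra_simps)
  also have "\<dots> = (x - y) * (y - z) * (t * y - z) * (t * x - z) * ((x - y) * b (a (T f)))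
       + (x - y) * (x - y) * (t * y - z) * (t - 1) * z * ((z - y) * b (T f))
      - (t - 1) * z * (x - y) * (y - z) * (t * x - y) * ((x - z) * a (T f))
      + (t - 1) * (t - 1) * y * z * (x - z) * (x - y) * ((y - z) * T f)"
    unfolding bS S by (simp add: algebra_simps)
  finally have 2: "?D * T (S (T f)) = (x - y) * (y - z) * (t * y - z) * (t * x - z)
         * ((t * x - y) * f5 - (t - 1) * y * f4)
       + (x - y) * (x - y) * (t * y - z) * (t - 1) * z * ((t * z - y) * f0 - (t - 1) * y * f2)
      - (t - 1) * z * (x - y) * (y - z) * (t * x - y) * ((t * x - z) * f3 - (t - 1) * z * f1)
      + (t - 1) * (t - 1) * y * z * (x - z) * (x - y) * ((t * y - z) * f2 - (t - 1) * z * f0)"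
    unfolding baT bT aT T f0_def f1_def f2_def f3_def f4_def f5_def .
  have "?D * S (T (S f)) = ?D * T (S (T f))"
    unfolding 1 2 by algebra
  moreover have "?D \<noteq> 0" unfolding x_def y_def z_def using Var_noteq by auto
  ultimately show ?thesis unfolding S_def T_def by (metis mult_left_cancel)
qed

lemma tt_neq_0 [simp]: "tt \<noteq> 0" and qq_neq_0 [simp]: "qq \<noteq> 0"
  by (simp_all add: tt_def qq_def Zero_fract_def eq_fract)

lemma Const_inverse_mult [simp]:
  "c \<noteq> 0 \<Longrightarrow> Const (inverse c) * (Const c * f) = f"
  "c \<noteq> 0 \<Longrightarrow> Const c * (Const (inverse c) * f) = f"
  by (simp_all add: Const_mult [symmetric] mult.assoc [symmetric])

lemma Const_mult_eq_iff: "c \<noteq> 0 \<Longrightarrow> Const c * f = g \<longleftrightarrow> f = Const (inverse c) * g"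
  by auto

section \<open>Linear operators, inverse Hecke operators and chains of them\<close>

definition linear_op :: "(mpoly \<Rightarrow> mpoly) \<Rightarrow> bool" where
  "linear_op L \<longleftrightarrow> (\<forall>f g. L (f + g) = L f + L g) \<and> (\<forall>c f. L (Const c * f) = Const c * L f)"

lemma linear_op_add: "linear_op L \<Longrightarrow> L (f + g) = L f + L g"
  and linear_op_Const: "linear_op L \<Longrightarrow> L (Const c * f) = Const c * L f"
  by (simp_all add: linear_op_def)

lemma linear_op_0: "linear_op L \<Longrightarrow> L 0 = 0"
  using linear_op_Const [of L 0 0] by simp

lemma linear_op_diff: "linear_op L \<Longrightarrow> L (f - g) = L f - L g"
  using linear_op_add [of L "f - g" g] by (simp add: algebra_simps)

lemma linear_op_sum: "linear_op L \<Longrightarrow> L (\<Sum>i\<in>A. h i) = (\<Sum>i\<in>A. L (h i))"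
  by (induction A rule: infinite_finite_induct) (simp_all add: linear_op_0 linear_op_add)

lemma linear_op_foldr:
  "(\<And>i. i \<in> set xs \<Longrightarrow> linear_op (L i)) \<Longrightarrow> linear_op (foldr L xs)"
  by (induction xs) (simp_all add: linear_op_def)

lemma linear_op_mult: "linear_op (\<lambda>f. g * f)"
  by (simp add: linear_op_def distrib_left mult.left_commute)

lemma linear_hecke_T: "linear_op (hecke_T i)"
  by (simp add: linear_op_def hecke_T_add hecke_T_Const)

lemmas hecke_T_diff = linear_op_diff [OF linear_hecke_T]

text \<open>The quadratic relation in the form T_i (T_i - (t - 1)) = t, read as a formula for the
  inverse.\<close>

definition hecke_inv :: "nat \<Rightarrow> mpoly \<Rightarrow> mpoly" where
  "hecke_inv i f = Const (inverse tt) * (hecke_T i f - (Const tt - 1) * f)"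

lemma hecke_T_scale: "hecke_T i ((Const tt - 1) * f) = (Const tt - 1) * hecke_T i f"
  by (rule hecke_T_mult_symmetric) (simp add: swap_diff)

lemma hecke_T_inv [simp]: "hecke_T i (hecke_inv i f) = f"
  by (simp add: hecke_inv_def hecke_T_Const hecke_T_diff hecke_T_scale hecke_T_quadratic)

lemma hecke_inv_T [simp]: "hecke_inv i (hecke_T i f) = f"
  by (simp add: hecke_inv_def hecke_T_quadratic)

lemma inv_hecke_T: "inv (hecke_T i) = hecke_inv i"
  by (rule inv_equality) simp_all

lemma hecke_T_via_inv: "hecke_T i f = Const tt * hecke_inv i f + (Const tt - 1) * f"
  by (simp add: hecke_inv_def)

lemma linear_hecke_inv: "linear_op (hecke_inv i)"
  unfolding linear_op_def hecke_inv_def hecke_T_add hecke_T_Const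
  by (simp add: algebra_simps)

text \<open>Insert T_i^{-1} f into the hypothesis and cancel: every relation that moves a T through
  L holds for the inverses too.\<close>

lemma hecke_inv_intertwine:
  assumes "\<And>f. L (hecke_T i f) = hecke_T j (L f)"
  shows "L (hecke_inv i f) = hecke_inv j (L f)"
  using assms [of "hecke_inv i f"] by simp

text \<open>The left factor T_i ... T_(n-1) of Y_i; \<open>hecke_dn i\<close> is the right factor
  T_1^{-1} ... T_(i-1)^{-1}.\<close>

definition hecke_up :: "nat \<Rightarrow> nat \<Rightarrow> mpoly \<Rightarrow> mpoly" where
  "hecke_up i n = foldr hecke_T [i..<n]"

definition hecke_dn :: "nat \<Rightarrow> mpoly \<Rightarrow> mpoly" where
  "hecke_dn i = foldr hecke_inv [1..<i]"

lemma hecke_up_refl [simp]: "n \<le> i \<Longrightarrow> hecke_up i n f = f"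
  by (simp add: hecke_up_def)

lemma hecke_up_step: "i < n \<Longrightarrow> hecke_up i n f = hecke_T i (hecke_up (Suc i) n f)"
  by (simp add: hecke_up_def upt_conv_Cons)

lemma hecke_up_last: "i \<le> n \<Longrightarrow> hecke_up i (Suc n) f = hecke_up i n (hecke_T n f)"
  by (simp add: hecke_up_def)

lemma hecke_dn_le_1 [simp]: "i \<le> 1 \<Longrightarrow> hecke_dn i f = f"
  by (simp add: hecke_dn_def)

lemma hecke_dn_Suc: "1 \<le> i \<Longrightarrow> hecke_dn (Suc i) f = hecke_dn i (hecke_inv i f)"
  by (simp add: hecke_dn_def)

lemma linear_hecke_up: "linear_op (hecke_up i n)"
  unfolding hecke_up_def by (intro linear_op_foldr linear_hecke_T)

lemma linear_hecke_dn: "linear_op (hecke_dn i)"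
  unfolding hecke_dn_def by (intro linear_op_foldr linear_hecke_inv)

lemma hecke_up_far: "Suc j < i \<Longrightarrow> hecke_T j (hecke_up i n f) = hecke_up i n (hecke_T j f)"
proof (induction "n - i" arbitrary: i)
  case (Suc d)
  hence "hecke_T j (hecke_T i (hecke_up (Suc i) n f)) = hecke_T i (hecke_up (Suc i) n (hecke_T j f))"
    by (simp add: hecke_T_commute)
  with Suc show ?case by (simp add: hecke_up_step)
qed simp

text \<open>In T_(j+1) T_j T_(j+1) the braid relation turns the outer T_(j+1) into a T_j on the
  right; all other factors of the chain commute with the one that is moved.\<close>

lemma hecke_up_shift:
  assumes "i \<le> j" "Suc j < n"
  shows "hecke_T (Suc j) (hecke_up i n f) = hecke_up i n (hecke_T j f)"
  using assms
proof (induction "j - i" arbitrary: i)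
  case 0
  hence [simp]: "i = j" by simp
  have "hecke_up j n g = hecke_T j (hecke_T (Suc j) (hecke_up (Suc (Suc j)) n g))" for g
    using 0 by (simp add: hecke_up_step)
  thus ?case by (simp add: hecke_T_braid [symmetric] hecke_up_far)
next
  case (Suc d)
  hence IH: "hecke_T (Suc j) (hecke_up (Suc i) n f) = hecke_up (Suc i) n (hecke_T j f)" by simp
  have "hecke_T (Suc j) (hecke_T i (hecke_up (Suc i) n f)) = hecke_T i (hecke_up (Suc i) n (hecke_T j f))"
    unfolding IH [symmetric] using Suc by (intro hecke_T_commute [symmetric]) simp
  with Suc show ?case by (simp add: hecke_up_step)
qed

lemma hecke_inv_commute:
  assumes "Suc i < j \<or> Suc j < i"
  shows "hecke_T i (hecke_inv j f) = hecke_inv j (hecke_T i f)"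
  using assms by (intro hecke_inv_intertwine) (auto intro: hecke_T_commute hecke_T_commute [symmetric])

lemma hecke_inv_braid:
  "hecke_inv j (hecke_inv (Suc j) (hecke_T j f)) = hecke_T (Suc j) (hecke_inv j (hecke_inv (Suc j) f))"
proof -
  define g where "g = hecke_inv j (hecke_inv (Suc j) f)"
  hence "f = hecke_T (Suc j) (hecke_T j g)" by simp
  thus ?thesis by (simp add: hecke_T_braid)
qed

lemma hecke_dn_far: "i < j \<Longrightarrow> hecke_dn i (hecke_T j f) = hecke_T j (hecke_dn i f)"
proof (induction i arbitrary: f)
  case (Suc i)
  thus ?case by (cases "i = 0") (simp_all add: hecke_dn_Suc hecke_inv_commute [symmetric])
qed (simp add: hecke_dn_def)

lemma hecke_dn_shift:
  assumes "1 \<le> j" "Suc j < i"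
  shows "hecke_dn i (hecke_T j f) = hecke_T (Suc j) (hecke_dn i f)"
  using assms(2)
proof (induction i arbitrary: f)
  case (Suc i)
  show ?case
  proof (cases "i = Suc j")
    case True
    have "hecke_dn (Suc i) g = hecke_dn j (hecke_inv j (hecke_inv (Suc j) g))" for g
      using assms(1) by (simp add: True hecke_dn_Suc)
    thus ?thesis by (simp add: hecke_inv_braid hecke_dn_far)
  next
    case False
    with Suc have "Suc j < i" by simp
    with Suc show ?thesis by (simp add: hecke_dn_Suc hecke_inv_commute [symmetric])
  qed
qed simp


section \<open>The affine generators\<close>

definition omega_subst :: "nat \<Rightarrow> nat \<Rightarrow> mpoly" where
  "omega_subst n k = (if k = 1 then Const qq * Var n else if 2 \<le> k \<and> k \<le> n then Var (k - 1) else Var k)"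

text \<open>The product of the s_k and \<tau>_1 is a single substitution, so \<omega> is a ring
  homomorphism.\<close>

lemma omega_op_eq: "1 \<le> n \<Longrightarrow> omega_op n = msubst (omega_subst n)"
proof (induction n rule: nat_induct_at_least)
  case base
  have "omega_subst 1 = (\<lambda>k. if k = 1 then Const qq * Var 1 else Var k)"
    by (auto simp: omega_subst_def)
  thus ?case by (simp add: omega_op_def q_shift_def)
next
  case (Suc n)
  have "msubst (\<lambda>k. Var (transpose n (Suc n) k)) (omega_subst n k) = omega_subst (Suc n) k" for k
    using Suc.hyps by (auto simp: omega_subst_def msubst_mult transpose_def)
  hence "omega_op (Suc n) f = msubst (omega_subst (Suc n)) f" for f
    using Suc by (simp add: omega_op_def swap_def msubst_msubst)
  thus ?case by blast
qed

context
  fixes n :: nat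
  assumes n: "1 \<le> n"
begin

lemma omega_add: "omega_op n (f + g) = omega_op n f + omega_op n g"
  and omega_mult: "omega_op n (f * g) = omega_op n f * omega_op n g"
  and omega_diff: "omega_op n (f - g) = omega_op n f - omega_op n g"
  and omega_Const [simp]: "omega_op n (Const c) = Const c"
  and omega_1 [simp]: "omega_op n 1 = 1"
  and omega_Var: "omega_op n (Var k) = omega_subst n k"
  and omega_sum: "omega_op n (\<Sum>a\<in>A. h a) = (\<Sum>a\<in>A. omega_op n (h a))"
  using n by (simp_all add: omega_op_eq msubst_hom msubst_sum)

lemma omega_swap:
  assumes "1 \<le> j" "Suc j < n"
  shows "omega_op n (swap (Suc j) f) = swap j (omega_op n f)"
proof -
  have "msubst (omega_subst n) (Var (transpose (Suc j) (Suc (Suc j)) k))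
      = msubst (\<lambda>k. Var (transpose j (Suc j) k)) (omega_subst n k)" for k
    unfolding msubst_of_Var using assms
    by (auto simp: omega_subst_def msubst_mult transpose_def)
  thus ?thesis using n by (simp add: omega_op_eq swap_def msubst_msubst)
qed

text \<open>The homomorphism \<omega> lowers the indices j + 1 and j + 2 by one and so carries the
  identity that characterises T_(j+1) to the one for T_j.\<close>

lemma omega_hecke_T:
  assumes "1 \<le> j" "Suc j < n"
  shows "omega_op n (hecke_T (Suc j) f) = hecke_T j (omega_op n f)"
proof (rule hecke_T_unique [symmetric])
  have "omega_op n (Var (Suc j)) = Var j" "omega_op n (Var (Suc (Suc j))) = Var (Suc j)"
    using assms by (simp_all add: omega_Var omega_subst_def)
  thus "(Var j - Var (Suc j)) * omega_op n (hecke_T (Suc j) f)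
     = (Const tt * Var j - Var (Suc j)) * swap j (omega_op n f)
       - (Const tt - 1) * Var (Suc j) * omega_op n f"
    using arg_cong [OF hecke_T_eq [of "Suc j" f], of "omega_op n"]
    by (simp add: omega_mult omega_diff omega_swap [OF assms])
qed

lemma omega_hecke_up:
  assumes "1 \<le> i" "m < n"
  shows "omega_op n (hecke_up (Suc i) (Suc m) f) = hecke_up i m (omega_op n f)"
  using assms
proof (induction m arbitrary: f)
  case (Suc m)
  show ?case
  proof (cases "i \<le> m")
    case True
    with Suc show ?thesis by (simp add: hecke_up_last omega_hecke_T)
  qed simp
qed simp

text \<open>A single \<omega> separates z_1, z_2 into q z_n, z_1. Its square sends them to q
  z_(n-1), q z_n, and the common factor q cancels because the characterising identity is homogeneous
  in the two variables.\<close>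

lemma omega_omega_hecke_T:
  assumes "2 \<le> n"
  shows "omega_op n (omega_op n (hecke_T 1 f)) = hecke_T (n - 1) (omega_op n (omega_op n f))"
proof (rule hecke_T_unique [symmetric])
  have S: "Suc (n - 1) = n" using assms by simp
  have v: "omega_op n (omega_op n (Var 1)) = Const qq * Var (n - 1)"
    "omega_op n (omega_op n (Var 2)) = Const qq * Var n"
    using assms by (auto simp: omega_Var omega_subst_def omega_mult)
  have s: "omega_op n (omega_op n (swap 1 g)) = swap (n - 1) (omega_op n (omega_op n g))" for g
  proof -
    have "msubst (omega_subst n) (msubst (omega_subst n) (Var (transpose 1 (Suc 1) k)))
      = msubst (\<lambda>k. Var (transpose (n - 1) n k)) (msubst (omega_subst n) (omega_subst n k))" for k
    proof -
      consider "k = 1" | "k = 2" | "3 \<le> k" "k \<le> n"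
        | "k \<noteq> 1" "k \<noteq> 2" "\<not> (2 \<le> k \<and> k \<le> n)" "k \<noteq> n" "k \<noteq> n - 1"
        using assms by linarith
      thus ?thesis
      proof cases
        case 4
        thus ?thesis by (simp add: omega_subst_def transpose_def)
      qed (use assms in \<open>auto simp: omega_subst_def msubst_mult transpose_def\<close>)
    qed
    thus ?thesis using n by (simp add: omega_op_eq swap_def msubst_msubst S)
  qed
  have "(Const qq * Var (n - 1) - Const qq * Var n) * omega_op n (omega_op n (hecke_T 1 f))
    = (Const tt * (Const qq * Var (n - 1)) - Const qq * Var n) * swap (n - 1) (omega_op n (omega_op n f))
       - (Const tt - 1) * (Const qq * Var n) * omega_op n (omega_op n f)"
    using arg_cong [OF hecke_T_eq [of 1 f], of "\<lambda>f. omega_op n (omega_op n f)"]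
    by (simp add: omega_mult omega_diff s v)
  hence "Const qq * ((Var (n - 1) - Var n) * omega_op n (omega_op n (hecke_T 1 f)))
    = Const qq * ((Const tt * Var (n - 1) - Var n) * swap (n - 1) (omega_op n (omega_op n f))
       - (Const tt - 1) * Var n * omega_op n (omega_op n f))"
    by (simp only: algebra_simps)
  moreover have "Const qq \<noteq> 0" by (metis lookup_single_eq lookup_zero qq_neq_0)
  ultimately show "(Var (n - 1) - Var (Suc (n - 1))) * omega_op n (omega_op n (hecke_T 1 f))
     = (Const tt * Var (n - 1) - Var (Suc (n - 1))) * swap (n - 1) (omega_op n (omega_op n f))
       - (Const tt - 1) * Var (Suc (n - 1)) * omega_op n (omega_op n f)"
    unfolding S by (metis mult_left_cancel)
qed

lemma cherednik_Y_eq: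
  "cherednik_Y n i f
     = Const (tt powi (int i - int n)) * hecke_up i n (omega_op n (hecke_dn i f))"
proof -
  have comp: "foldr (\<circ>) (map L xs) id g = foldr L xs g" for L :: "nat \<Rightarrow> mpoly \<Rightarrow> mpoly" and xs g
    by (induction xs) simp_all
  show ?thesis
    by (simp add: cherednik_Y_def comp inv_hecke_T hecke_up_def hecke_dn_def)
qed

lemma linear_Y: "linear_op (cherednik_Y n i)"
  unfolding linear_op_def cherednik_Y_eq
  by (simp add: linear_op_add [OF linear_hecke_dn] linear_op_Const [OF linear_hecke_dn]
      omega_add omega_mult linear_op_add [OF linear_hecke_up] linear_op_Const [OF linear_hecke_up]
      distrib_left mult.left_commute)

section \<open>Relations between the Y_i and the T_j\<close>

lemma Y_hecke_low:
  assumes "1 \<le> j" "Suc j < i" "i \<le> n"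
  shows "cherednik_Y n i (hecke_T j f) = hecke_T j (cherednik_Y n i f)"
  using assms by (simp add: cherednik_Y_eq hecke_dn_shift omega_hecke_T hecke_up_far hecke_T_Const)

lemma Y_hecke_high:
  assumes "1 \<le> i" "i < j" "j < n"
  shows "cherednik_Y n i (hecke_T j f) = hecke_T j (cherednik_Y n i f)"
proof -
  obtain k where [simp]: "j = Suc k" using assms by (cases j) auto
  show ?thesis
    using assms by (simp add: cherednik_Y_eq hecke_dn_far omega_hecke_T hecke_up_shift hecke_T_Const)
qed

text \<open>The outer T_i completes the chain on the left, and the inner one cancels the last
  inverse on the right. \<open>Y_Suc_hecke\<close> and \<open>Y_hecke\<close> rearrange this by the
  quadratic relation.\<close>

lemma hecke_Y_hecke:
  assumes "1 \<le> i" "i < n"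
  shows "hecke_T i (cherednik_Y n (Suc i) (hecke_T i f)) = Const tt * cherednik_Y n i f"
proof -
  have "tt powi (int (Suc i) - int n) = tt * tt powi (int i - int n)"
    using power_int_add [of tt 1 "int i - int n"] by (simp add: algebra_simps)
  thus ?thesis
    using assms by (simp add: cherednik_Y_eq hecke_dn_Suc hecke_T_Const hecke_up_step Const_mult mult.assoc)
qed

lemma Y_Suc_hecke:
  assumes "1 \<le> i" "i < n"
  shows "cherednik_Y n (Suc i) (hecke_T i f) = hecke_T i (cherednik_Y n i f) - (Const tt - 1) * cherednik_Y n i f"
proof -
  have "hecke_inv i (hecke_T i (cherednik_Y n (Suc i) (hecke_T i f))) = hecke_inv i (Const tt * cherednik_Y n i f)"
    unfolding hecke_Y_hecke [OF assms] ..
  hence "cherednik_Y n (Suc i) (hecke_T i f) = Const tt * hecke_inv i (cherednik_Y n i f)"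
    by (simp add: linear_op_Const [OF linear_hecke_inv])
  thus ?thesis by (simp add: hecke_inv_def)
qed

lemma Y_hecke:
  assumes "1 \<le> i" "i < n"
  shows "cherednik_Y n i (hecke_T i f) = hecke_T i (cherednik_Y n (Suc i) f) + (Const tt - 1) * cherednik_Y n i f"
proof -
  note lin = linear_Y
  have 1: "Const tt * cherednik_Y n i (hecke_inv i g) = hecke_T i (cherednik_Y n (Suc i) g)" for g
    using hecke_Y_hecke [OF assms, of "hecke_inv i g"] by simp
  have "Const tt * cherednik_Y n i (hecke_inv i f)
      = cherednik_Y n i (Const tt * hecke_inv i f)"
    by (simp add: linear_op_Const [OF lin])
  also have "Const tt * hecke_inv i f = hecke_T i f - Const (tt - 1) * f"
    by (simp add: hecke_inv_def Const_diff)
  finally have "hecke_T i (cherednik_Y n (Suc i) f)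
     = cherednik_Y n i (hecke_T i f) - Const (tt - 1) * cherednik_Y n i f"
    unfolding 1 by (simp only: linear_op_diff [OF lin] linear_op_Const [OF lin])
  thus ?thesis by (simp only: Const_diff single_one) (simp add: eq_diff_eq)
qed

section \<open>The raising operator z_n \<omega>, which shifts spectra cyclically\<close>

definition raise_op :: "mpoly \<Rightarrow> mpoly" where
  "raise_op f = Var n * omega_op n f"

lemma linear_raise: "linear_op raise_op"
  by (simp add: linear_op_def raise_op_def omega_add omega_mult distrib_left mult.left_commute)

lemma raise_hecke:
  assumes "1 \<le> j" "Suc j < n"
  shows "raise_op (hecke_T (Suc j) f) = hecke_T j (raise_op f)"
  using assms by (simp add: raise_op_def omega_hecke_T hecke_T_Var_commute)

lemma hecke_T_Var_inv: "hecke_T i (Var i * f) = Const tt * (Var (Suc i) * hecke_inv i f)"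
  using hecke_T_Var [of i "hecke_inv i f"] by simp

lemma hecke_up_Var:
  assumes "i \<le> m"
  shows "hecke_up i m (Var (Suc m) * f) = Var (Suc m) * hecke_up i m f"
  using assms
proof (induction "m - i" arbitrary: i)
  case (Suc d)
  hence "hecke_up (Suc i) m (Var (Suc m) * f) = Var (Suc m) * hecke_up (Suc i) m f" by simp
  with Suc show ?case by (simp add: hecke_up_step hecke_T_Var_commute)
qed simp

text \<open>As \<omega> z_n = z_(n-1) \<omega>, the relation T_(n-1) z_(n-1) = t z_n T_(n-1)^{-1}
  brings z_n to the front. The inverse passes through \<omega>^2 and becomes T_1^{-1}, the right
  factor of Y_2; the factor t adjusts the power of t.\<close>

lemma Y_1_raise:
  assumes "2 \<le> n"
  shows "cherednik_Y n 1 (raise_op f) = raise_op (cherednik_Y n 2 f)"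
proof -
  obtain m where m: "n = Suc m" "1 \<le> m" using assms by (cases n) auto
  have 2: "Suc 1 = 2" by simp
  let ?g = "omega_op n (omega_op n f)"
  have inv: "omega_op n (omega_op n (hecke_inv 1 f)) = hecke_inv m ?g"
    by (rule hecke_inv_intertwine) (use omega_omega_hecke_T [OF assms] m in simp)
  have p: "tt powi (2 - int n) = tt powi (1 - int n) * tt"
    using power_int_add [of tt "1 - int n" 1] by simp
  have "omega_op n (Var n) = Var m"
    unfolding omega_Var omega_subst_def using assms m(1) by simp
  hence "cherednik_Y n 1 (raise_op f) = Const (tt powi (1 - int n)) * hecke_up 1 n (Var m * ?g)"
    by (simp add: cherednik_Y_eq raise_op_def omega_mult)
  also have "hecke_up 1 n (Var m * ?g) = hecke_up 1 m (Const tt * (Var n * hecke_inv m ?g))"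
    unfolding m(1) using m(2) by (simp add: hecke_up_last hecke_T_Var_inv)
  also have "\<dots> = Const tt * (Var n * hecke_up 1 m (hecke_inv m ?g))"
    unfolding linear_op_Const [OF linear_hecke_up] using m by (simp add: hecke_up_Var)
  also have "Const (tt powi (1 - int n)) * \<dots> = Var n * (Const (tt powi (2 - int n)) * hecke_up 1 m (hecke_inv m ?g))"
    unfolding p Const_mult by (simp only: ac_simps)
  also have "hecke_up 1 m (hecke_inv m ?g) = omega_op n (hecke_up 2 n (omega_op n (hecke_inv 1 f)))"
    unfolding inv [symmetric] using omega_hecke_up [of 1 m] m unfolding 2 by simp
  also have "Var n * (Const (tt powi (2 - int n)) * \<dots>) = raise_op (cherednik_Y n 2 f)"
    using hecke_dn_Suc [of 1 f] unfolding 2 by (simp add: raise_op_def cherednik_Y_eq omega_mult)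
  finally show ?thesis .
qed

text \<open>Induction from i = 1, using Y_(i+1) = t T_i^{-1} Y_i T_i^{-1} and the fact that raising
  turns T_(i+1)^{-1} into T_i^{-1}.\<close>

lemma Y_raise:
  assumes "1 \<le> i" "i < n"
  shows "cherednik_Y n i (raise_op f) = raise_op (cherednik_Y n (Suc i) f)"
  using assms
proof (induction i arbitrary: f rule: nat_induct_at_least)
  case base
  hence "2 \<le> n" by simp
  from Y_1_raise [OF this] show ?case by simp
next
  case (Suc i)
  have Y: "Const (inverse tt) * hecke_inv k (Const tt * (Const tt * cherednik_Y n k (hecke_inv k g)))
     = cherednik_Y n (Suc k) g" if "1 \<le> k" "k < n" for k g
    using arg_cong [OF hecke_Y_hecke [OF that, of "hecke_inv k g"], of "hecke_inv k"]
    by (simp add: linear_op_Const [OF linear_hecke_inv])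
  have inv: "raise_op (hecke_inv (Suc i) g) = hecke_inv i (raise_op g)" for g
    using Suc by (intro hecke_inv_intertwine raise_hecke) auto
  have "cherednik_Y n (Suc i) (raise_op f)
     = Const (inverse tt) * hecke_inv i (Const tt * (Const tt * cherednik_Y n i (raise_op (hecke_inv (Suc i) f))))"
    using Suc by (simp add: Y inv)
  also have "\<dots> = Const (inverse tt) * hecke_inv i (Const tt * (Const tt * raise_op (cherednik_Y n (Suc i) (hecke_inv (Suc i) f))))"
    using Suc by simp
  also have "\<dots> = raise_op (Const (inverse tt) * hecke_inv (Suc i) (Const tt * (Const tt * cherednik_Y n (Suc i) (hecke_inv (Suc i) f))))"
    by (simp only: inv linear_op_Const [OF linear_raise])
  also have "\<dots> = raise_op (cherednik_Y n (Suc (Suc i)) f)"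
    using Suc by (simp add: Y)
  finally show ?case .
qed

text \<open>Each inverse meets the variable as T_k^{-1} z_(k+1) = t^{-1} z_k T_k. For i = n this
  converts the inverses in Y_n into the chain of Y_1, and \<omega> z_1 = q z_n \<omega> then
  accounts for the q in \<open>Y_n_raise\<close>.\<close>

lemma hecke_dn_Var:
  assumes "1 \<le> i"
  shows "hecke_dn i (Var i * f) = Const (tt powi (1 - int i)) * (Var 1 * hecke_up 1 i f)"
  using assms
proof (induction i arbitrary: f rule: nat_induct_at_least)
  case base
  show ?case by simp
next
  case (Suc i)
  have "hecke_T i (Var i * hecke_T i f) = Const tt * (Var (Suc i) * f)"
    by (rule hecke_T_Var)
  hence "Const tt * hecke_inv i (Var (Suc i) * f) = Var i * hecke_T i f"
    by (metis hecke_inv_T linear_op_Const [OF linear_hecke_inv])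
  hence "hecke_inv i (Var (Suc i) * f) = Const (inverse tt) * (Var i * hecke_T i f)"
    by (simp add: Const_mult_eq_iff)
  moreover have "tt powi (1 - int (Suc i)) = inverse tt * tt powi (1 - int i)"
    using power_int_add [of tt "-1" "1 - int i"] by (simp add: power_int_minus)
  ultimately show ?case
    using Suc by (simp add: hecke_dn_Suc linear_op_Const [OF linear_hecke_dn] hecke_up_last Const_mult mult.assoc)
qed

lemma Y_n_raise: "cherednik_Y n n (raise_op f) = Const qq * raise_op (cherednik_Y n 1 f)"
proof -
  have "omega_op n (Var 1) = Const qq * Var n" by (simp add: omega_Var omega_subst_def)
  thus ?thesis
    using hecke_dn_Var [OF n, of "omega_op n f"]
    by (simp add: cherednik_Y_eq raise_op_def omega_mult ac_simps)
qed

section \<open>Multiplication by the sum of the variables\<close>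

definition var_sum :: mpoly where
  "var_sum = (\<Sum>i=1..n. Var i)"

lemma swap_var_sum:
  assumes "1 \<le> i" "i < n"
  shows "swap i var_sum = var_sum"
proof -
  have "bij_betw (transpose i (Suc i)) {1..n} {1..n}"
    using assms by (intro bij_betw_byWitness [of _ "transpose i (Suc i)"]) (auto simp: transpose_def)
  thus ?thesis
    unfolding var_sum_def swap_sum swap_Var by (rule sum.reindex_bij_betw)
qed

lemma omega_var_sum: "omega_op n var_sum = var_sum + Const (qq - 1) * Var n"
proof -
  obtain m where m: "n = Suc m" using n by (cases n) auto
  have "omega_op n var_sum = (\<Sum>i=1..n. omega_subst n i)"
    by (simp add: var_sum_def omega_sum omega_Var)
  also have "\<dots> = omega_subst n 1 + (\<Sum>i=1..m. omega_subst n (Suc i))"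
    using sum.atLeast_Suc_atMost [of 1 n "omega_subst n"]
      sum.shift_bounds_cl_Suc_ivl [of "omega_subst n" 1 m] n by (simp add: m)
  also have "\<dots> = Const qq * Var n + (\<Sum>i=1..m. Var i)"
    by (auto simp: omega_subst_def m intro!: sum.cong)
  also have "(\<Sum>i=1..m. Var i) = var_sum - Var n"
    unfolding var_sum_def unfolding m by simp
  finally show ?thesis by (simp add: Const_diff algebra_simps)
qed

lemma Y_var_sum:
  assumes "1 \<le> i" "i \<le> n"
  shows "cherednik_Y n i (var_sum * f) = var_sum * cherednik_Y n i f
    + Const (qq - 1) * (Const (tt powi (int i - int n)) * hecke_up i n (raise_op (hecke_dn i f)))"
proof -
  have T: "hecke_T j (var_sum * g) = var_sum * hecke_T j g" if "1 \<le> j" "j < n" for j g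
    using that by (intro hecke_T_mult_symmetric swap_var_sum)
  have Ti: "hecke_inv j (var_sum * g) = var_sum * hecke_inv j g" if "1 \<le> j" "j < n" for j g
    using that by (intro hecke_inv_intertwine [symmetric] T [symmetric])
  have up: "hecke_up k n (var_sum * g) = var_sum * hecke_up k n g" if "1 \<le> k" for k g
    using that
  proof (induction "n - k" arbitrary: k)
    case (Suc d)
    hence "hecke_up (Suc k) n (var_sum * g) = var_sum * hecke_up (Suc k) n g" by simp
    with Suc show ?case by (simp add: hecke_up_step T)
  qed simp
  have dn: "hecke_dn i (var_sum * g) = var_sum * hecke_dn i g" for g
    using assms by (induction i arbitrary: g rule: nat_induct_at_least) (simp_all add: hecke_dn_Suc Ti)
  have "omega_op n (var_sum * hecke_dn i f)
     = var_sum * omega_op n (hecke_dn i f) + Const (qq - 1) * raise_op (hecke_dn i f)"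
    by (simp add: omega_mult omega_var_sum raise_op_def algebra_simps)
  thus ?thesis
    using assms
    by (simp add: cherednik_Y_eq dn up linear_op_add [OF linear_hecke_up] linear_op_Const [OF linear_hecke_up])
       (simp add: algebra_simps)
qed

end


section \<open>Compositions and their spectra\<close>

lemma qt_monomial: "qq ^ a * tt ^ b = Fract (monom (monom 1 a) b) 1"
proof -
  have "tt ^ b = Fract (monom 1 b) 1"
    by (induction b) (simp_all add: tt_def One_fract_def monom_Suc)
  moreover have "qq ^ a = Fract [:monom 1 a:] 1"
    by (simp add: qq_power monom_altdef)
  ultimately show ?thesis by (simp add: smult_monom)
qed

text \<open>Coefficients of bivariate polynomials separate monomials; the statements that spectral
  values differ rest on this.\<close>

lemma qt_monomial_eq_iff: "qq ^ a * tt ^ b = qq ^ c * tt ^ d \<longleftrightarrow> a = c \<and> b = d"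
proof
  assume "qq ^ a * tt ^ b = qq ^ c * tt ^ d"
  hence eq: "monom (monom 1 a) b = (monom (monom 1 c) d :: rat poly poly)"
    by (simp add: qt_monomial eq_fract)
  have "coeff (coeff (monom (monom 1 c) d :: rat poly poly) b) a = 1"
    unfolding eq [symmetric] by simp
  thus "a = c \<and> b = d" by (auto split: if_splits)
qed simp

lemma qt_monomial_eq_1_iff: "qq ^ a * tt ^ b = 1 \<longleftrightarrow> a = 0 \<and> b = 0"
  using qt_monomial_eq_iff [of a b 0 0] by simp

lemma tt_neq_1 [simp]: "tt \<noteq> 1" and qq_neq_1 [simp]: "qq \<noteq> 1"
  using qt_monomial_eq_1_iff [of 0 1] qt_monomial_eq_1_iff [of 1 0] by simp_all

lemma spectral_altdef: "spectral n \<eta> i = qq ^ lookup \<eta> i / tt ^ leg' n \<eta> i"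
  by (simp add: spectral_def power_int_minus field_simps)

lemma spectral_neq_0 [simp]: "spectral n \<eta> i \<noteq> 0"
  by (simp add: spectral_altdef)

lemma spectral_eq_iff:
  "spectral n \<eta> i = spectral m \<nu> j \<longleftrightarrow> lookup \<eta> i = lookup \<nu> j \<and> leg' n \<eta> i = leg' m \<nu> j"
proof -
  have "spectral n \<eta> i = spectral m \<nu> j
      \<longleftrightarrow> qq ^ lookup \<eta> i * tt ^ leg' m \<nu> j = qq ^ lookup \<nu> j * tt ^ leg' n \<eta> i"
    by (simp add: spectral_altdef frac_eq_eq)
  thus ?thesis unfolding qt_monomial_eq_iff by auto
qed

lemma leg'_altdef:
  "leg' n \<eta> i = card {j\<in>{1..n}. j < i \<and> lookup \<eta> j \<ge> lookup \<eta> i \<or> j > i \<and> lookup \<eta> j > lookup \<eta> i}"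
proof -
  let ?A = "{j\<in>{1..n}. j < i \<and> lookup \<eta> j \<ge> lookup \<eta> i}"
  let ?B = "{j\<in>{1..n}. j > i \<and> lookup \<eta> j > lookup \<eta> i}"
  have "{j\<in>{1..n}. j < i \<and> lookup \<eta> j \<ge> lookup \<eta> i \<or> j > i \<and> lookup \<eta> j > lookup \<eta> i} = ?A \<union> ?B"
    by blast
  moreover have "card (?A \<union> ?B) = card ?A + card ?B"
    by (rule card_Un_disjoint) auto
  ultimately show ?thesis by (simp add: leg'_def)
qed

text \<open>Whatever counts for i also counts for j, and i itself, an equal part to the left, counts
  for j in addition.\<close>

lemma leg'_less:
  assumes "i \<in> {1..n}" "i < j" "lookup \<eta> i = lookup \<eta> j"
  shows "leg' n \<eta> i < leg' n \<eta> j"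
proof -
  let ?S = "\<lambda>i. {k\<in>{1..n}. k < i \<and> lookup \<eta> k \<ge> lookup \<eta> i \<or> k > i \<and> lookup \<eta> k > lookup \<eta> i}"
  have "?S i \<subseteq> ?S j"
  proof
    fix k assume "k \<in> ?S i"
    with assms(2) show "k \<in> ?S j"
      unfolding assms(3) by (cases k j rule: linorder_cases) auto
  qed
  moreover have "i \<in> ?S j" "i \<notin> ?S i" using assms by simp_all
  ultimately have "?S i \<subset> ?S j" by blast
  thus ?thesis unfolding leg'_altdef by (intro psubset_card_mono) simp_all
qed

text \<open>The power of q gives the part and the power of t tells equal parts apart, so the values
  can label positions.\<close>

lemma spectral_inj:
  assumes "i \<in> {1..n}" "j \<in> {1..n}" "spectral n \<eta> i = spectral n \<eta> j"
  shows "i = j"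
  using assms leg'_less [of i n j \<eta>] leg'_less [of j n i \<eta>]
  by (cases i j rule: linorder_cases) (auto simp: spectral_eq_iff)

lemma leg'_adjacent:
  assumes "i \<in> {1..n}" "Suc i \<in> {1..n}" "lookup \<eta> i = lookup \<eta> (Suc i)"
  shows "leg' n \<eta> (Suc i) = Suc (leg' n \<eta> i)"
proof -
  have "{j\<in>{1..n}. j < Suc i \<and> lookup \<eta> j \<ge> lookup \<eta> (Suc i) \<or> j > Suc i \<and> lookup \<eta> j > lookup \<eta> (Suc i)}
      = insert i {j\<in>{1..n}. j < i \<and> lookup \<eta> j \<ge> lookup \<eta> i \<or> j > i \<and> lookup \<eta> j > lookup \<eta> i}"
    using assms(1,3) by (auto simp: less_Suc_eq not_less dest: Suc_lessI)
  thus ?thesis unfolding leg'_altdef by (simp add: card_insert_if)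
qed

lemma spectral_adjacent:
  assumes "i \<in> {1..n}" "Suc i \<in> {1..n}" "lookup \<eta> i = lookup \<eta> (Suc i)"
  shows "spectral n \<eta> i = tt * spectral n \<eta> (Suc i)"
  using assms by (simp add: spectral_altdef leg'_adjacent)

lemma composition_outside: "composition n \<eta> \<Longrightarrow> i \<notin> {1..n} \<Longrightarrow> lookup \<eta> i = 0"
  unfolding composition_def by (metis in_keys_iff subsetD)

lemma composition_support: "composition n \<eta> \<Longrightarrow> lookup \<eta> i > 0 \<Longrightarrow> i \<in> {1..n}"
  using composition_outside [of n \<eta> i] by auto

lemma compositionI: "(\<And>i. lookup \<eta> i > 0 \<Longrightarrow> i \<in> {1..n}) \<Longrightarrow> composition n \<eta>"
  unfolding composition_def using in_keys_iff by (metis gr0I subsetI)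

lemma composition_eqI:
  assumes "composition n \<eta>" "composition n \<nu>" "\<And>i. i \<in> {1..n} \<Longrightarrow> lookup \<eta> i = lookup \<nu> i"
  shows "\<eta> = \<nu>"
proof (rule poly_mapping_eqI)
  fix i
  show "lookup \<eta> i = lookup \<nu> i"
  proof (cases "i \<in> {1..n}")
    case False
    thus ?thesis using composition_outside assms(1,2) by metis
  qed (rule assms(3))
qed

lemma finite_compositions: "finite {\<nu>. composition n \<nu> \<and> csize n \<nu> = d}"
proof (rule finite_subset)
  let ?S = "PiE {1..n} (\<lambda>_. {..d})"
  show "{\<nu>. composition n \<nu> \<and> csize n \<nu> = d}
      \<subseteq> (\<lambda>f. Abs_poly_mapping (\<lambda>i. if i \<in> {1..n} then f i else 0)) ` ?S"
  proof
    fix \<nu> assume \<nu>: "\<nu> \<in> {\<nu>. composition n \<nu> \<and> csize n \<nu> = d}"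
    have "lookup \<nu> i \<le> d" if "i \<in> {1..n}" for i
      using \<nu> member_le_sum [of i "{1..n}" "lookup \<nu>"] that by (simp add: csize_def)
    moreover have "(\<lambda>i. if i \<in> {1..n} then restrict (lookup \<nu>) {1..n} i else 0) = lookup \<nu>"
    proof
      fix i
      show "(if i \<in> {1..n} then restrict (lookup \<nu>) {1..n} i else 0) = lookup \<nu> i"
        using \<nu> composition_outside [of n \<nu> i] by (cases "i \<in> {1..n}") simp_all
    qed
    hence "\<nu> = Abs_poly_mapping (\<lambda>i. if i \<in> {1..n} then restrict (lookup \<nu>) {1..n} i else 0)"
      by (simp add: lookup_inverse)
    ultimately show "\<nu> \<in> (\<lambda>f. Abs_poly_mapping (\<lambda>i. if i \<in> {1..n} then f i else 0)) ` ?S"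
      by (intro image_eqI [of _ _ "restrict (lookup \<nu>) {1..n}"]) auto
  qed
qed (intro finite_imageI finite_PiE, auto)

section \<open>Exchange of neighbouring parts\<close>

definition comp_swap :: "nat \<Rightarrow> expo \<Rightarrow> expo" where
  "comp_swap i \<eta> = Poly_Mapping.map_key (transpose i (Suc i)) \<eta>"

lemma lookup_comp_swap: "lookup (comp_swap i \<eta>) k = lookup \<eta> (transpose i (Suc i) k)"
  by (simp add: comp_swap_def map_key.rep_eq)

lemma comp_swap_swap [simp]: "comp_swap i (comp_swap i \<eta>) = \<eta>"
  by (rule poly_mapping_eqI) (simp add: lookup_comp_swap)

lemma lookup_comp_swap_simps [simp]:
  "lookup (comp_swap i \<eta>) i = lookup \<eta> (Suc i)"
  "lookup (comp_swap i \<eta>) (Suc i) = lookup \<eta> i"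
  "k \<noteq> i \<Longrightarrow> k \<noteq> Suc i \<Longrightarrow> lookup (comp_swap i \<eta>) k = lookup \<eta> k"
  by (simp_all add: lookup_comp_swap transpose_def)

lemma comp_swap_eq_iff: "comp_swap i \<eta> = \<eta> \<longleftrightarrow> lookup \<eta> i = lookup \<eta> (Suc i)"
proof
  assume "comp_swap i \<eta> = \<eta>"
  thus "lookup \<eta> i = lookup \<eta> (Suc i)" using lookup_comp_swap_simps(1) [of i \<eta>] by simp
next
  assume "lookup \<eta> i = lookup \<eta> (Suc i)"
  thus "comp_swap i \<eta> = \<eta>"
    by (intro poly_mapping_eqI) (auto simp: lookup_comp_swap transpose_def)
qed

lemma transpose_bij:
  assumes "1 \<le> i" "i < n"
  shows "bij_betw (transpose i (Suc i)) {1..n} {1..n}"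
  using assms by (intro bij_betw_byWitness [of _ "transpose i (Suc i)"]) (auto simp: transpose_def)

lemma composition_swap:
  assumes "1 \<le> i" "i < n" "composition n \<eta>"
  shows "composition n (comp_swap i \<eta>)"
proof (rule compositionI)
  fix k assume "lookup (comp_swap i \<eta>) k > 0"
  hence "transpose i (Suc i) k \<in> {1..n}"
    unfolding lookup_comp_swap using assms(3) by (rule composition_support [rotated])
  thus "k \<in> {1..n}" using assms(1,2) by (auto simp: transpose_def split: if_splits)
qed

lemma csize_swap:
  assumes "1 \<le> i" "i < n"
  shows "csize n (comp_swap i \<eta>) = csize n \<eta>"
  unfolding csize_def lookup_comp_swap
  by (rule sum.reindex_bij_betw [OF transpose_bij [OF assms]])

lemma leg'_swap:
  assumes "1 \<le> i" "i < n" "lookup \<eta> i \<noteq> lookup \<eta> (Suc i)"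
  shows "leg' n (comp_swap i \<eta>) k = leg' n \<eta> (transpose i (Suc i) k)"
proof -
  let ?s = "transpose i (Suc i)"
  define R where "R a b \<longleftrightarrow> a < b \<and> lookup \<eta> a \<ge> lookup \<eta> b \<or> a > b \<and> lookup \<eta> a > lookup \<eta> b" for a b
  \<comment> \<open>Here \<open>R a b\<close> says that a counts for b. Positions matter only for
    ties, and the two exchanged parts are not tied; for all other pairs the exchange preserves the
    order of positions.\<close>
  have key: "R a b \<longleftrightarrow> ?s a < ?s b \<and> lookup \<eta> a \<ge> lookup \<eta> b \<or> ?s a > ?s b \<and> lookup \<eta> a > lookup \<eta> b" for a b
  proof (cases "a \<in> {i, Suc i} \<and> b \<in> {i, Suc i}")
    case True
    thus ?thesis using assms(3) by (auto simp: R_def)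
  next
    case False
    hence "?s a < ?s b \<longleftrightarrow> a < b" "?s b < ?s a \<longleftrightarrow> b < a" by (auto simp: transpose_def)
    thus ?thesis by (simp add: R_def)
  qed
  have mem: "?s j \<in> {1..n} \<longleftrightarrow> j \<in> {1..n}" for j
    using assms by (auto simp: transpose_def)
  have B: "{j\<in>{1..n}. j < k \<and> lookup \<eta> (?s j) \<ge> lookup \<eta> (?s k) \<or> j > k \<and> lookup \<eta> (?s j) > lookup \<eta> (?s k)}
      = {j\<in>{1..n}. R (?s j) (?s k)}"
    unfolding key by auto
  have "bij_betw ?s {j\<in>{1..n}. R (?s j) (?s k)} {j\<in>{1..n}. R j (?s k)}"
    by (rule bij_betw_byWitness [of _ ?s]) (auto simp del: atLeastAtMost_iff simp: mem)
  thus ?thesis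
    unfolding leg'_altdef lookup_comp_swap B
    by (simp add: bij_betw_same_card R_def)
qed

lemma spectral_swap:
  assumes "1 \<le> i" "i < n" "lookup \<eta> i \<noteq> lookup \<eta> (Suc i)"
  shows "spectral n (comp_swap i \<eta>) k = spectral n \<eta> (transpose i (Suc i) k)"
  using assms by (simp add: spectral_altdef leg'_swap lookup_comp_swap)

section \<open>The cyclic shift of a composition\<close>

definition cyc :: "nat \<Rightarrow> nat \<Rightarrow> nat" where
  "cyc n k = (if 1 \<le> k \<and> k < n then Suc k else if k = n then 1 else k)"

text \<open>The composition (\<eta>_2, ..., \<eta>_n, \<eta>_1 + 1): the exponent of z_n \<omega>
  z^\<eta>, up to a power of q in front.\<close>

definition comp_shift :: "nat \<Rightarrow> expo \<Rightarrow> expo" where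
  "comp_shift n \<eta> = Poly_Mapping.map_key (cyc n) \<eta> + single n 1"

lemma inj_cyc: "1 \<le> n \<Longrightarrow> inj (cyc n)"
  by (rule injI) (auto simp: cyc_def split: if_splits)

lemma bij_cyc: "1 \<le> n \<Longrightarrow> bij_betw (cyc n) {1..n} {1..n}"
  by (rule bij_betw_byWitness [of _ "\<lambda>k. if k = 1 then n else k - 1"]) (auto simp: cyc_def)

lemma lookup_comp_shift:
  assumes "1 \<le> n"
  shows "lookup (comp_shift n \<eta>) k = lookup \<eta> (cyc n k) + (if k = n then 1 else 0)"
  using inj_cyc [OF assms] by (auto simp: comp_shift_def lookup_add map_key.rep_eq lookup_single when_def)

lemma lookup_comp_shift_simps [simp]:
  "1 \<le> n \<Longrightarrow> lookup (comp_shift n \<eta>) n = Suc (lookup \<eta> 1)"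
  "1 \<le> k \<Longrightarrow> k < n \<Longrightarrow> lookup (comp_shift n \<eta>) k = lookup \<eta> (Suc k)"
  by (simp_all add: lookup_comp_shift cyc_def)

lemma composition_shift:
  assumes "1 \<le> n" "composition n \<eta>"
  shows "composition n (comp_shift n \<eta>)"
proof (rule compositionI)
  fix k assume "lookup (comp_shift n \<eta>) k > 0"
  hence "k = n \<or> cyc n k \<in> {1..n}"
    using assms composition_support [of n \<eta> "cyc n k"]
    by (auto simp: lookup_comp_shift split: if_splits)
  thus "k \<in> {1..n}" using assms(1) by (auto simp: cyc_def split: if_splits)
qed

lemma csize_shift: "1 \<le> n \<Longrightarrow> csize n (comp_shift n \<eta>) = Suc (csize n \<eta>)"
  using sum.reindex_bij_betw [OF bij_cyc, of n "lookup \<eta>"]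
  by (simp add: csize_def lookup_comp_shift sum.distrib)

lemma comp_shift_inj:
  assumes "1 \<le> n" "comp_shift n \<eta> = comp_shift n \<nu>"
  shows "\<eta> = \<nu>"
proof (rule poly_mapping_eqI)
  fix k
  have "\<exists>j. cyc n j = k"
  proof -
    consider "k = 0 \<or> n < k" | "k = 1" | "2 \<le> k" "k \<le> n" by linarith
    thus ?thesis
    proof cases
      case 1
      thus ?thesis using assms(1) by (intro exI [of _ k]) (auto simp: cyc_def)
    next
      case 2
      thus ?thesis by (intro exI [of _ n]) (simp add: cyc_def)
    next
      case 3
      thus ?thesis by (intro exI [of _ "k - 1"]) (auto simp: cyc_def)
    qed
  qed
  then obtain j where "k = cyc n j" by blast
  thus "lookup \<eta> k = lookup \<nu> k"
    using lookup_comp_shift [OF assms(1), of \<eta> j] lookup_comp_shift [OF assms(1), of \<nu> j] assms(2) by simp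
qed

text \<open>Adding 1 compensates the move of \<eta>_1 from the left end to the right end, where weak
  inequalities against other parts turn into strict ones and conversely.\<close>

lemma leg'_shift:
  assumes "1 \<le> n" "k \<in> {1..n}"
  shows "leg' n (comp_shift n \<eta>) k = leg' n \<eta> (cyc n k)"
proof -
  let ?A = "{j\<in>{1..n}. j < cyc n k \<and> lookup \<eta> j \<ge> lookup \<eta> (cyc n k) \<or> j > cyc n k \<and> lookup \<eta> j > lookup \<eta> (cyc n k)}"
  let ?h = "lookup (comp_shift n \<eta>)"
  let ?B = "{j\<in>{1..n}. j < k \<and> ?h j \<ge> ?h k \<or> j > k \<and> ?h j > ?h k}"
  have "bij_betw (cyc n) ?B ?A"
    using assms unfolding lookup_comp_shift [OF assms(1)]
    by (intro bij_betw_byWitness [of _ "\<lambda>k. if k = 1 then n else k - 1"])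
       (auto simp: cyc_def split: if_splits)
  thus ?thesis
    unfolding leg'_altdef by (rule bij_betw_same_card)
qed

lemma spectral_shift:
  assumes "1 \<le> n"
  shows "1 \<le> k \<Longrightarrow> k < n \<Longrightarrow> spectral n (comp_shift n \<eta>) k = spectral n \<eta> (Suc k)"
    and "spectral n (comp_shift n \<eta>) n = qq * spectral n \<eta> 1"
  using assms by (simp_all add: spectral_altdef leg'_shift cyc_def)

text \<open>The last nonzero part moves to the right end by exchanges with zeros; there a shift can
  be undone, which lowers the size. Read backwards, every exchange is made at an ascent.\<close>

lemma composition_induct [consumes 2, case_names zero shift swap]:
  assumes "1 \<le> n" "composition n \<eta>"
    and zero: "P 0"
    and shift: "\<And>\<eta>. composition n \<eta> \<Longrightarrow> P \<eta> \<Longrightarrow> P (comp_shift n \<eta>)"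
    and swap: "\<And>\<eta> i. composition n \<eta> \<Longrightarrow> 1 \<le> i \<Longrightarrow> i < n \<Longrightarrow> lookup \<eta> i < lookup \<eta> (Suc i)
                 \<Longrightarrow> P \<eta> \<Longrightarrow> P (comp_swap i \<eta>)"
  shows "P \<eta>"
proof -
  have nz: "P \<eta>" if "composition n \<eta>" "csize n \<eta> = d" "1 \<le> k" "k \<le> n" "lookup \<eta> k > 0"
    "\<And>j. k < j \<Longrightarrow> lookup \<eta> j = 0" and IH: "\<And>\<eta>. composition n \<eta> \<Longrightarrow> csize n \<eta> < d \<Longrightarrow> P \<eta>" for d k \<eta>
    using that(1-6)
  proof (induction "n - k" arbitrary: k \<eta>)
    case 0
    hence [simp]: "k = n" by simp
    \<comment> \<open>The inverse of \<open>cyc n\<close>, which undoes the shift.\<close>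
    define p where "p j = (if j = 1 then n else if 1 \<le> j \<and> j \<le> n then j - 1 else j)" for j
    have "inj p" using assms(1) by (intro injI) (auto simp: p_def split: if_splits)
    define \<mu> where "\<mu> = Poly_Mapping.map_key p (\<eta> - single n 1)"
    have \<mu>: "lookup \<mu> j = lookup \<eta> (p j) - (if p j = n then 1 else 0)" for j
      using \<open>inj p\<close> by (auto simp: \<mu>_def map_key.rep_eq lookup_minus lookup_single when_def)
    have "composition n \<mu>"
    proof (rule compositionI)
      fix j assume "lookup \<mu> j > 0"
      hence "p j \<in> {1..n}" unfolding \<mu> using 0 composition_support [of n \<eta> "p j"] by simp
      thus "j \<in> {1..n}" using assms(1) by (auto simp: p_def split: if_splits)
    qed
    moreover have eq: "comp_shift n \<mu> = \<eta>"
    proof (rule poly_mapping_eqI)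
      fix j
      show "lookup (comp_shift n \<mu>) j = lookup \<eta> j"
        using 0 assms(1) by (auto simp: lookup_comp_shift \<mu> p_def cyc_def)
    qed
    moreover from eq have "csize n \<mu> < d"
      using csize_shift [OF assms(1), of \<mu>] 0 by simp
    ultimately show ?case using shift [of \<mu>] IH [of \<mu>] by simp
  next
    case (Suc e)
    hence k: "1 \<le> k" "k < n" by auto
    have "P (comp_swap k \<eta>)"
      using Suc k by (intro Suc.hyps(1) [of "Suc k"]) (auto simp: composition_swap csize_swap)
    moreover have "lookup (comp_swap k \<eta>) k < lookup (comp_swap k \<eta>) (Suc k)"
      using Suc by simp
    ultimately have "P (comp_swap k (comp_swap k \<eta>))"
      using k Suc by (intro swap [OF composition_swap]) auto
    thus ?case by simp
  qed
  show ?thesis using assms(2)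
  proof (induction "csize n \<eta>" arbitrary: \<eta> rule: less_induct)
    case less
    show ?case
    proof (cases "\<eta> = 0")
      case False
      hence "keys \<eta> \<noteq> {}" by simp
      define k where "k = Max (keys \<eta>)"
      have "k \<in> keys \<eta>" using \<open>keys \<eta> \<noteq> {}\<close> by (simp add: k_def)
      moreover have "lookup \<eta> j = 0" if "k < j" for j
        using that Max_ge [of "keys \<eta>" j] unfolding k_def by (fastforce simp: in_keys_iff)
      ultimately show ?thesis
        using less composition_support [of n \<eta> k] by (intro nz [of \<eta> "csize n \<eta>" k]) (auto simp: in_keys_iff)
    qed (simp add: zero)
  qed
qed


section \<open>An order of Bruhat type\<close>

text \<open>A composition is extended to a sequence on the integers by \<open>\<eta>(j + n) = \<eta>(j) + 1\<close>;
  then \<open>rank_sum n \<eta> p c\<close> is the number of \<open>j \<le> p\<close> with \<open>\<eta>(j) \<ge> c\<close>, and the order below is the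
  rank description of the affine Bruhat order. Unlike the dominance order of \<^const>\<open>comp_prec\<close>
  it is compatible both with \<^const>\<open>comp_shift\<close> and with the Hecke operators.\<close>

definition rank_sum :: "nat \<Rightarrow> expo \<Rightarrow> nat \<Rightarrow> nat \<Rightarrow> nat" where
  "rank_sum n \<eta> p c = (\<Sum>j=1..n. lookup \<eta> j + (if j \<le> p then 1 else 0) - c)"

definition rank_le :: "nat \<Rightarrow> expo \<Rightarrow> expo \<Rightarrow> bool" where
  "rank_le n \<mu> \<eta> \<longleftrightarrow> composition n \<mu> \<and> composition n \<eta> \<and> csize n \<mu> = csize n \<eta> \<and>
     (\<forall>p\<le>n. \<forall>c. rank_sum n \<mu> p c \<le> rank_sum n \<eta> p c)"

lemma rank_le_refl: "composition n \<eta> \<Longrightarrow> rank_le n \<eta> \<eta>"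
  by (simp add: rank_le_def)

lemma rank_le_trans: "rank_le n \<mu> \<eta> \<Longrightarrow> rank_le n \<eta> \<nu> \<Longrightarrow> rank_le n \<mu> \<nu>"
  unfolding rank_le_def by (metis le_trans)

text \<open>Differences in p detect whether the p-th part reaches the level c, so the rank sums
  determine the composition; antisymmetry follows.\<close>

lemma rank_sum_step:
  assumes "p \<in> {1..n}"
  shows "rank_sum n \<eta> p c = rank_sum n \<eta> (p - 1) c + (if c \<le> lookup \<eta> p then 1 else 0)"
proof -
  let ?h = "\<lambda>p j. lookup \<eta> j + (if j \<le> p then 1 else 0) - c"
  have "(\<Sum>j\<in>{1..n} - {p}. ?h p j) = (\<Sum>j\<in>{1..n} - {p}. ?h (p - 1) j)"
    by (rule sum.cong) auto
  thus ?thesis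
    unfolding rank_sum_def
    using sum.remove [of "{1..n}" p "?h p"] sum.remove [of "{1..n}" p "?h (p - 1)"] assms by auto
qed

lemma rank_le_antisym:
  assumes "rank_le n \<mu> \<eta>" "rank_le n \<eta> \<mu>"
  shows "\<mu> = \<eta>"
proof (rule composition_eqI)
  show "composition n \<mu>" "composition n \<eta>" using assms by (simp_all add: rank_le_def)
next
  fix p assume p: "p \<in> {1..n}"
  have eq: "rank_sum n \<mu> r c = rank_sum n \<eta> r c" if "r \<le> n" for r c
    using assms that unfolding rank_le_def by (simp add: le_antisym)
  have "c \<le> lookup \<mu> p \<longleftrightarrow> c \<le> lookup \<eta> p" for c
  proof -
    have "p \<le> n" "p - 1 \<le> n" using p by auto
    from eq [OF this(1), of c] eq [OF this(2), of c]
    have "(if c \<le> lookup \<mu> p then 1 else 0) = (if c \<le> lookup \<eta> p then 1 else (0::nat))"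
      unfolding rank_sum_step [OF p] by linarith
    thus ?thesis by (simp split: if_splits)
  qed
  from this [of "lookup \<mu> p"] this [of "lookup \<eta> p"] show "lookup \<mu> p = lookup \<eta> p" by simp
qed

lemma sum_split_adjacent:
  fixes h :: "nat \<Rightarrow> nat"
  assumes "1 \<le> i" "i < n"
  shows "(\<Sum>j=1..n. h j) = h i + h (Suc i) + (\<Sum>j\<in>{1..n} - {i, Suc i}. h j)"
  using sum.subset_diff [of "{i, Suc i}" "{1..n}" h] assms by simp

definition rank_rest :: "nat \<Rightarrow> nat \<Rightarrow> expo \<Rightarrow> nat \<Rightarrow> nat \<Rightarrow> nat" where
  "rank_rest n i \<eta> p c = (\<Sum>j\<in>{1..n} - {i, Suc i}. lookup \<eta> j + (if j \<le> p then 1 else 0) - c)"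

lemma rank_sum_split:
  assumes "1 \<le> i" "i < n"
  shows "rank_sum n \<eta> p c = (lookup \<eta> i + (if i \<le> p then 1 else 0) - c)
      + (lookup \<eta> (Suc i) + (if Suc i \<le> p then 1 else 0) - c) + rank_rest n i \<eta> p c"
  unfolding rank_sum_def rank_rest_def by (rule sum_split_adjacent [OF assms])

lemma rank_rest_cong:
  assumes "\<And>j. j \<notin> {i, Suc i} \<Longrightarrow> lookup \<mu> j = lookup \<eta> j"
  shows "rank_rest n i \<mu> p c = rank_rest n i \<eta> p c"
  unfolding rank_rest_def using assms by (intro sum.cong) auto

lemma rank_rest_swap: "rank_rest n i (comp_swap i \<eta>) p c = rank_rest n i \<eta> p c"
  by (rule rank_rest_cong) auto

lemma rank_rest_adjacent:
  "rank_rest n i \<eta> (i - 1) c = rank_rest n i \<eta> i c" "rank_rest n i \<eta> (Suc i) c = rank_rest n i \<eta> i c"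
  unfolding rank_rest_def by (intro sum.cong; auto)+

text \<open>A form of the lifting property of the Bruhat order. An exchange at i alters the rank
  sums only at p = i, and there they are controlled by those at i - 1 and i + 1.\<close>

lemma rank_le_swap_mono:
  assumes i: "1 \<le> i" "i < n" and le: "rank_le n \<mu> \<eta>" and less: "lookup \<eta> i < lookup \<eta> (Suc i)"
  shows "rank_le n (comp_swap i \<mu>) (comp_swap i \<eta>)"
  unfolding rank_le_def
proof (intro conjI allI impI)
  show "composition n (comp_swap i \<mu>)" "composition n (comp_swap i \<eta>)"
    using le i by (auto simp: rank_le_def composition_swap)
  show "csize n (comp_swap i \<mu>) = csize n (comp_swap i \<eta>)"
    using le i by (simp add: rank_le_def csize_swap)
next
  fix p c assume "p \<le> n"
  have R: "rank_sum n \<mu> r c \<le> rank_sum n \<eta> r c" if "r \<le> n" for r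
    using le that by (simp add: rank_le_def)
  show "rank_sum n (comp_swap i \<mu>) p c \<le> rank_sum n (comp_swap i \<eta>) p c"
  proof (cases "p = i")
    case False
    hence "rank_sum n (comp_swap i \<theta>) p c = rank_sum n \<theta> p c" for \<theta>
      unfolding rank_sum_split [OF i] rank_rest_swap by auto
    with R \<open>p \<le> n\<close> show ?thesis by simp
  next
    case [simp]: True
    \<comment> \<open>The level decides which neighbour is used: p = i - 1 for c up to \<eta>_(i+1),
      and p = i + 1 above, where both parts of \<eta> contribute 0.\<close>
    have aux: "(y + 1 - c) + (x - c) + S \<le> (b + 1 - c) + (a - c) + S'"
      if 1: "(x - c) + (y - c) + S \<le> (a - c) + (b - c) + S'"
        and 2: "(x + 1 - c) + (y + 1 - c) + S \<le> (a + 1 - c) + (b + 1 - c) + S'" and "a < b"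
      for x y a b S S' :: nat
    proof (cases "c \<le> b")
      case True
      hence "b + 1 - c = (b - c) + 1" by simp
      moreover have "y + 1 - c \<le> (y - c) + 1" by simp
      ultimately show ?thesis using 1 by linarith
    next
      case False
      hence "a + 1 - c = 0" "b + 1 - c = 0" using \<open>a < b\<close> by simp_all
      moreover have "x - c \<le> x + 1 - c" by simp
      ultimately show ?thesis using 2 by linarith
    qed
    have "i - 1 \<le> n" "Suc i \<le> n" "\<not> i \<le> i - 1" "\<not> Suc i \<le> i - 1" using i by auto
    with R [OF this(1)] R [OF this(2)] show ?thesis
      unfolding rank_sum_split [OF i] rank_rest_swap rank_rest_adjacent
      using aux [OF _ _ less, of "lookup \<mu> i" "lookup \<mu> (Suc i)"] by simp
  qed
qed

lemma rank_le_swap: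
  assumes i: "1 \<le> i" "i < n" and \<eta>: "composition n \<eta>" and less: "lookup \<eta> i < lookup \<eta> (Suc i)"
  shows "rank_le n \<eta> (comp_swap i \<eta>)"
  unfolding rank_le_def
proof (intro conjI allI impI)
  fix p c
  show "rank_sum n \<eta> p c \<le> rank_sum n (comp_swap i \<eta>) p c"
    unfolding rank_sum_split [OF i] rank_rest_swap using less by auto
qed (use i \<eta> in \<open>simp_all add: composition_swap csize_swap\<close>)

text \<open>The truncated difference x - c is convex in x, so two parts with a given sum contribute
  less when they are closer together.\<close>

lemma rank_le_between:
  assumes i: "1 \<le> i" "i < n" and \<mu>: "composition n \<mu>" and \<mu>': "composition n \<mu>'"
    and rest: "\<And>j. j \<notin> {i, Suc i} \<Longrightarrow> lookup \<mu>' j = lookup \<mu> j"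
    and sum: "lookup \<mu>' i + lookup \<mu>' (Suc i) = lookup \<mu> i + lookup \<mu> (Suc i)"
    and strict: "min (lookup \<mu> i) (lookup \<mu> (Suc i)) < lookup \<mu>' i"
      "lookup \<mu>' i < max (lookup \<mu> i) (lookup \<mu> (Suc i))"
  shows "rank_le n \<mu>' \<mu>"
  unfolding rank_le_def
proof (intro conjI allI impI)
  have "(\<Sum>j\<in>{1..n} - {i, Suc i}. lookup \<mu>' j) = (\<Sum>j\<in>{1..n} - {i, Suc i}. lookup \<mu> j)"
    by (intro sum.cong refl rest) auto
  thus "csize n \<mu>' = csize n \<mu>"
    unfolding csize_def sum_split_adjacent [OF i] using sum by simp
  fix p c
  show "rank_sum n \<mu>' p c \<le> rank_sum n \<mu> p c"
  proof -
    have conv: "(x' - c) + (y' - c) \<le> (x - c) + (y - c)"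
      if "x' + y' = x + y" "min x y \<le> x'" "x' \<le> max x y" for x y x' y' :: nat
      using that by (cases "x \<le> y") auto
    have "rank_rest n i \<mu>' p c = rank_rest n i \<mu> p c" by (rule rank_rest_cong) (rule rest)
    moreover have "(lookup \<mu>' i + (if i \<le> p then 1 else 0) - c) + (lookup \<mu>' (Suc i) + (if Suc i \<le> p then 1 else 0) - c)
       \<le> (lookup \<mu> i + (if i \<le> p then 1 else 0) - c) + (lookup \<mu> (Suc i) + (if Suc i \<le> p then 1 else 0) - c)"
      \<comment> \<open>Strictness leaves room for the extra 1 that only the first of the two parts
        receives when p = i.\<close>
      by (rule conv) (use sum strict in auto)
    ultimately show ?thesis unfolding rank_sum_split [OF i] by simp
  qed
qed (use \<mu> \<mu>' in simp_all)

text \<open>These are the exponents that can occur in T_i z^\<mu>, see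
  \<open>support_hecke_T_monomial\<close>.\<close>

definition in_string :: "nat \<Rightarrow> expo \<Rightarrow> expo \<Rightarrow> bool" where
  "in_string i \<mu> \<mu>' \<longleftrightarrow> (\<forall>j. j \<notin> {i, Suc i} \<longrightarrow> lookup \<mu>' j = lookup \<mu> j) \<and>
     lookup \<mu>' i + lookup \<mu>' (Suc i) = lookup \<mu> i + lookup \<mu> (Suc i) \<and>
     min (lookup \<mu> i) (lookup \<mu> (Suc i)) \<le> lookup \<mu>' i \<and> lookup \<mu>' i \<le> max (lookup \<mu> i) (lookup \<mu> (Suc i))"

lemma composition_in_string:
  assumes "1 \<le> i" "i < n" "composition n \<mu>" "in_string i \<mu> \<mu>'"
  shows "composition n \<mu>'"
proof (rule compositionI)
  fix j assume "lookup \<mu>' j > 0"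
  thus "j \<in> {1..n}"
    using assms composition_support [of n \<mu> j] by (cases "j \<in> {i, Suc i}") (auto simp: in_string_def)
qed

lemma in_string_cases:
  assumes "1 \<le> i" "i < n" "composition n \<mu>" "in_string i \<mu> \<mu>'"
  obtains "\<mu>' = \<mu>" | "\<mu>' = comp_swap i \<mu>" | "rank_le n \<mu>' \<mu>"
proof -
  from assms(4) have rest: "\<And>j. j \<notin> {i, Suc i} \<Longrightarrow> lookup \<mu>' j = lookup \<mu> j"
    and sum: "lookup \<mu>' i + lookup \<mu>' (Suc i) = lookup \<mu> i + lookup \<mu> (Suc i)"
    and le: "min (lookup \<mu> i) (lookup \<mu> (Suc i)) \<le> lookup \<mu>' i" "lookup \<mu>' i \<le> max (lookup \<mu> i) (lookup \<mu> (Suc i))"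
    unfolding in_string_def by blast+
  consider "lookup \<mu>' i = lookup \<mu> i" | "lookup \<mu>' i = lookup \<mu> (Suc i)"
    | "min (lookup \<mu> i) (lookup \<mu> (Suc i)) < lookup \<mu>' i" "lookup \<mu>' i < max (lookup \<mu> i) (lookup \<mu> (Suc i))"
    using le by linarith
  thus ?thesis
  proof cases
    case 1
    have "\<mu>' = \<mu>"
    proof (rule poly_mapping_eqI)
      fix j show "lookup \<mu>' j = lookup \<mu> j" using 1 sum rest by (cases "j \<in> {i, Suc i}") auto
    qed
    thus ?thesis by (rule that)
  next
    case 2
    have "\<mu>' = comp_swap i \<mu>"
    proof (rule poly_mapping_eqI)
      fix j show "lookup \<mu>' j = lookup (comp_swap i \<mu>) j" using 2 sum rest by (cases "j \<in> {i, Suc i}") auto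
    qed
    thus ?thesis by (rule that)
  next
    case 3
    thus ?thesis
      using that rank_le_between [OF assms(1-3) composition_in_string [OF assms] rest sum] by blast
  qed
qed

lemma rank_le_in_string:
  assumes i: "1 \<le> i" "i < n" and le: "rank_le n \<mu> \<eta>" and less: "lookup \<eta> i < lookup \<eta> (Suc i)"
    and str: "in_string i \<mu> \<mu>'"
  shows "rank_le n \<mu>' (comp_swap i \<eta>)"
proof -
  have comp: "composition n \<mu>" "composition n \<eta>" using le by (simp_all add: rank_le_def)
  have up: "rank_le n \<mu> (comp_swap i \<eta>)"
    using rank_le_trans [OF le rank_le_swap [OF i comp(2) less]] .
  from in_string_cases [OF i comp(1) str] show ?thesis
    by cases (use up rank_le_swap_mono [OF i le less] rank_le_trans in blast)+
qed

text \<open>If s_i \<eta> is not the exchange of \<mu>, it is at most \<mu> and hence at most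
  \<eta>, which is impossible at an ascent. So the leading coefficient of T_i P comes from the
  leading term of P alone.\<close>

lemma in_string_top:
  assumes i: "1 \<le> i" "i < n" and le: "rank_le n \<mu> \<eta>" and less: "lookup \<eta> i < lookup \<eta> (Suc i)"
    and str: "in_string i \<mu> (comp_swap i \<eta>)"
  shows "\<mu> = \<eta>"
proof -
  have comp: "composition n \<mu>" "composition n \<eta>" using le by (simp_all add: rank_le_def)
  have no: "\<not> rank_le n (comp_swap i \<eta>) \<eta>"
    using rank_le_antisym rank_le_swap [OF i comp(2) less] less comp_swap_eq_iff [of i \<eta>] by fastforce
  from in_string_cases [OF i comp(1) str] show ?thesis
  proof cases
    case 2
    thus ?thesis by (metis comp_swap_swap)
  qed (use no le rank_le_trans in blast)+
qed

lemma rank_sum_shift: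
  assumes "1 \<le> n" "p < n"
  shows "rank_sum n (comp_shift n \<eta>) p c = rank_sum n \<eta> (Suc p) c"
proof -
  let ?h = "\<lambda>k. lookup \<eta> k + (if k \<le> Suc p then 1 else 0) - c"
  have "rank_sum n (comp_shift n \<eta>) p c = (\<Sum>j=1..n. ?h (cyc n j))"
    unfolding rank_sum_def lookup_comp_shift [OF assms(1)]
    by (rule sum.cong) (use assms in \<open>auto simp: cyc_def\<close>)
  also have "\<dots> = (\<Sum>k=1..n. ?h k)"
    by (rule sum.reindex_bij_betw [OF bij_cyc [OF assms(1)]])
  finally show ?thesis by (simp add: rank_sum_def)
qed

text \<open>The full window p = n adds 1 to every part, which amounts to lowering the level by 1;
  only the shifted first part keeps an extra 1. Level 0 is settled by
  \<open>rank_sum_0\<close>.\<close>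

lemma rank_sum_shift_n:
  assumes "1 \<le> n"
  shows "rank_sum n (comp_shift n \<eta>) n (Suc c) = rank_sum n \<eta> 1 c"
proof -
  let ?h = "\<lambda>k. lookup \<eta> k + (if k \<le> 1 then 1 else 0) - c"
  have "rank_sum n (comp_shift n \<eta>) n (Suc c) = (\<Sum>j=1..n. ?h (cyc n j))"
    unfolding rank_sum_def lookup_comp_shift [OF assms(1)]
    by (rule sum.cong) (use assms in \<open>auto simp: cyc_def\<close>)
  also have "\<dots> = (\<Sum>k=1..n. ?h k)"
    by (rule sum.reindex_bij_betw [OF bij_cyc [OF assms(1)]])
  finally show ?thesis by (simp add: rank_sum_def)
qed

lemma rank_sum_0:
  assumes "p \<le> n"
  shows "rank_sum n \<eta> p 0 = csize n \<eta> + p"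
proof -
  have "(\<Sum>j=1..n. if j \<le> p then 1 else 0 :: nat) = card {j\<in>{1..n}. j \<le> p}"
    by (simp only: card_eq_sum sum.inter_filter [OF finite_atLeastAtMost])
  also have "{j\<in>{1..n}. j \<le> p} = {1..p}" using assms by auto
  finally show ?thesis by (simp add: rank_sum_def csize_def sum.distrib)
qed

lemma rank_le_shift:
  assumes n: "1 \<le> n" and le: "rank_le n \<mu> \<eta>"
  shows "rank_le n (comp_shift n \<mu>) (comp_shift n \<eta>)"
  unfolding rank_le_def
proof (intro conjI allI impI)
  show "composition n (comp_shift n \<mu>)" "composition n (comp_shift n \<eta>)"
    using le n by (auto simp: rank_le_def composition_shift)
  show *: "csize n (comp_shift n \<mu>) = csize n (comp_shift n \<eta>)"
    using le n by (simp add: rank_le_def csize_shift)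
  fix p c assume p: "p \<le> n"
  consider "p < n" | "c = 0" | c' where "p = n" "c = Suc c'"
    using p by (cases "p < n"; cases c) auto
  thus "rank_sum n (comp_shift n \<mu>) p c \<le> rank_sum n (comp_shift n \<eta>) p c"
    by cases (use le n p * in \<open>auto simp: rank_sum_shift rank_sum_shift_n rank_sum_0 rank_le_def\<close>)
qed

text \<open>An integer that grows strictly along the order. Levels above the size contribute 0, so
  the finite range loses nothing.\<close>

definition rank_measure :: "nat \<Rightarrow> expo \<Rightarrow> nat" where
  "rank_measure n \<eta> = (\<Sum>p\<le>n. \<Sum>c\<le>csize n \<eta>. rank_sum n \<eta> p c)"

lemma rank_sum_large:
  assumes "csize n \<eta> < c"
  shows "rank_sum n \<eta> p c = 0"
proof -
  have "lookup \<eta> j + (if j \<le> p then 1 else 0) - c = 0" if "j \<in> {1..n}" for j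
    using assms member_le_sum [of j "{1..n}" "lookup \<eta>"] that by (simp add: csize_def)
  thus ?thesis unfolding rank_sum_def by (intro sum.neutral ballI)
qed

lemma rank_measure_less:
  assumes le: "rank_le n \<mu> \<eta>" and neq: "\<mu> \<noteq> \<eta>"
  shows "rank_measure n \<mu> < rank_measure n \<eta>"
proof -
  have size: "csize n \<mu> = csize n \<eta>" using le by (simp add: rank_le_def)
  have R: "rank_sum n \<mu> p c \<le> rank_sum n \<eta> p c" if "p \<le> n" for p c
    using le that by (simp add: rank_le_def)
  have "\<not> rank_le n \<eta> \<mu>" using rank_le_antisym le neq by blast
  then obtain p c where pc: "p \<le> n" "rank_sum n \<mu> p c < rank_sum n \<eta> p c"
    using le unfolding rank_le_def by (metis not_le)
  hence c: "c \<le> csize n \<eta>" using rank_sum_large [of n \<eta> c p] by (metis not_le not_less_zero)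
  have "(\<Sum>c\<le>csize n \<eta>. rank_sum n \<mu> p c) < (\<Sum>c\<le>csize n \<eta>. rank_sum n \<eta> p c)"
    by (rule sum_strict_mono_ex1) (use R pc c in auto)
  hence "(\<Sum>p\<le>n. \<Sum>c\<le>csize n \<eta>. rank_sum n \<mu> p c) < (\<Sum>p\<le>n. \<Sum>c\<le>csize n \<eta>. rank_sum n \<eta> p c)"
    using pc R by (intro sum_strict_mono_ex1) (auto intro: sum_mono)
  thus ?thesis by (simp add: rank_measure_def size)
qed

section \<open>Comparison with the dominance order\<close>

lemma sum_parts_desc: "(\<Sum>i=1..n. h (parts_desc n \<eta> i)) = (\<Sum>i=1..n. h (lookup \<eta> i) :: nat)"
proof -
  let ?L = "rev (sort (map (lookup \<eta>) [1..<Suc n]))"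
  have "(\<Sum>i=1..n. h (parts_desc n \<eta> i)) = (\<Sum>i<n. h (?L ! i))"
    unfolding parts_desc_def
    by (rule sum.reindex_bij_witness [of _ Suc "\<lambda>i. i - 1"]) (auto simp del: upt_Suc)
  also have "\<dots> = sum_list (map h ?L)"
    by (simp add: sum_list_sum_nth atLeast0LessThan del: upt_Suc)
  also have "\<dots> = sum_mset (image_mset h (mset ?L))"
    by (metis mset_map sum_mset_sum_list)
  also have "mset ?L = mset (map (lookup \<eta>) [1..<Suc n])"
    by simp
  also have "sum_mset (image_mset h \<dots>) = sum_list (map (\<lambda>i. h (lookup \<eta> i)) [1..<Suc n])"
    by (metis (no_types, lifting) mset_map sum_mset_sum_list map_map comp_apply map_eq_conv)
  also have "\<dots> = (\<Sum>i=1..n. h (lookup \<eta> i))"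
    by (simp only: distinct_upt sum_list_distinct_conv_sum_set set_upt atLeastLessThanSuc_atLeastAtMost)
  finally show ?thesis .
qed

lemma parts_desc_mono:
  assumes "1 \<le> i" "i \<le> j" "j \<le> n"
  shows "parts_desc n \<eta> j \<le> parts_desc n \<eta> i"
proof -
  let ?L = "sort (map (lookup \<eta>) [1..<Suc n])"
  have len: "length ?L = n" by simp
  have "?L ! (n - j) \<le> ?L ! (n - i)"
    by (rule sorted_nth_mono) (use assms len in auto)
  thus ?thesis using assms unfolding parts_desc_def by (simp add: rev_nth del: upt_Suc)
qed

lemma sum_truncated_Suc: "x \<le> M \<Longrightarrow> (\<Sum>c=1..M. x + 1 - c) = (\<Sum>c=1..M. x - c) + (x::nat)"
proof -
  assume "x \<le> M"
  have "(\<Sum>c=1..M. x + 1 - c) = (\<Sum>c=1..M. (x - c) + (if c \<le> x then 1 else 0))"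
    by (rule sum.cong) auto
  also have "\<dots> = (\<Sum>c=1..M. x - c) + card {c\<in>{1..M}. c \<le> x}"
    by (simp only: sum.distrib card_eq_sum sum.inter_filter [OF finite_atLeastAtMost])
  also have "{c\<in>{1..M}. c \<le> x} = {1..x}" using \<open>x \<le> M\<close> by auto
  finally show ?thesis by simp
qed

text \<open>Raising a part x by 1 adds 1 at each of the levels 1, ..., x. Summed over the positive
  levels, the rank sums therefore yield the partial sums of the composition.\<close>

lemma sum_rank_sum:
  assumes "csize n \<eta> \<le> M" "p \<le> n"
  shows "(\<Sum>c=1..M. rank_sum n \<eta> p c) = (\<Sum>c=1..M. rank_sum n \<eta> 0 c) + (\<Sum>j=1..p. lookup \<eta> j)"
proof -
  have le: "lookup \<eta> j \<le> M" if "j \<in> {1..n}" for j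
    using assms member_le_sum [of j "{1..n}" "lookup \<eta>"] that by (simp add: csize_def)
  have "(\<Sum>c=1..M. rank_sum n \<eta> p c) = (\<Sum>j=1..n. \<Sum>c=1..M. lookup \<eta> j + (if j \<le> p then 1 else 0) - c)"
    unfolding rank_sum_def by (rule sum.swap)
  also have "\<dots> = (\<Sum>j=1..n. (\<Sum>c=1..M. lookup \<eta> j - c) + (if j \<le> p then lookup \<eta> j else 0))"
    using le by (intro sum.cong) (auto simp: sum_truncated_Suc)
  also have "\<dots> = (\<Sum>j=1..n. \<Sum>c=1..M. lookup \<eta> j - c) + (\<Sum>j\<in>{j\<in>{1..n}. j \<le> p}. lookup \<eta> j)"
    by (simp add: sum.distrib sum.inter_filter del: atLeastAtMost_iff)
  also have "{j\<in>{1..n}. j \<le> p} = {1..p}" using assms by auto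
  also have "(\<Sum>j=1..n. \<Sum>c=1..M. lookup \<eta> j - c) = (\<Sum>c=1..M. rank_sum n \<eta> 0 c)"
    unfolding rank_sum_def by (subst sum.swap) (auto intro!: sum.cong)
  finally show ?thesis .
qed

lemma rank_sum_parts_desc: "rank_sum n \<eta> 0 c = (\<Sum>i=1..n. parts_desc n \<eta> i - c)"
proof -
  have "rank_sum n \<eta> 0 c = (\<Sum>j=1..n. lookup \<eta> j - c)"
    unfolding rank_sum_def by (rule sum.cong) auto
  thus ?thesis using sum_parts_desc [of "\<lambda>x. x - c" n \<eta>] by simp
qed

text \<open>Any p parts sum to at most p c plus the truncated excesses over c, with equality for the
  p largest parts of \<eta> when c is the smallest of these.\<close>

lemma parts_desc_prefix_le:
  assumes le: "\<And>c. rank_sum n \<mu> 0 c \<le> rank_sum n \<eta> 0 c" and p: "p \<in> {1..n}"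
  shows "(\<Sum>i=1..p. parts_desc n \<mu> i) \<le> (\<Sum>i=1..p. parts_desc n \<eta> i)"
proof -
  define c where "c = parts_desc n \<eta> p"
  have sub: "{1..p} \<subseteq> {1..n}" using p by auto
  have "(\<Sum>i=1..p. parts_desc n \<mu> i) \<le> (\<Sum>i=1..p. c + (parts_desc n \<mu> i - c))"
    by (rule sum_mono) simp
  also have "\<dots> = p * c + (\<Sum>i=1..p. parts_desc n \<mu> i - c)"
    by (simp add: sum.distrib)
  also have "\<dots> \<le> p * c + (\<Sum>i=1..n. parts_desc n \<mu> i - c)"
    using sub by (intro add_left_mono sum_mono2) auto
  also have "\<dots> \<le> p * c + (\<Sum>i=1..n. parts_desc n \<eta> i - c)"
    using le [of c] by (simp add: rank_sum_parts_desc)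
  also have "(\<Sum>i=1..n. parts_desc n \<eta> i - c) = (\<Sum>i=1..p. parts_desc n \<eta> i - c)"
  proof (rule sum.mono_neutral_right)
    show "\<forall>i\<in>{1..n} - {1..p}. parts_desc n \<eta> i - c = 0"
      using p parts_desc_mono [of p _ n \<eta>] by (auto simp: c_def)
  qed (use sub in auto)
  also have "p * c + \<dots> = (\<Sum>i=1..p. c + (parts_desc n \<eta> i - c))"
    by (simp add: sum.distrib)
  also have "\<dots> = (\<Sum>i=1..p. parts_desc n \<eta> i)"
    using p parts_desc_mono [of _ p n \<eta>] by (intro sum.cong) (auto simp: c_def)
  finally show ?thesis .
qed

lemma dominatedI:
  assumes "\<exists>i\<in>{1..n}. \<mu> i \<noteq> \<eta> i" "\<And>p. p \<in> {1..n} \<Longrightarrow> (\<Sum>i=1..p. \<mu> i) \<le> (\<Sum>i=1..p. \<eta> i)"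
  shows "dominated n \<mu> \<eta>"
  unfolding dominated_def
proof (intro conjI ballI assms(1))
  fix p assume "p \<in> {1..n}"
  hence "int (\<Sum>i=1..p. \<mu> i) \<le> int (\<Sum>i=1..p. \<eta> i)" using assms(2) by (simp only: of_nat_le_iff)
  thus "0 \<le> (\<Sum>i=1..p. int (\<eta> i) - int (\<mu> i))" by (simp add: sum_subtractf)
qed

text \<open>The rank sums at p = 0 see only the partition and give dominance of partitions. If the
  partitions agree, these sums coincide, and the other p give dominance of the compositions.\<close>

lemma rank_le_comp_prec:
  assumes le: "rank_le n \<mu> \<eta>" and neq: "\<mu> \<noteq> \<eta>"
  shows "comp_prec n \<mu> \<eta>"
proof (cases "\<forall>i\<in>{1..n}. parts_desc n \<mu> i = parts_desc n \<eta> i")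
  case True
  have comp: "composition n \<mu>" "composition n \<eta>" and size: "csize n \<mu> = csize n \<eta>"
    using le by (simp_all add: rank_le_def)
  have R: "rank_sum n \<mu> p c \<le> rank_sum n \<eta> p c" if "p \<le> n" for p c
    using le that by (simp add: rank_le_def)
  have R0: "rank_sum n \<mu> 0 c = rank_sum n \<eta> 0 c" for c
    using True by (simp add: rank_sum_parts_desc)
  have "dominated n (lookup \<mu>) (lookup \<eta>)"
  proof (rule dominatedI)
    show "\<exists>i\<in>{1..n}. lookup \<mu> i \<noteq> lookup \<eta> i" using composition_eqI [OF comp] neq by blast
    fix p assume p: "p \<in> {1..n}"
    hence "(\<Sum>c=1..csize n \<eta>. rank_sum n \<mu> p c) \<le> (\<Sum>c=1..csize n \<eta>. rank_sum n \<eta> p c)"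
      by (intro sum_mono R) auto
    thus "(\<Sum>i=1..p. lookup \<mu> i) \<le> (\<Sum>i=1..p. lookup \<eta> i)"
      using sum_rank_sum [of n \<mu> "csize n \<eta>" p] sum_rank_sum [of n \<eta> "csize n \<eta>" p] p size
      by (simp add: R0)
  qed
  thus ?thesis using True comp size by (simp add: comp_prec_def)
next
  case False
  have "dominated n (parts_desc n \<mu>) (parts_desc n \<eta>)"
  proof (rule dominatedI)
    show "\<exists>i\<in>{1..n}. parts_desc n \<mu> i \<noteq> parts_desc n \<eta> i" using False by blast
    show "(\<Sum>i=1..p. parts_desc n \<mu> i) \<le> (\<Sum>i=1..p. parts_desc n \<eta> i)" if "p \<in> {1..n}" for p
      using le that by (intro parts_desc_prefix_le) (simp_all add: rank_le_def)
  qed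
  thus ?thesis using le by (simp add: comp_prec_def rank_le_def)
qed


section \<open>Supports and leading coefficients\<close>

lemma monomial_sum: "f = (\<Sum>\<mu>\<in>keys f. Const (lookup f \<mu>) * single \<mu> 1)"
  for f :: mpoly
  by (simp add: mult_single sum_single_keys)

lemma linear_op_lookup:
  assumes "linear_op L"
  shows "lookup (L f) \<nu> = (\<Sum>\<mu>\<in>keys f. lookup f \<mu> * lookup (L (single \<mu> 1)) \<nu>)"
proof -
  have "L f = (\<Sum>\<mu>\<in>keys f. Const (lookup f \<mu>) * L (single \<mu> 1))"
    using arg_cong [OF monomial_sum, of L f] assms by (simp only: linear_op_sum linear_op_Const)
  thus ?thesis by (simp add: lookup_sum lookup_Const_mult)
qed

lemma linear_op_support:
  assumes "linear_op L" "lookup (L f) \<nu> \<noteq> 0"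
  obtains \<mu> where "lookup f \<mu> \<noteq> 0" "lookup (L (single \<mu> 1)) \<nu> \<noteq> 0"
proof -
  from assms(2) obtain \<mu> where "\<mu> \<in> keys f" "lookup f \<mu> * lookup (L (single \<mu> 1)) \<nu> \<noteq> 0"
    unfolding linear_op_lookup [OF assms(1), of f \<nu>] by (meson sum.not_neutral_contains_not_neutral)
  thus ?thesis using that by auto
qed

lemma subst_mono_perm:
  assumes "\<And>k. \<sigma> (\<pi> k) = k" "\<And>k. \<pi> (\<sigma> k) = k"
  shows "subst_mono (\<lambda>k. Var (\<pi> k)) \<mu> = single (Poly_Mapping.map_key \<sigma> \<mu>) 1"
proof -
  have inj: "inj \<pi>" "inj \<sigma>" using assms by (metis injI)+
  have keys: "keys (Poly_Mapping.map_key \<sigma> \<mu>) = \<pi> ` keys \<mu>"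
  proof (rule set_eqI)
    fix k
    show "k \<in> keys (Poly_Mapping.map_key \<sigma> \<mu>) \<longleftrightarrow> k \<in> \<pi> ` keys \<mu>"
      unfolding keys_map_key [OF inj(2)] vimage_eq image_iff using assms by metis
  qed
  have "subst_mono Var (Poly_Mapping.map_key \<sigma> \<mu>) = (\<Prod>k\<in>keys \<mu>. Var (\<pi> k) ^ lookup \<mu> k)"
    unfolding subst_mono_def keys using inj
    by (subst prod.reindex) (auto simp: map_key.rep_eq assms intro: inj_on_subset)
  thus ?thesis by (simp add: subst_mono_Var subst_mono_def)
qed

lemma swap_monomial: "swap i (single \<mu> 1) = single (comp_swap i \<mu>) 1"
  by (simp add: swap_def msubst_monomial comp_swap_def
      subst_mono_perm [of "transpose i (Suc i)" "transpose i (Suc i)"])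

lemma lookup_monomial_mult:
  fixes p :: mpoly
  shows "lookup (single \<rho> 1 * p) (\<rho> + \<kappa>) = lookup p \<kappa>"
proof (induction p rule: mpoly_induct)
  case (monomial \<mu> c)
  show ?case by (simp add: mult_single lookup_single when_def)
qed (simp add: distrib_left lookup_add)

lemma support_monomial_mult:
  fixes p :: mpoly
  assumes "lookup (single \<rho> 1 * p) \<mu> \<noteq> 0"
  obtains \<kappa> where "\<mu> = \<rho> + \<kappa>" "lookup p \<kappa> \<noteq> 0"
proof -
  have "\<mu> \<in> keys (single \<rho> 1 * p)" using assms by (simp add: in_keys_iff)
  then obtain a b where "\<mu> = a + b" "a \<in> keys (single \<rho> (1::qt_field))" "b \<in> keys p"
    using keys_mult [of "single \<rho> (1::qt_field)" p] by blast
  thus ?thesis using that by (auto simp: in_keys_iff split: if_splits)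
qed

section \<open>Hecke operators on monomials\<close>

lemma Var_power: "Var i ^ k = single (single i k) 1"
  using subst_mono_single [of Var i k] by (simp add: subst_mono_Var)

text \<open>The divided difference of a power is the geometric sum (x^m - y^m) / (x - y).\<close>

lemma hecke_T_power:
  fixes i :: nat
  defines "x \<equiv> Var i" and "y \<equiv> Var (Suc i)"
  shows "hecke_T i (y ^ m) = Const tt * y ^ m + (Const tt * x - y) * (\<Sum>k<m. y ^ (m - Suc k) * x ^ k)"
    and "hecke_T i (x ^ m) = Const tt * x ^ m - (Const tt * x - y) * (\<Sum>k<m. y ^ (m - Suc k) * x ^ k)"
proof -
  let ?S = "\<Sum>k<m. y ^ (m - Suc k) * x ^ k" and ?t = "Const tt"
  have S: "(x - y) * ?S = x ^ m - y ^ m" by (rule power_diff_sumr2 [symmetric])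
  have "swap i (p ^ m) = swap i p ^ m" for p by (simp add: swap_def msubst_power)
  moreover have "swap i x = y" "swap i y = x" by (simp_all add: x_def y_def swap_Var)
  ultimately have swap: "swap i (x ^ m) = y ^ m" "swap i (y ^ m) = x ^ m" by metis+
  have e: "(x - y) * (t * v + (t * x - y) * s) = (t * x - y) * u - (t - 1) * y * v"
    "(x - y) * (t * u - (t * x - y) * s) = (t * x - y) * v - (t - 1) * y * u"
    if s: "(x - y) * s = u - v" for t s u v :: mpoly
  proof -
    have "(x - y) * (t * v + (t * x - y) * s) = t * (x - y) * v + (t * x - y) * ((x - y) * s)"
      "(x - y) * (t * u - (t * x - y) * s) = t * (x - y) * u - (t * x - y) * ((x - y) * s)" by algebra+
    thus "(x - y) * (t * v + (t * x - y) * s) = (t * x - y) * u - (t - 1) * y * v"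
      "(x - y) * (t * u - (t * x - y) * s) = (t * x - y) * v - (t - 1) * y * u"
      unfolding s by algebra+
  qed
  show "hecke_T i (y ^ m) = ?t * y ^ m + (?t * x - y) * ?S"
    by (rule hecke_T_unique, fold x_def y_def) (simp only: e(1) [OF S] swap)
  show "hecke_T i (x ^ m) = ?t * x ^ m - (?t * x - y) * ?S"
    by (rule hecke_T_unique, fold x_def y_def) (simp only: e(2) [OF S] swap)
qed

definition two_var :: "nat \<Rightarrow> nat \<Rightarrow> mpoly \<Rightarrow> bool" where
  "two_var i m p \<longleftrightarrow> (\<forall>\<mu>. lookup p \<mu> \<noteq> 0 \<longrightarrow> (\<exists>u v. u + v = m \<and> \<mu> = single i u + single (Suc i) v))"

lemma two_var_monomial: "u + v = m \<Longrightarrow> two_var i m (Var i ^ u * Var (Suc i) ^ v)"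
  by (auto simp: two_var_def Var_power mult_single lookup_single when_def)

lemma two_var_add: "two_var i m p \<Longrightarrow> two_var i m q \<Longrightarrow> two_var i m (p + q)"
  and two_var_diff: "two_var i m p \<Longrightarrow> two_var i m q \<Longrightarrow> two_var i m (p - q)"
  and two_var_Const: "two_var i m p \<Longrightarrow> two_var i m (Const c * p)"
  unfolding two_var_def lookup_add lookup_minus lookup_Const_mult
  by (metis add.right_neutral, metis diff_zero diff_self right_minus_eq, metis mult_zero_right)

lemma two_var_sum: "(\<And>k. k \<in> A \<Longrightarrow> two_var i m (h k)) \<Longrightarrow> two_var i m (\<Sum>k\<in>A. h k)"
  by (induction A rule: infinite_finite_induct) (auto intro: two_var_add simp: two_var_def [of _ _ 0])

lemma power_sum_expand:
  fixes t x y :: "'a::comm_ring_1"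
  shows "(t * x - y) * (\<Sum>k<m. y ^ (m - Suc k) * x ^ k)
      = (\<Sum>k<m. t * (x ^ Suc k * y ^ (m - Suc k)) - x ^ k * y ^ Suc (m - Suc k))"
  unfolding sum_distrib_left
proof (rule sum.cong [OF refl])
  fix k
  show "(t * x - y) * (y ^ (m - Suc k) * x ^ k) = t * (x ^ Suc k * y ^ (m - Suc k)) - x ^ k * y ^ Suc (m - Suc k)"
    unfolding power_Suc by (simp only: algebra_simps)
qed

lemma two_var_hecke_T: "two_var i m (hecke_T i (Var (Suc i) ^ m))" "two_var i m (hecke_T i (Var i ^ m))"
proof -
  let ?x = "Var i" and ?y = "Var (Suc i)" and ?t = "Const tt"
  have "two_var i m (\<Sum>k<m. ?t * (?x ^ Suc k * ?y ^ (m - Suc k)) - ?x ^ k * ?y ^ Suc (m - Suc k))"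
    by (intro two_var_sum two_var_diff two_var_Const two_var_monomial) auto
  moreover have "two_var i m (?y ^ m)" "two_var i m (?x ^ m)"
    using two_var_monomial [of 0 m m i] two_var_monomial [of m 0 m i] by simp_all
  ultimately show "two_var i m (hecke_T i (?y ^ m))" "two_var i m (hecke_T i (?x ^ m))"
    unfolding hecke_T_power power_sum_expand by (simp_all only: two_var_add two_var_diff two_var_Const)
qed

lemma hecke_T_power_top:
  assumes "0 < m"
  shows "lookup (hecke_T i (Var (Suc i) ^ m)) (single i m) = tt"
proof -
  let ?x = "Var i" and ?y = "Var (Suc i)" and ?t = "Const tt"
  have key: "single i u + single (Suc i) v = single i m \<longleftrightarrow> u = m \<and> v = 0" for u v :: nat
  proof
    assume eq: "single i u + single (Suc i) v = single i m"
    show "u = m \<and> v = 0"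
      using arg_cong [OF eq, of "\<lambda>\<mu>. lookup \<mu> i"] arg_cong [OF eq, of "\<lambda>\<mu>. lookup \<mu> (Suc i)"]
      by (simp add: lookup_add lookup_single_not_eq)
  qed simp
  have mon: "lookup (?x ^ u * ?y ^ v) (single i m) = (if u = m \<and> v = 0 then 1 else 0)" for u v
    by (simp add: Var_power mult_single lookup_single when_def key)
  have ym: "lookup (?y ^ m) (single i m) = 0" using mon [of 0 m] assms by simp
  have "lookup (hecke_T i (?y ^ m)) (single i m) = (\<Sum>k<m. tt * (if Suc k = m \<and> m - Suc k = 0 then 1 else 0))"
    unfolding hecke_T_power power_sum_expand
    by (simp only: lookup_add lookup_Const_mult ym lookup_sum lookup_minus mon) simp
  \<comment> \<open>The pure power z_i^m occurs in the expanded sum only for the last k, with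
    coefficient t.\<close>
  also have "\<dots> = (\<Sum>k<m. if k = m - 1 then tt else 0)"
    by (rule sum.cong) auto
  also have "\<dots> = tt" using assms by (simp add: sum.delta)
  finally show ?thesis .
qed

text \<open>The monomial z^\<rho> has equal exponents at i and i + 1 and therefore commutes with
  T_i, which leaves a pure power for T_i to act on.\<close>

lemma hecke_T_monomial:
  assumes "lookup \<mu> i \<le> lookup \<mu> (Suc i)"
  defines "\<rho> \<equiv> \<mu> - single (Suc i) (lookup \<mu> (Suc i) - lookup \<mu> i)"
  shows "hecke_T i (single \<mu> 1) = single \<rho> 1 * hecke_T i (Var (Suc i) ^ (lookup \<mu> (Suc i) - lookup \<mu> i))"
    and "hecke_T i (single (comp_swap i \<mu>) 1) = single \<rho> 1 * hecke_T i (Var i ^ (lookup \<mu> (Suc i) - lookup \<mu> i))"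
    and "comp_swap i \<mu> = \<rho> + single i (lookup \<mu> (Suc i) - lookup \<mu> i)"
    and "\<mu> = \<rho> + single (Suc i) (lookup \<mu> (Suc i) - lookup \<mu> i)"
proof -
  let ?m = "lookup \<mu> (Suc i) - lookup \<mu> i"
  have \<rho>: "lookup \<rho> k = (if k = Suc i then lookup \<mu> i else lookup \<mu> k)" for k
    using assms(1) by (auto simp: \<rho>_def lookup_minus lookup_single when_def)
  show 1: "\<mu> = \<rho> + single (Suc i) ?m"
    by (rule poly_mapping_eqI) (use assms(1) in \<open>auto simp: lookup_add \<rho> lookup_single when_def\<close>)
  show 2: "comp_swap i \<mu> = \<rho> + single i ?m"
    by (rule poly_mapping_eqI)
       (use assms(1) in \<open>auto simp: lookup_add \<rho> lookup_single when_def lookup_comp_swap transpose_def\<close>)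
  have "comp_swap i \<rho> = \<rho>" by (simp add: comp_swap_eq_iff \<rho>)
  hence T: "hecke_T i (single \<rho> 1 * p) = single \<rho> 1 * hecke_T i p" for p
    by (intro hecke_T_mult_symmetric) (simp add: swap_monomial)
  have m: "single (\<rho> + \<kappa>) 1 = single \<rho> 1 * single \<kappa> (1::qt_field)" for \<kappa>
    by (simp add: mult_single)
  show "hecke_T i (single \<mu> 1) = single \<rho> 1 * hecke_T i (Var (Suc i) ^ ?m)"
    by (subst 1) (simp only: m T Var_power)
  show "hecke_T i (single (comp_swap i \<mu>) 1) = single \<rho> 1 * hecke_T i (Var i ^ ?m)"
    unfolding 2 by (simp only: m T Var_power)
qed

lemma in_string_swap: "in_string i (comp_swap i \<mu>) \<mu>' \<longleftrightarrow> in_string i \<mu> \<mu>'"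
  by (auto simp: in_string_def)

lemma support_hecke_T_monomial:
  assumes "lookup (hecke_T i (single \<mu> 1)) \<mu>' \<noteq> 0"
  shows "in_string i \<mu> \<mu>'"
proof -
  have main: "in_string i \<nu> \<mu>'"
    if le: "lookup \<nu> i \<le> lookup \<nu> (Suc i)" and \<mu>: "\<mu> = \<nu> \<or> \<mu> = comp_swap i \<nu>" for \<nu>
  proof -
    let ?m = "lookup \<nu> (Suc i) - lookup \<nu> i"
    let ?\<rho> = "\<nu> - single (Suc i) ?m"
    obtain p where p: "hecke_T i (single \<mu> 1) = single ?\<rho> 1 * p" "two_var i ?m p"
      using \<mu> hecke_T_monomial [OF le] two_var_hecke_T by metis
    from assms obtain \<kappa> where "\<mu>' = ?\<rho> + \<kappa>" "lookup p \<kappa> \<noteq> 0"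
      unfolding p(1) by (rule support_monomial_mult)
    with p(2) obtain u v where uv: "u + v = ?m" "\<mu>' = ?\<rho> + (single i u + single (Suc i) v)"
      unfolding two_var_def by blast
    have "lookup \<mu>' k = (if k = Suc i then lookup \<nu> i + v else if k = i then lookup \<nu> i + u else lookup \<nu> k)" for k
      unfolding uv(2) using le by (auto simp: lookup_add lookup_minus lookup_single when_def)
    thus ?thesis using uv(1) le by (auto simp: in_string_def)
  qed
  show ?thesis
  proof (cases "lookup \<mu> i \<le> lookup \<mu> (Suc i)")
    case True
    thus ?thesis using main by blast
  next
    case False
    hence "in_string i (comp_swap i \<mu>) \<mu>'" by (intro main) auto
    thus ?thesis by (simp only: in_string_swap)
  qed
qed

lemma hecke_T_monomial_top:
  assumes "lookup \<mu> i < lookup \<mu> (Suc i)"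
  shows "lookup (hecke_T i (single \<mu> 1)) (comp_swap i \<mu>) = tt"
proof -
  from assms have le: "lookup \<mu> i \<le> lookup \<mu> (Suc i)" by simp
  show ?thesis
    unfolding hecke_T_monomial(1,3) [OF le] lookup_monomial_mult
    using assms by (intro hecke_T_power_top) simp
qed

lemma raise_monomial:
  assumes "1 \<le> n"
  shows "raise_op n (single \<mu> 1) = Const (qq ^ lookup \<mu> 1) * single (comp_shift n \<mu>) 1"
proof -
  define \<pi> where "\<pi> k = (if k = 1 then n else if 2 \<le> k \<and> k \<le> n then k - 1 else k)" for k
  have \<pi>: "cyc n (\<pi> k) = k" "\<pi> (cyc n k) = k" for k
    using assms by (auto simp: cyc_def \<pi>_def)
  have "subst_mono (omega_subst n) \<mu> = (\<Prod>k\<in>keys \<mu>. (if k = 1 then Const (qq ^ lookup \<mu> 1) else 1) * Var (\<pi> k) ^ lookup \<mu> k)"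
    unfolding subst_mono_def
    by (intro prod.cong) (auto simp: omega_subst_def \<pi>_def Const_power power_mult_distrib)
  also have "\<dots> = Const (qq ^ lookup \<mu> 1) * subst_mono (\<lambda>k. Var (\<pi> k)) \<mu>"
    by (cases "1 \<in> keys \<mu>") (auto simp: subst_mono_def prod.distrib prod.delta in_keys_iff)
  also have "subst_mono (\<lambda>k. Var (\<pi> k)) \<mu> = single (Poly_Mapping.map_key (cyc n) \<mu>) 1"
    using \<pi> by (rule subst_mono_perm)
  finally have "raise_op n (single \<mu> 1)
     = Const (qq ^ lookup \<mu> 1) * (Var n * single (Poly_Mapping.map_key (cyc n) \<mu>) 1)"
    using assms by (simp add: raise_op_def omega_op_eq msubst_monomial mult.left_commute)
  thus ?thesis by (simp add: mult_single comp_shift_def add.commute)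
qed


section \<open>Homogeneous polynomials and triangular bases\<close>

definition comps :: "nat \<Rightarrow> nat \<Rightarrow> expo set" where
  "comps n d = {\<nu>. composition n \<nu> \<and> csize n \<nu> = d}"

lemma finite_comps [simp]: "finite (comps n d)"
  unfolding comps_def by (rule finite_compositions)

definition homogeneous :: "nat \<Rightarrow> nat \<Rightarrow> mpoly \<Rightarrow> bool" where
  "homogeneous n d f \<longleftrightarrow> (\<forall>\<mu>. lookup f \<mu> \<noteq> 0 \<longrightarrow> \<mu> \<in> comps n d)"

lemma homogeneous_0: "homogeneous n d 0"
  by (simp add: homogeneous_def)

lemma homogeneous_add: "homogeneous n d f \<Longrightarrow> homogeneous n d g \<Longrightarrow> homogeneous n d (f + g)"
  unfolding homogeneous_def lookup_add by (metis add.right_neutral)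

lemma homogeneous_Const: "homogeneous n d f \<Longrightarrow> homogeneous n d (Const c * f)"
  unfolding homogeneous_def lookup_Const_mult by (metis mult_zero_right)

lemma homogeneous_sum: "(\<And>k. k \<in> A \<Longrightarrow> homogeneous n d (h k)) \<Longrightarrow> homogeneous n d (\<Sum>k\<in>A. h k)"
  by (induction A rule: infinite_finite_induct) (auto intro: homogeneous_add homogeneous_0)

lemma homogeneous_linear_op:
  assumes "linear_op L" "homogeneous n d f" "\<And>\<mu>. \<mu> \<in> comps n d \<Longrightarrow> homogeneous n e (L (single \<mu> 1))"
  shows "homogeneous n e (L f)"
  unfolding homogeneous_def
proof (intro allI impI)
  fix \<nu> assume "lookup (L f) \<nu> \<noteq> 0"
  with assms(1) obtain \<mu> where "lookup f \<mu> \<noteq> 0" "lookup (L (single \<mu> 1)) \<nu> \<noteq> 0"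
    by (rule linear_op_support)
  thus "\<nu> \<in> comps n e" using assms(2,3) unfolding homogeneous_def by blast
qed

lemma csize_in_string:
  assumes "1 \<le> i" "i < n" "in_string i \<mu> \<mu>'"
  shows "csize n \<mu>' = csize n \<mu>"
proof -
  have "(\<Sum>j\<in>{1..n} - {i, Suc i}. lookup \<mu>' j) = (\<Sum>j\<in>{1..n} - {i, Suc i}. lookup \<mu> j)"
    using assms(3) by (intro sum.cong) (auto simp: in_string_def)
  thus ?thesis
    unfolding csize_def sum_split_adjacent [OF assms(1,2)] using assms(3) by (simp add: in_string_def)
qed

lemma homogeneous_hecke_T:
  assumes "1 \<le> i" "i < n" "homogeneous n d f"
  shows "homogeneous n d (hecke_T i f)"
  using linear_hecke_T assms(3)
proof (rule homogeneous_linear_op)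
  fix \<mu> assume \<mu>: "\<mu> \<in> comps n d"
  show "homogeneous n d (hecke_T i (single \<mu> 1))"
    unfolding homogeneous_def
    using \<mu> support_hecke_T_monomial composition_in_string [OF assms(1,2)] csize_in_string [OF assms(1,2)]
    by (auto simp: comps_def)
qed

lemma homogeneous_raise:
  assumes "1 \<le> n" "homogeneous n d f"
  shows "homogeneous n (Suc d) (raise_op n f)"
  using linear_raise [OF assms(1)] assms(2)
proof (rule homogeneous_linear_op)
  fix \<mu> assume "\<mu> \<in> comps n d"
  hence "comp_shift n \<mu> \<in> comps n (Suc d)"
    using assms(1) by (simp add: comps_def composition_shift csize_shift)
  thus "homogeneous n (Suc d) (raise_op n (single \<mu> 1))"
    using assms(1) by (simp add: homogeneous_def raise_monomial lookup_Const_mult lookup_single when_def)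
qed

lemma csize_add: "csize n (\<mu> + \<nu>) = csize n \<mu> + csize n \<nu>"
  by (simp add: csize_def lookup_add sum.distrib)

lemma csize_single: "i \<in> {1..n} \<Longrightarrow> csize n (single i k) = k"
  by (simp add: csize_def lookup_single when_def)

lemma composition_add: "composition n \<mu> \<Longrightarrow> composition n \<nu> \<Longrightarrow> composition n (\<mu> + \<nu>)"
  unfolding composition_def using keys_add [of \<mu> \<nu>] by blast

lemma composition_single: "i \<in> {1..n} \<Longrightarrow> composition n (single i k)"
  by (simp add: composition_def)

lemma homogeneous_var_sum:
  assumes "1 \<le> n" "homogeneous n d f"
  shows "homogeneous n (Suc d) (var_sum n * f)"
  using linear_op_mult assms(2)
proof (rule homogeneous_linear_op)
  fix \<mu> assume \<mu>: "\<mu> \<in> comps n d"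
  have "homogeneous n (Suc d) (Var i * single \<mu> 1)" if "i \<in> {1..n}" for i
    using \<mu> that
    by (auto simp: homogeneous_def mult_single lookup_single when_def comps_def csize_add csize_single
        composition_add composition_single simp del: atLeastAtMost_iff)
  thus "homogeneous n (Suc d) (var_sum n * single \<mu> 1)"
    unfolding var_sum_def [OF assms(1)] sum_distrib_right by (rule homogeneous_sum)
qed

text \<open>Leading coefficients are only required to be nonzero, so that the notion covers the
  E_\<nu>, the F_\<nu> and the rescaled images of E_\<nu> under inversion of q and t.\<close>

definition triangular :: "nat \<Rightarrow> (expo \<Rightarrow> mpoly) \<Rightarrow> bool" where
  "triangular n e \<longleftrightarrow> (\<forall>\<nu>. composition n \<nu> \<longrightarrow>
     lookup (e \<nu>) \<nu> \<noteq> 0 \<and> (\<forall>\<mu>. lookup (e \<nu>) \<mu> \<noteq> 0 \<longrightarrow> rank_le n \<mu> \<nu>))"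

lemma triangular_homogeneous:
  assumes "triangular n e" "\<nu> \<in> comps n d"
  shows "homogeneous n d (e \<nu>)"
  using assms unfolding triangular_def homogeneous_def rank_le_def comps_def by auto

lemma triangular_spans:
  assumes tri: "triangular n e" and f: "homogeneous n d f"
  shows "\<exists>c. f = (\<Sum>\<nu>\<in>comps n d. Const (c \<nu>) * e \<nu>)"
proof -
  define W where "W = {f. \<exists>c. f = (\<Sum>\<nu>\<in>comps n d. Const (c \<nu>) * e \<nu>)}"
  have add: "g + h \<in> W" if gh: "g \<in> W" "h \<in> W" for g h
  proof -
    from gh obtain a b where "g = (\<Sum>\<nu>\<in>comps n d. Const (a \<nu>) * e \<nu>)" "h = (\<Sum>\<nu>\<in>comps n d. Const (b \<nu>) * e \<nu>)"
      unfolding W_def by blast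
    hence "g + h = (\<Sum>\<nu>\<in>comps n d. Const (a \<nu> + b \<nu>) * e \<nu>)"
      by (simp only: Const_add distrib_right sum.distrib)
    thus ?thesis unfolding W_def by (intro CollectI exI [of _ "\<lambda>\<nu>. a \<nu> + b \<nu>"])
  qed
  have mult: "Const k * g \<in> W" if g: "g \<in> W" for g k
  proof -
    from g obtain a where "g = (\<Sum>\<nu>\<in>comps n d. Const (a \<nu>) * e \<nu>)"
      unfolding W_def by blast
    hence "Const k * g = (\<Sum>\<nu>\<in>comps n d. Const (k * a \<nu>) * e \<nu>)"
      by (simp only: Const_mult sum_distrib_left mult.assoc)
    thus ?thesis unfolding W_def by (intro CollectI exI [of _ "\<lambda>\<nu>. k * a \<nu>"])
  qed
  have zero: "0 \<in> W" unfolding W_def by (auto intro!: exI [of _ "\<lambda>_. 0"])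
  have sum: "(\<Sum>k\<in>A. h k) \<in> W" if "\<And>k. k \<in> A \<Longrightarrow> h k \<in> W" for A :: "expo set" and h
    using that by (induction A rule: infinite_finite_induct) (auto intro: add zero)
  have e: "e \<nu> \<in> W" if "\<nu> \<in> comps n d" for \<nu>
  proof -
    have "(\<Sum>\<mu>\<in>comps n d. Const (if \<mu> = \<nu> then 1 else 0) * e \<mu>) = (\<Sum>\<mu>\<in>comps n d. if \<mu> = \<nu> then e \<mu> else 0)"
      by (rule sum.cong) auto
    also have "\<dots> = e \<nu>" using that by simp
    finally show ?thesis
      unfolding W_def by (intro CollectI exI [of _ "\<lambda>\<mu>. if \<mu> = \<nu> then 1 else 0"]) (rule sym)
  qed
  \<comment> \<open>Solving \<open>e \<nu>\<close> for its leading monomial leaves monomials of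
    smaller rank measure.\<close>
  have mono: "single \<nu> 1 \<in> W" if "\<nu> \<in> comps n d" for \<nu>
    using that
  proof (induction "rank_measure n \<nu>" arbitrary: \<nu> rule: less_induct)
    case less
    hence comp: "composition n \<nu>" by (simp add: comps_def)
    let ?l = "lookup (e \<nu>)"
    have nz: "?l \<nu> \<noteq> 0" using tri comp by (simp add: triangular_def)
    have m1: "Const (- 1) * g = - g" for g by (simp add: single_uminus)
    have "\<nu> \<in> keys (e \<nu>)" using nz by (simp add: in_keys_iff)
    hence "e \<nu> = Const (?l \<nu>) * single \<nu> 1 + (\<Sum>\<mu>\<in>keys (e \<nu>) - {\<nu>}. Const (?l \<mu>) * single \<mu> 1)"
      by (subst monomial_sum) (simp add: sum.remove)
    hence "Const (?l \<nu>) * single \<nu> 1 = e \<nu> + Const (- 1) * (\<Sum>\<mu>\<in>keys (e \<nu>) - {\<nu>}. Const (?l \<mu>) * single \<mu> 1)"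
      unfolding m1 add_uminus_conv_diff eq_diff_eq by (rule sym)
    hence eq: "single \<nu> 1 = Const (inverse (?l \<nu>)) * (e \<nu> + Const (- 1) * (\<Sum>\<mu>\<in>keys (e \<nu>) - {\<nu>}. Const (?l \<mu>) * single \<mu> 1))"
      using nz by (simp add: Const_mult_eq_iff)
    have "single \<mu> 1 \<in> W" if \<mu>: "\<mu> \<in> keys (e \<nu>) - {\<nu>}" for \<mu>
    proof -
      have "rank_le n \<mu> \<nu>" using tri comp \<mu> by (auto simp: triangular_def in_keys_iff)
      thus ?thesis using less \<mu> rank_measure_less [of n \<mu> \<nu>] by (auto simp: rank_le_def comps_def)
    qed
    hence "Const (inverse (?l \<nu>)) * (e \<nu> + Const (- 1) * (\<Sum>\<mu>\<in>keys (e \<nu>) - {\<nu>}. Const (?l \<mu>) * single \<mu> 1)) \<in> W"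
      by (intro mult add e sum less.prems)
    thus ?case using eq by metis
  qed
  have "(\<Sum>\<mu>\<in>keys f. Const (lookup f \<mu>) * single \<mu> 1) \<in> W"
    using f by (intro sum mult mono) (auto simp: homogeneous_def in_keys_iff)
  thus ?thesis unfolding monomial_sum [symmetric] W_def by blast
qed

lemma triangular_independent:
  assumes tri: "triangular n e" and zero: "(\<Sum>\<nu>\<in>comps n d. Const (c \<nu>) * e \<nu>) = 0"
    and \<nu>: "\<nu> \<in> comps n d"
  shows "c \<nu> = 0"
proof (rule ccontr)
  assume "c \<nu> \<noteq> 0"
  let ?S = "{\<nu> \<in> comps n d. c \<nu> \<noteq> 0}"
  have "?S \<noteq> {}" "finite ?S" using \<nu> \<open>c \<nu> \<noteq> 0\<close> by auto
  \<comment> \<open>A composition of maximal measure among those with nonzero coefficient: its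
    monomial occurs in no other summand.\<close>
  define M where "M = Max (rank_measure n ` ?S)"
  have "M \<in> rank_measure n ` ?S" unfolding M_def using \<open>?S \<noteq> {}\<close> by (intro Max_in) auto
  then obtain \<mu> where \<mu>: "\<mu> \<in> ?S" "rank_measure n \<mu> = M" by auto
  have no: "c \<kappa> * lookup (e \<kappa>) \<mu> = 0" if \<kappa>: "\<kappa> \<in> comps n d - {\<mu>}" for \<kappa>
  proof (rule ccontr)
    assume nz: "c \<kappa> * lookup (e \<kappa>) \<mu> \<noteq> 0"
    hence "rank_le n \<mu> \<kappa>" using tri \<kappa> by (auto simp: triangular_def comps_def)
    hence "rank_measure n \<mu> < rank_measure n \<kappa>" using \<kappa> by (intro rank_measure_less) auto
    moreover have "rank_measure n \<kappa> \<le> M"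
      unfolding M_def using \<kappa> nz by (intro Max_ge) auto
    ultimately show False using \<mu> by simp
  qed
  have "0 = lookup (\<Sum>\<nu>\<in>comps n d. Const (c \<nu>) * e \<nu>) \<mu>" unfolding zero by simp
  also have "\<dots> = (\<Sum>\<nu>\<in>comps n d. c \<nu> * lookup (e \<nu>) \<mu>)"
    by (simp add: lookup_sum lookup_Const_mult)
  also have "\<dots> = c \<mu> * lookup (e \<mu>) \<mu>"
  proof -
    have "(\<Sum>\<nu>\<in>comps n d - {\<mu>}. c \<nu> * lookup (e \<nu>) \<mu>) = 0"
      by (intro sum.neutral ballI no)
    thus ?thesis using \<mu> sum.remove [of "comps n d" \<mu> "\<lambda>\<nu>. c \<nu> * lookup (e \<nu>) \<mu>"] by simp
  qed
  finally show False using \<mu> tri by (auto simp: triangular_def comps_def)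
qed

lemma triangular_unique:
  assumes "triangular n e" "(\<Sum>\<nu>\<in>comps n d. Const (a \<nu>) * e \<nu>) = (\<Sum>\<nu>\<in>comps n d. Const (b \<nu>) * e \<nu>)"
    "\<nu> \<in> comps n d"
  shows "a \<nu> = b \<nu>"
proof -
  have "(\<Sum>\<nu>\<in>comps n d. Const (a \<nu> - b \<nu>) * e \<nu>) = 0"
    using assms(2) by (simp only: Const_diff left_diff_distrib sum_subtractf) simp
  from triangular_independent [OF assms(1) this assms(3)] show ?thesis by simp
qed


section \<open>Existence and uniqueness of the nonsymmetric Macdonald polynomials\<close>

definition eigen :: "nat \<Rightarrow> (nat \<Rightarrow> qt_field) \<Rightarrow> mpoly \<Rightarrow> bool" where
  "eigen n x f \<longleftrightarrow> (\<forall>i\<in>{1..n}. cherednik_Y n i f = Const (x i) * f)"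

text \<open>The rank order replaces \<open>comp_prec\<close>, because triangularity in this order
  survives raising and the Hecke operators.\<close>

definition rank_macdonald :: "nat \<Rightarrow> expo \<Rightarrow> mpoly \<Rightarrow> bool" where
  "rank_macdonald n \<eta> P \<longleftrightarrow> eigen n (spectral n \<eta>) P \<and> lookup P \<eta> = 1 \<and>
     (\<forall>\<mu>. lookup P \<mu> \<noteq> 0 \<longrightarrow> rank_le n \<mu> \<eta>)"

lemma rank_macdonald_imp:
  assumes "rank_macdonald n \<eta> P"
  shows "is_macdonald n \<eta> P"
  using assms rank_le_comp_prec unfolding rank_macdonald_def is_macdonald_def eigen_def by blast

context
  fixes n :: nat
  assumes n: "1 \<le> n"
begin

lemma eigen_Const:
  assumes "eigen n x f"
  shows "eigen n x (Const c * f)"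
  using assms by (simp add: eigen_def linear_op_Const [OF linear_Y [OF n]] mult.left_commute)

text \<open>Every T_j acts on constants as t, so Y_i 1 = t^(i-n) t^(n-i) t^(1-i), and in the zero
  composition exactly the i - 1 earlier places count for i.\<close>

lemma Y_1:
  assumes i: "i \<in> {1..n}"
  shows "cherednik_Y n i 1 = Const (spectral n 0 i)"
proof -
  have inv: "hecke_inv j 1 = Const (inverse tt)" for j
    by (simp add: hecke_inv_def hecke_T_1)
  have dn: "hecke_dn k 1 = Const (inverse tt ^ (k - 1))" if "1 \<le> k" for k
    using that
  proof (induction k rule: nat_induct_at_least)
    case (Suc k)
    have "hecke_dn (Suc k) 1 = hecke_dn k (Const (inverse tt) * 1)"
      using Suc by (simp add: hecke_dn_Suc inv)
    also have "\<dots> = Const (inverse tt) * Const (inverse tt ^ (k - 1))"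
      by (simp only: linear_op_Const [OF linear_hecke_dn] Suc.IH)
    also have "\<dots> = Const (inverse tt ^ Suc (k - 1))" by (simp only: Const_mult power_Suc)
    finally show ?case using Suc by simp
  qed simp
  have up: "hecke_up k n 1 = Const (tt ^ (n - k))" if "k \<le> n" for k
    using that
  proof (induction "n - k" arbitrary: k)
    case (Suc d)
    moreover from Suc have d: "d = n - Suc k" by simp
    ultimately have "hecke_up k n 1 = hecke_T k (Const (tt ^ d) * 1)" by (simp add: hecke_up_step)
    also have "\<dots> = Const (tt ^ d) * Const tt" by (simp only: hecke_T_Const hecke_T_1)
    also have "\<dots> = Const (tt ^ Suc d)" by (simp only: Const_mult power_Suc mult.commute)
    finally show ?case using Suc by simp
  qed simp
  have "hecke_up i n (Const c * 1) = Const c * Const (tt ^ (n - i))" for c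
    unfolding linear_op_Const [OF linear_hecke_up] using i by (simp add: up)
  hence "cherednik_Y n i 1 = Const (tt powi (int i - int n)) * (Const (inverse tt ^ (i - 1)) * Const (tt ^ (n - i)))"
    using i by (simp add: cherednik_Y_eq [OF n] dn omega_Const [OF n])
  also have "\<dots> = Const (tt powi (int i - int n) * (inverse tt ^ (i - 1) * tt ^ (n - i)))"
    by (simp only: Const_mult)
  also have "tt powi (int i - int n) = inverse (tt ^ (n - i))"
    using i by (simp add: power_int_def nat_diff_distrib power_inverse)
  also have "inverse (tt ^ (n - i)) * (inverse tt ^ (i - 1) * tt ^ (n - i)) = inverse tt ^ (i - 1)"
    by simp
  also have "\<dots> = spectral n 0 i"
  proof -
    have "{j\<in>{1..n}. j < i \<and> lookup (0 :: expo) j \<ge> lookup 0 i \<or> j > i \<and> lookup (0 :: expo) j > lookup 0 i} = {1..<i}"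
      using i by auto
    hence "leg' n 0 i = i - 1" by (simp only: leg'_altdef card_atLeastLessThan)
    thus ?thesis by (simp add: spectral_altdef power_inverse divide_inverse)
  qed
  finally show ?thesis .
qed

lemma rank_macdonald_0: "rank_macdonald n 0 1"
  unfolding rank_macdonald_def eigen_def
proof (intro conjI ballI allI impI)
  fix \<mu> :: expo assume "lookup (1 :: mpoly) \<mu> \<noteq> 0"
  hence "\<mu> = 0" by (auto simp: lookup_one when_def split: if_splits)
  thus "rank_le n \<mu> 0" by (simp add: rank_le_refl composition_def)
qed (simp_all add: Y_1)

text \<open>The constant is forced: it makes the components along f agree in the relations of Y_i
  and Y_(i+1) with T_i. The result is the usual intertwiner that exchanges two eigenvalues.\<close>

lemma eigen_hecke:
  assumes i: "1 \<le> i" "i < n" and f: "eigen n x f" and neq: "x i \<noteq> x (Suc i)"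
  shows "eigen n (x \<circ> transpose i (Suc i)) (hecke_T i f + Const ((tt - 1) * x i / (x (Suc i) - x i)) * f)"
  unfolding eigen_def
proof
  fix k assume k: "k \<in> {1..n}"
  define c where "c = (tt - 1) * x i / (x (Suc i) - x i)"
  have c: "(tt - 1) * x i + c * x i = c * x (Suc i)"
    using neq by (simp add: c_def field_simps)
  note lin = linear_op_add [OF linear_Y [OF n]] linear_op_Const [OF linear_Y [OF n]]
  have Y: "cherednik_Y n j f = Const (x j) * f" if "j \<in> {1..n}" for j
    using f that by (simp add: eigen_def)
  have eq: "cherednik_Y n k (hecke_T i f + Const c * f) = Const (x (transpose i (Suc i) k)) * (hecke_T i f + Const c * f)"
  proof -
    consider "k = i" | "k = Suc i" | "Suc i < k" | "k < i" by linarith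
    thus ?thesis
    proof cases
      case 1
      have "cherednik_Y n i (hecke_T i f + Const c * f)
          = Const (x (Suc i)) * hecke_T i f + Const (tt - 1) * (Const (x i) * f) + Const c * (Const (x i) * f)"
        using i by (simp add: lin Y_hecke [OF n] Y hecke_T_Const Const_diff)
      also have "\<dots> = Const (x (Suc i)) * hecke_T i f + Const ((tt - 1) * x i + c * x i) * f"
        by (simp only: Const_add Const_mult) (simp only: algebra_simps)
      also have "\<dots> = Const (x (Suc i)) * (hecke_T i f + Const c * f)"
        unfolding c by (simp only: Const_mult) (simp only: algebra_simps)
      finally show ?thesis using 1 by simp
    next
      case 2
      have "cherednik_Y n (Suc i) (hecke_T i f + Const c * f)
          = Const (x i) * hecke_T i f - Const (tt - 1) * (Const (x i) * f) + Const c * (Const (x (Suc i)) * f)"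
        using i by (simp add: lin Y_Suc_hecke [OF n] Y hecke_T_Const Const_diff)
      also have "\<dots> = Const (x i) * hecke_T i f + (Const (c * x (Suc i)) - Const ((tt - 1) * x i)) * f"
        by (simp only: Const_mult) (simp only: algebra_simps)
      also have "Const (c * x (Suc i)) - Const ((tt - 1) * x i) = Const (c * x i)"
        unfolding c [symmetric] Const_add by simp
      also have "Const (x i) * hecke_T i f + Const (c * x i) * f = Const (x i) * (hecke_T i f + Const c * f)"
        by (simp only: Const_mult) (simp only: algebra_simps)
      finally show ?thesis using 2 by simp
    next
      case 3
      hence "cherednik_Y n k (hecke_T i f) = hecke_T i (cherednik_Y n k f)"
        using i k by (intro Y_hecke_low [OF n]) auto
      thus ?thesis using 3 k by (simp add: lin Y hecke_T_Const transpose_def distrib_left mult.left_commute)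
    next
      case 4
      hence "cherednik_Y n k (hecke_T i f) = hecke_T i (cherednik_Y n k f)"
        using i k by (intro Y_hecke_high [OF n]) auto
      thus ?thesis using 4 k by (simp add: lin Y hecke_T_Const transpose_def distrib_left mult.left_commute)
    qed
  qed
  show "cherednik_Y n k (hecke_T i f + Const ((tt - 1) * x i / (x (Suc i) - x i)) * f)
     = Const ((x \<circ> transpose i (Suc i)) k) * (hecke_T i f + Const ((tt - 1) * x i / (x (Suc i) - x i)) * f)"
    using eq unfolding c_def by simp
qed

lemma eigen_raise:
  assumes "eigen n (spectral n \<eta>) f"
  shows "eigen n (spectral n (comp_shift n \<eta>)) (raise_op n f)"
  unfolding eigen_def
proof
  fix i assume i: "i \<in> {1..n}"
  show "cherednik_Y n i (raise_op n f) = Const (spectral n (comp_shift n \<eta>) i) * raise_op n f"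
  proof (cases "i = n")
    case True
    have "cherednik_Y n 1 f = Const (spectral n \<eta> 1) * f" using assms n by (simp add: eigen_def)
    thus ?thesis
      by (simp add: True Y_n_raise [OF n] spectral_shift [OF n] linear_op_Const [OF linear_raise [OF n]]
          Const_mult mult.assoc)
  next
    case False
    hence "cherednik_Y n (Suc i) f = Const (spectral n \<eta> (Suc i)) * f" using assms i by (simp add: eigen_def)
    thus ?thesis
      using False i by (simp add: Y_raise [OF n] spectral_shift [OF n] linear_op_Const [OF linear_raise [OF n]])
  qed
qed

lemma lookup_raise_shift: "lookup (raise_op n f) (comp_shift n \<eta>) = qq ^ lookup \<eta> 1 * lookup f \<eta>"
proof -
  have "lookup (raise_op n f) (comp_shift n \<eta>)
     = (\<Sum>\<mu>\<in>keys f. if \<mu> = \<eta> then qq ^ lookup \<eta> 1 * lookup f \<eta> else 0)"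
    unfolding linear_op_lookup [OF linear_raise [OF n], of f] raise_monomial [OF n] lookup_Const_mult
    using comp_shift_inj [OF n] by (intro sum.cong) (auto simp: lookup_single when_def)
  thus ?thesis by (simp add: in_keys_iff)
qed

lemma support_raise:
  assumes "lookup (raise_op n f) \<nu> \<noteq> 0"
  obtains \<mu> where "\<nu> = comp_shift n \<mu>" "lookup f \<mu> \<noteq> 0"
proof -
  from linear_raise [OF n] assms obtain \<mu> where \<mu>: "lookup f \<mu> \<noteq> 0" "lookup (raise_op n (single \<mu> 1)) \<nu> \<noteq> 0"
    by (rule linear_op_support)
  from \<mu>(2) have "\<nu> = comp_shift n \<mu>"
    unfolding raise_monomial [OF n] lookup_Const_mult by (auto simp: lookup_single when_def split: if_splits)
  with \<mu> that show ?thesis by blast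
qed

lemma rank_macdonald_shift:
  assumes "rank_macdonald n \<eta> P"
  shows "rank_macdonald n (comp_shift n \<eta>) (Const (inverse (qq ^ lookup \<eta> 1)) * raise_op n P)"
  unfolding rank_macdonald_def
proof (intro conjI allI impI)
  show "eigen n (spectral n (comp_shift n \<eta>)) (Const (inverse (qq ^ lookup \<eta> 1)) * raise_op n P)"
    using assms by (intro eigen_Const eigen_raise) (simp add: rank_macdonald_def)
  show "lookup (Const (inverse (qq ^ lookup \<eta> 1)) * raise_op n P) (comp_shift n \<eta>) = 1"
    using assms by (simp add: lookup_Const_mult lookup_raise_shift rank_macdonald_def)
next
  fix \<nu> assume "lookup (Const (inverse (qq ^ lookup \<eta> 1)) * raise_op n P) \<nu> \<noteq> 0"
  hence "lookup (raise_op n P) \<nu> \<noteq> 0" by (simp add: lookup_Const_mult)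
  then obtain \<mu> where "\<nu> = comp_shift n \<mu>" "lookup P \<mu> \<noteq> 0" by (rule support_raise)
  thus "rank_le n \<nu> (comp_shift n \<eta>)"
    using assms by (auto simp: rank_macdonald_def intro: rank_le_shift n)
qed

lemma lookup_hecke_T_swap:
  assumes i: "1 \<le> i" "i < n" and less: "lookup \<eta> i < lookup \<eta> (Suc i)"
    and P: "\<And>\<mu>. lookup P \<mu> \<noteq> 0 \<Longrightarrow> rank_le n \<mu> \<eta>"
  shows "lookup (hecke_T i P) (comp_swap i \<eta>) = tt * lookup P \<eta>"
proof -
  have "lookup P \<mu> * lookup (hecke_T i (single \<mu> 1)) (comp_swap i \<eta>) = (if \<mu> = \<eta> then tt * lookup P \<eta> else 0)"
    if \<mu>: "\<mu> \<in> keys P" for \<mu>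
  proof (cases "\<mu> = \<eta>")
    case True
    thus ?thesis using hecke_T_monomial_top [OF less] by simp
  next
    case False
    have "lookup (hecke_T i (single \<mu> 1)) (comp_swap i \<eta>) = 0"
    proof (rule ccontr)
      assume "lookup (hecke_T i (single \<mu> 1)) (comp_swap i \<eta>) \<noteq> 0"
      hence "in_string i \<mu> (comp_swap i \<eta>)" by (rule support_hecke_T_monomial)
      thus False using in_string_top [OF i P less] \<mu> False by (auto simp: in_keys_iff)
    qed
    thus ?thesis using False by simp
  qed
  hence "lookup (hecke_T i P) (comp_swap i \<eta>) = (\<Sum>\<mu>\<in>keys P. if \<mu> = \<eta> then tt * lookup P \<eta> else 0)"
    unfolding linear_op_lookup [OF linear_hecke_T, of i P] by (intro sum.cong refl)
  thus ?thesis by (simp add: in_keys_iff)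
qed

lemma not_rank_le_swap:
  assumes i: "1 \<le> i" "i < n" and \<eta>: "composition n \<eta>" and less: "lookup \<eta> i < lookup \<eta> (Suc i)"
  shows "\<not> rank_le n (comp_swap i \<eta>) \<eta>"
  using rank_le_antisym rank_le_swap [OF i \<eta> less] less comp_swap_eq_iff [of i \<eta>] by fastforce

lemma spectral_adjacent_neq:
  assumes "1 \<le> i" "i < n"
  shows "spectral n \<eta> i \<noteq> spectral n \<eta> (Suc i)"
  using spectral_inj [of i n "Suc i" \<eta>] assms by auto

lemma spectral_swap_fun:
  assumes "1 \<le> i" "i < n" "lookup \<eta> i \<noteq> lookup \<eta> (Suc i)"
  shows "spectral n \<eta> \<circ> transpose i (Suc i) = spectral n (comp_swap i \<eta>)"
  using spectral_swap [OF assms] by (simp add: fun_eq_iff)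

lemma rank_macdonald_swap:
  assumes P: "rank_macdonald n \<eta> P" and i: "1 \<le> i" "i < n" and \<eta>: "composition n \<eta>"
    and less: "lookup \<eta> i < lookup \<eta> (Suc i)"
  shows "\<exists>Q. rank_macdonald n (comp_swap i \<eta>) Q"
proof
  let ?c = "(tt - 1) * spectral n \<eta> i / (spectral n \<eta> (Suc i) - spectral n \<eta> i)"
  let ?G = "hecke_T i P + Const ?c * P"
  have supp: "\<And>\<mu>. lookup P \<mu> \<noteq> 0 \<Longrightarrow> rank_le n \<mu> \<eta>" using P by (simp add: rank_macdonald_def)
  have top: "lookup P (comp_swap i \<eta>) = 0" using supp not_rank_le_swap [OF i \<eta> less] by blast
  show "rank_macdonald n (comp_swap i \<eta>) (Const (inverse tt) * ?G)"
    unfolding rank_macdonald_def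
  proof (intro conjI allI impI)
    have "eigen n (spectral n \<eta> \<circ> transpose i (Suc i)) ?G"
      using P by (intro eigen_hecke i spectral_adjacent_neq) (simp add: rank_macdonald_def)
    thus "eigen n (spectral n (comp_swap i \<eta>)) (Const (inverse tt) * ?G)"
      using i less by (intro eigen_Const) (simp add: spectral_swap_fun)
    show "lookup (Const (inverse tt) * ?G) (comp_swap i \<eta>) = 1"
      using P by (simp add: lookup_Const_mult lookup_add top lookup_hecke_T_swap [OF i less supp] rank_macdonald_def)
  next
    fix \<mu>' assume "lookup (Const (inverse tt) * ?G) \<mu>' \<noteq> 0"
    hence "lookup (hecke_T i P) \<mu>' \<noteq> 0 \<or> lookup P \<mu>' \<noteq> 0"
      by (auto simp: lookup_Const_mult lookup_add)
    thus "rank_le n \<mu>' (comp_swap i \<eta>)"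
    proof
      assume "lookup (hecke_T i P) \<mu>' \<noteq> 0"
      with linear_hecke_T obtain \<mu> where "lookup P \<mu> \<noteq> 0" "lookup (hecke_T i (single \<mu> 1)) \<mu>' \<noteq> 0"
        by (rule linear_op_support)
      thus ?thesis using rank_le_in_string [OF i supp less support_hecke_T_monomial] by blast
    next
      assume "lookup P \<mu>' \<noteq> 0"
      thus ?thesis using rank_le_trans [OF supp rank_le_swap [OF i \<eta> less]] by blast
    qed
  qed
qed

lemma rank_macdonald_exists:
  assumes "composition n \<eta>"
  shows "\<exists>P. rank_macdonald n \<eta> P"
  using n assms
proof (induction rule: composition_induct)
  case zero
  show ?case using rank_macdonald_0 by blast
next
  case (shift \<eta>)
  thus ?case using rank_macdonald_shift by blast
next
  case (swap \<eta> i)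
  thus ?case using rank_macdonald_swap by blast
qed

text \<open>Applying Y_i termwise and comparing coefficients shows that a basis element occurs only
  if its spectrum is that of f.\<close>

lemma eigen_expansion:
  assumes tri: "triangular n e" and e: "\<And>\<nu>. composition n \<nu> \<Longrightarrow> eigen n (spectral n \<nu>) (e \<nu>)"
    and f: "homogeneous n d f" "eigen n x f"
  obtains c where "f = (\<Sum>\<nu>\<in>comps n d. Const (c \<nu>) * e \<nu>)"
    "\<And>\<nu> i. \<nu> \<in> comps n d \<Longrightarrow> c \<nu> \<noteq> 0 \<Longrightarrow> i \<in> {1..n} \<Longrightarrow> spectral n \<nu> i = x i"
proof -
  obtain c where c: "f = (\<Sum>\<nu>\<in>comps n d. Const (c \<nu>) * e \<nu>)"
    using triangular_spans [OF tri f(1)] by blast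
  have "spectral n \<nu> i = x i" if \<nu>: "\<nu> \<in> comps n d" "c \<nu> \<noteq> 0" and i: "i \<in> {1..n}" for \<nu> i
  proof -
    have "(\<Sum>\<nu>\<in>comps n d. Const (c \<nu> * spectral n \<nu> i) * e \<nu>) = (\<Sum>\<nu>\<in>comps n d. Const (c \<nu>) * cherednik_Y n i (e \<nu>))"
      using e i by (intro sum.cong) (auto simp: eigen_def comps_def Const_mult mult.assoc)
    also have "\<dots> = cherednik_Y n i f"
      unfolding c linear_op_sum [OF linear_Y [OF n]] linear_op_Const [OF linear_Y [OF n]] ..
    also have "\<dots> = Const (x i) * f" using f(2) i by (simp add: eigen_def)
    also have "\<dots> = (\<Sum>\<nu>\<in>comps n d. Const (c \<nu> * x i) * e \<nu>)"
      unfolding c sum_distrib_left by (intro sum.cong) (simp_all add: Const_mult ac_simps)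
    finally have "c \<nu> * spectral n \<nu> i = c \<nu> * x i" using \<nu>(1) by (rule triangular_unique [OF tri])
    thus ?thesis using \<nu>(2) by simp
  qed
  with c that show ?thesis by blast
qed

lemma spectral_determines:
  assumes "composition n \<eta>" "composition n \<nu>" "\<And>i. i \<in> {1..n} \<Longrightarrow> spectral n \<nu> i = spectral n \<eta> i"
  shows "\<nu> = \<eta>"
  using assms by (intro composition_eqI) (auto simp: spectral_eq_iff)

lemma eigen_multiple:
  assumes tri: "triangular n e" and e: "\<And>\<nu>. composition n \<nu> \<Longrightarrow> eigen n (spectral n \<nu>) (e \<nu>)"
    and f: "homogeneous n d f" "eigen n (spectral n \<eta>) f" and \<eta>: "\<eta> \<in> comps n d" "lookup (e \<eta>) \<eta> = 1"
  shows "f = Const (lookup f \<eta>) * e \<eta>"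
proof -
  obtain c where c: "f = (\<Sum>\<nu>\<in>comps n d. Const (c \<nu>) * e \<nu>)"
    "\<And>\<nu> i. \<nu> \<in> comps n d \<Longrightarrow> c \<nu> \<noteq> 0 \<Longrightarrow> i \<in> {1..n} \<Longrightarrow> spectral n \<nu> i = spectral n \<eta> i"
    using eigen_expansion [OF tri e f] by blast
  have "c \<nu> = 0" if "\<nu> \<in> comps n d - {\<eta>}" for \<nu>
    using c(2) [of \<nu>] spectral_determines [of \<eta> \<nu>] that \<eta> by (auto simp: comps_def)
  hence "(\<Sum>\<nu>\<in>comps n d - {\<eta>}. Const (c \<nu>) * e \<nu>) = 0" by (intro sum.neutral) auto
  hence f: "f = Const (c \<eta>) * e \<eta>"
    using \<eta> sum.remove [of "comps n d" \<eta> "\<lambda>\<nu>. Const (c \<nu>) * e \<nu>"] c(1) by simp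
  have "lookup f \<eta> = c \<eta>" using \<eta> by (subst f) (simp add: lookup_Const_mult)
  thus ?thesis using f by simp
qed

lemma rank_macdonald_E:
  assumes \<eta>: "composition n \<eta>"
  shows "rank_macdonald n \<eta> (macdonald_E n \<eta>)"
proof -
  define e where "e \<nu> = (SOME P. rank_macdonald n \<nu> P)" for \<nu>
  have e: "rank_macdonald n \<nu> (e \<nu>)" if "composition n \<nu>" for \<nu>
    unfolding e_def using rank_macdonald_exists [OF that] by (rule someI_ex)
  have tri: "triangular n e" using e by (simp add: triangular_def rank_macdonald_def)
  have eig: "eigen n (spectral n \<nu>) (e \<nu>)" if "composition n \<nu>" for \<nu>
    using e [OF that] by (simp add: rank_macdonald_def)
  \<comment> \<open>Dominance triangularity makes P homogeneous. A homogeneous joint eigenvector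
    with this spectrum is a multiple of \<open>e \<eta>\<close>, and the coefficient 1 at \<eta>
    fixes the multiple; so both orders select the same polynomial.\<close>
  have "P = e \<eta>" if P: "is_macdonald n \<eta> P" for P
  proof -
    have "homogeneous n (csize n \<eta>) P"
      unfolding homogeneous_def using P \<eta> by (auto simp: is_macdonald_def comp_prec_def comps_def)
    moreover have "eigen n (spectral n \<eta>) P" using P by (simp add: is_macdonald_def eigen_def)
    ultimately have "P = Const (lookup P \<eta>) * e \<eta>"
      using \<eta> e [OF \<eta>] by (intro eigen_multiple [OF tri eig]) (auto simp: comps_def rank_macdonald_def)
    thus ?thesis using P by (simp add: is_macdonald_def)
  qed
  hence "macdonald_E n \<eta> = e \<eta>"
    unfolding macdonald_E_def using rank_macdonald_imp [OF e [OF \<eta>]] by (intro the_equality)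
  thus ?thesis using e [OF \<eta>] by simp
qed

abbreviation E :: "expo \<Rightarrow> mpoly" where
  "E \<equiv> macdonald_E n"

lemma E_top: "composition n \<eta> \<Longrightarrow> lookup (E \<eta>) \<eta> = 1"
  and E_support: "composition n \<eta> \<Longrightarrow> lookup (E \<eta>) \<mu> \<noteq> 0 \<Longrightarrow> rank_le n \<mu> \<eta>"
  and E_eigen: "composition n \<eta> \<Longrightarrow> eigen n (spectral n \<eta>) (E \<eta>)"
  using rank_macdonald_E [of \<eta>] unfolding rank_macdonald_def by blast+

lemma triangular_E: "triangular n E"
  by (simp add: triangular_def E_top E_support)

lemma homogeneous_E: "composition n \<eta> \<Longrightarrow> homogeneous n (csize n \<eta>) (E \<eta>)"
  using triangular_homogeneous [OF triangular_E] by (simp add: comps_def)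

lemma E_unique:
  assumes "composition n \<eta>" "homogeneous n (csize n \<eta>) f" "eigen n (spectral n \<eta>) f"
  shows "f = Const (lookup f \<eta>) * E \<eta>"
  using assms by (intro eigen_multiple [OF triangular_E]) (auto simp: E_eigen E_top comps_def)

text \<open>The intertwiner sends E_\<eta> to a joint eigenvector with the exchanged spectrum, hence
  to a multiple of E at the exchanged composition; the factor t is its leading coefficient.\<close>

lemma hecke_E_less:
  assumes i: "1 \<le> i" "i < n" and \<eta>: "composition n \<eta>" and less: "lookup \<eta> i < lookup \<eta> (Suc i)"
  shows "hecke_T i (E \<eta>) = Const ((tt - 1) * spectral n \<eta> i / (spectral n \<eta> i - spectral n \<eta> (Suc i))) * E \<eta>
     + Const tt * E (comp_swap i \<eta>)"
proof -
  let ?x = "spectral n \<eta> i" and ?y = "spectral n \<eta> (Suc i)"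
  let ?c = "(tt - 1) * ?x / (?y - ?x)"
  let ?G = "hecke_T i (E \<eta>) + Const ?c * E \<eta>"
  have "eigen n (spectral n \<eta> \<circ> transpose i (Suc i)) ?G"
    by (intro eigen_hecke i spectral_adjacent_neq E_eigen \<eta>)
  moreover have "homogeneous n (csize n (comp_swap i \<eta>)) ?G"
    unfolding csize_swap [OF i] using i \<eta>
    by (intro homogeneous_add homogeneous_Const homogeneous_hecke_T homogeneous_E)
  ultimately have G: "?G = Const (lookup ?G (comp_swap i \<eta>)) * E (comp_swap i \<eta>)"
    using i \<eta> less by (intro E_unique) (auto simp: spectral_swap_fun composition_swap)
  have "lookup (E \<eta>) (comp_swap i \<eta>) = 0"
    using E_support [OF \<eta>] not_rank_le_swap [OF i \<eta> less] by blast
  hence "lookup ?G (comp_swap i \<eta>) = tt"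
    by (simp add: lookup_add lookup_Const_mult lookup_hecke_T_swap [OF i less E_support] \<eta> E_top)
  with G have "hecke_T i (E \<eta>) = Const (- ?c) * E \<eta> + Const tt * E (comp_swap i \<eta>)"
    by (simp add: single_uminus eq_diff_eq)
  also have "- ?c = (tt - 1) * ?x / (?x - ?y)"
    by (metis minus_diff_eq minus_divide_right)
  finally show ?thesis .
qed

text \<open>The intertwiner would produce an eigenvector whose spectrum exchanges the values of two
  equal parts, and no composition has that spectrum. So it gives 0, and x_i = t x_(i+1) evaluates
  the constant to -t.\<close>

lemma hecke_E_equal:
  assumes i: "1 \<le> i" "i < n" and \<eta>: "composition n \<eta>" and eq: "lookup \<eta> i = lookup \<eta> (Suc i)"
  shows "hecke_T i (E \<eta>) = Const tt * E \<eta>"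
proof -
  let ?x = "spectral n \<eta> i" and ?y = "spectral n \<eta> (Suc i)"
  let ?c = "(tt - 1) * ?x / (?y - ?x)"
  let ?G = "hecke_T i (E \<eta>) + Const ?c * E \<eta>"
  have "eigen n (spectral n \<eta> \<circ> transpose i (Suc i)) ?G"
    by (intro eigen_hecke i spectral_adjacent_neq E_eigen \<eta>)
  moreover have "homogeneous n (csize n \<eta>) ?G"
    using i \<eta> by (intro homogeneous_add homogeneous_Const homogeneous_hecke_T homogeneous_E)
  ultimately obtain c where c: "?G = (\<Sum>\<nu>\<in>comps n (csize n \<eta>). Const (c \<nu>) * E \<nu>)"
    "\<And>\<nu> k. \<nu> \<in> comps n (csize n \<eta>) \<Longrightarrow> c \<nu> \<noteq> 0 \<Longrightarrow> k \<in> {1..n}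
       \<Longrightarrow> spectral n \<nu> k = (spectral n \<eta> \<circ> transpose i (Suc i)) k"
    using eigen_expansion [OF triangular_E E_eigen] by blast
  have "c \<nu> = 0" if \<nu>: "\<nu> \<in> comps n (csize n \<eta>)" for \<nu>
  proof (rule ccontr)
    assume nz: "c \<nu> \<noteq> 0"
    have "lookup \<nu> k = lookup \<eta> k" if "k \<in> {1..n}" for k
      using c(2) [OF \<nu> nz that] eq by (auto simp: spectral_eq_iff transpose_def split: if_splits)
    hence "\<nu> = \<eta>" using \<nu> \<eta> by (intro composition_eqI) (auto simp: comps_def)
    thus False using c(2) [OF \<nu> nz, of i] spectral_adjacent_neq [OF i, of \<eta>] i by simp
  qed
  hence "?G = 0" unfolding c(1) by simp
  hence "hecke_T i (E \<eta>) = Const (- ?c) * E \<eta>"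
    by (simp add: single_uminus eq_neg_iff_add_eq_0)
  also have "- ?c = tt"
  proof -
    have "?x = tt * ?y" using i eq by (intro spectral_adjacent) auto
    moreover have "?y - tt * ?y \<noteq> 0" using spectral_adjacent_neq [OF i, of \<eta>] calculation by simp
    ultimately show ?thesis by (simp add: field_simps)
  qed
  finally show ?thesis .
qed

lemma raise_E:
  assumes \<eta>: "composition n \<eta>"
  shows "raise_op n (E \<eta>) = Const (qq ^ lookup \<eta> 1) * E (comp_shift n \<eta>)"
proof -
  have "raise_op n (E \<eta>) = Const (lookup (raise_op n (E \<eta>)) (comp_shift n \<eta>)) * E (comp_shift n \<eta>)"
    using n \<eta> homogeneous_raise [OF n homogeneous_E [OF \<eta>]]
    by (intro E_unique eigen_raise E_eigen composition_shift) (auto simp: csize_shift)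
  thus ?thesis using \<eta> by (simp add: lookup_raise_shift E_top)
qed

end


section \<open>Normalisation\<close>

lemma leg_sum:
  "leg n \<eta> i j = (\<Sum>k=1..n. if k > i \<and> j \<le> lookup \<eta> k \<and> lookup \<eta> k \<le> lookup \<eta> i
     \<or> k < i \<and> j \<le> lookup \<eta> k + 1 \<and> lookup \<eta> k + 1 \<le> lookup \<eta> i then 1 else 0)"
proof -
  let ?A = "{k\<in>{1..n}. k > i \<and> j \<le> lookup \<eta> k \<and> lookup \<eta> k \<le> lookup \<eta> i}"
  let ?B = "{k\<in>{1..n}. k < i \<and> j \<le> lookup \<eta> k + 1 \<and> lookup \<eta> k + 1 \<le> lookup \<eta> i}"
  have "leg n \<eta> i j = card (?A \<union> ?B)"
    unfolding leg_def by (rule card_Un_disjoint [symmetric]) auto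
  also have "?A \<union> ?B = {k\<in>{1..n}. k > i \<and> j \<le> lookup \<eta> k \<and> lookup \<eta> k \<le> lookup \<eta> i
     \<or> k < i \<and> j \<le> lookup \<eta> k + 1 \<and> lookup \<eta> k + 1 \<le> lookup \<eta> i}" by blast
  finally show ?thesis
    by (simp only: card_eq_sum sum.inter_filter [OF finite_atLeastAtMost])
qed

lemma leg'_sum:
  "leg' n \<eta> i = (\<Sum>k=1..n. if k < i \<and> lookup \<eta> k \<ge> lookup \<eta> i \<or> k > i \<and> lookup \<eta> k > lookup \<eta> i then 1 else 0)"
  unfolding leg'_altdef by (simp only: card_eq_sum sum.inter_filter [OF finite_atLeastAtMost])

lemma sum_adjacent_cong:
  fixes g h :: "nat \<Rightarrow> nat"
  assumes "1 \<le> i" "i < n" "\<And>k. k \<notin> {i, Suc i} \<Longrightarrow> g k = h k" "g i + g (Suc i) = h i + h (Suc i) + c"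
  shows "(\<Sum>k=1..n. g k) = (\<Sum>k=1..n. h k) + c"
proof -
  have "(\<Sum>k\<in>{1..n} - {i, Suc i}. g k) = (\<Sum>k\<in>{1..n} - {i, Suc i}. h k)"
    using assms(3) by (intro sum.cong) auto
  thus ?thesis unfolding sum_split_adjacent [OF assms(1,2)] using assms(4) by simp
qed

context
  fixes n i :: nat and \<eta> :: expo
  assumes i: "1 \<le> i" "i < n" and less: "lookup \<eta> i < lookup \<eta> (Suc i)"
begin

lemma leg_swap_other:
  assumes "k \<notin> {i, Suc i}"
  shows "leg n (comp_swap i \<eta>) k j = leg n \<eta> k j"
  unfolding leg_sum
  by (rule sum_adjacent_cong [OF i, where c = 0, simplified]) (use assms in auto)

lemma leg_swap_lower: "leg n (comp_swap i \<eta>) (Suc i) j = leg n \<eta> i j"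
  unfolding leg_sum
  by (rule sum_adjacent_cong [OF i, where c = 0, simplified]) (use less in auto)

text \<open>In the row of length \<eta>_(i+1), the shorter neighbour counts for j \<le> \<eta>_i + 1
  when it stands before and for j \<le> \<eta>_i when it stands after; a single column is
  affected.\<close>

lemma leg_swap_upper:
  assumes "j \<le> lookup \<eta> (Suc i)"
  shows "leg n \<eta> (Suc i) j = leg n (comp_swap i \<eta>) i j + (if j = Suc (lookup \<eta> i) then 1 else 0)"
  unfolding leg_sum by (rule sum_adjacent_cong [OF i]) (use less assms in auto)

text \<open>Relates the ratio of the two spectral values to the leg of the one cell whose factor
  changes under the exchange.\<close>

lemma leg'_adjacent_less:
  "leg' n \<eta> i = leg' n \<eta> (Suc i) + Suc (leg n (comp_swap i \<eta>) i (Suc (lookup \<eta> i)))"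
proof -
  have "leg' n \<eta> i = leg' n \<eta> (Suc i) + leg n (comp_swap i \<eta>) i (Suc (lookup \<eta> i)) + 1"
    unfolding leg_sum leg'_sum sum.distrib [symmetric]
    by (rule sum_adjacent_cong [OF i]) (use less in auto)
  thus ?thesis by simp
qed

end

definition cell_factor :: "nat \<Rightarrow> expo \<Rightarrow> nat \<Rightarrow> nat \<Rightarrow> qt_field" where
  "cell_factor n \<eta> i j = tt ^ leg n \<eta> i j - inverse qq ^ Suc (arm \<eta> i j)"

text \<open>Inverting \<open>q\<close> and \<open>t\<close> turns \<open>norm_factor n \<eta>\<close> into \<open>t\<^bsup>- l(\<eta>)\<^esup> d'\<^sub>\<eta>(q, t)\<close>.\<close>

definition norm_factor :: "nat \<Rightarrow> expo \<Rightarrow> qt_field" where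
  "norm_factor n \<eta> = (\<Prod>i=1..n. \<Prod>j=1..lookup \<eta> i. cell_factor n \<eta> i j)"

lemma qt_diff_neq_0: "tt ^ l - inverse qq ^ Suc a \<noteq> 0"
proof
  assume "tt ^ l - inverse qq ^ Suc a = 0"
  hence "tt ^ l = inverse qq ^ Suc a" by simp
  hence "qq ^ Suc a * tt ^ l = qq ^ Suc a * inverse qq ^ Suc a" by (simp only:)
  also have "\<dots> = 1" unfolding power_mult_distrib [symmetric] by simp
  finally show False using qt_monomial_eq_1_iff by blast
qed

lemma norm_factor_neq_0 [simp]: "norm_factor n \<eta> \<noteq> 0"
  using qt_diff_neq_0 by (simp add: norm_factor_def cell_factor_def del: power_Suc)

lemma prod_split_adjacent:
  fixes h :: "nat \<Rightarrow> qt_field"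
  assumes "1 \<le> i" "i < n"
  shows "(\<Prod>j=1..n. h j) = h i * h (Suc i) * (\<Prod>j\<in>{1..n} - {i, Suc i}. h j)"
  using prod.subset_diff [of "{i, Suc i}" "{1..n}" h] assms by (simp add: mult.commute)

text \<open>All cell factors cancel except those of column \<eta>_i + 1. With k the difference of
  the parts and L the new leg, these are t^(L+1) - q^(-k) before and t^L - q^(-k) after the
  exchange, and q^k t^(L+1) is the ratio y / x.\<close>

lemma norm_factor_swap:
  assumes i: "1 \<le> i" "i < n" and less: "lookup \<eta> i < lookup \<eta> (Suc i)"
  defines "x \<equiv> spectral n \<eta> i" and "y \<equiv> spectral n \<eta> (Suc i)"
  shows "norm_factor n (comp_swap i \<eta>) / norm_factor n \<eta> = (tt * x - y) / (tt * (x - y))"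
proof -
  let ?s = "comp_swap i \<eta>" and ?a = "lookup \<eta> i" and ?b = "lookup \<eta> (Suc i)"
  let ?L = "leg n ?s i (Suc ?a)" and ?k = "?b - ?a"
  define R where "R = (\<Prod>k\<in>{1..n} - {i, Suc i}. \<Prod>j=1..lookup \<eta> k. cell_factor n \<eta> k j)"
  define S where "S = (\<Prod>j=1..?a. cell_factor n \<eta> i j)"
  define U where "U = (\<Prod>j\<in>{1..?b} - {Suc ?a}. cell_factor n \<eta> (Suc i) j)"
  define u where "u = inverse qq ^ ?k"
  have k: "Suc (?b - Suc ?a) = ?k" using less by simp
  have mem: "Suc ?a \<in> {1..?b}" using less by simp
  have cell: "cell_factor n ?s i j = cell_factor n \<eta> (Suc i) j" if "j \<in> {1..?b} - {Suc ?a}" for j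
    using that leg_swap_upper [OF i less, of j] by (simp add: cell_factor_def arm_def)
  have "(\<Prod>j=1..?b. cell_factor n \<eta> (Suc i) j) = cell_factor n \<eta> (Suc i) (Suc ?a) * U"
    unfolding U_def using mem by (intro prod.remove) auto
  also have "cell_factor n \<eta> (Suc i) (Suc ?a) = tt ^ Suc ?L - u"
    using leg_swap_upper [OF i less, of "Suc ?a"] less
    by (simp add: cell_factor_def arm_def u_def k del: power_Suc flip: Suc_eq_plus1)
  finally have 1: "norm_factor n \<eta> = S * ((tt ^ Suc ?L - u) * U) * R"
    unfolding norm_factor_def prod_split_adjacent [OF i] R_def S_def by simp
  have "(\<Prod>j=1..?b. cell_factor n ?s i j) = cell_factor n ?s i (Suc ?a) * (\<Prod>j\<in>{1..?b} - {Suc ?a}. cell_factor n ?s i j)"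
    using mem by (intro prod.remove) auto
  also have "(\<Prod>j\<in>{1..?b} - {Suc ?a}. cell_factor n ?s i j) = U"
    unfolding U_def using cell by (intro prod.cong) auto
  also have "cell_factor n ?s i (Suc ?a) = tt ^ ?L - u"
    by (simp add: cell_factor_def arm_def u_def k del: power_Suc)
  finally have "(\<Prod>j=1..lookup ?s i. cell_factor n ?s i j) = (tt ^ ?L - u) * U" by simp
  moreover have "(\<Prod>j=1..lookup ?s (Suc i). cell_factor n ?s (Suc i) j) = S"
    unfolding S_def by (simp add: cell_factor_def leg_swap_lower [OF i less] arm_def)
  moreover have "(\<Prod>k\<in>{1..n} - {i, Suc i}. \<Prod>j=1..lookup ?s k. cell_factor n ?s k j) = R"
    unfolding R_def by (intro prod.cong) (auto simp: cell_factor_def leg_swap_other [OF i less] arm_def)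
  ultimately have 2: "norm_factor n ?s = ((tt ^ ?L - u) * U) * S * R"
    unfolding norm_factor_def prod_split_adjacent [OF i] by simp
  have u: "qq ^ ?k * u = 1"
    unfolding u_def power_mult_distrib [symmetric] by simp
  have nz: "tt ^ Suc ?L - u \<noteq> 0"
    unfolding u_def k [symmetric] by (rule qt_diff_neq_0)
  have y: "y = x * (qq ^ ?k * tt ^ Suc ?L)"
  proof -
    have "qq ^ ?b = qq ^ ?a * qq ^ ?k" using less by (simp flip: power_add)
    thus ?thesis
      unfolding x_def y_def spectral_altdef leg'_adjacent_less [OF i less] power_add by simp
  qed
  have x: "x \<noteq> 0" by (simp add: x_def)
  have "S * U * R \<noteq> 0" using norm_factor_neq_0 [of n \<eta>] unfolding 1 by auto
  hence "norm_factor n ?s / norm_factor n \<eta> = (tt ^ ?L - u) / (tt ^ Suc ?L - u)"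
    unfolding 1 2 using nz by (simp add: frac_eq_eq)
  also have "\<dots> = (qq ^ ?k * (tt ^ ?L - u)) / (qq ^ ?k * (tt ^ Suc ?L - u))"
    by simp
  also have "\<dots> = (qq ^ ?k * tt ^ ?L - 1) / (qq ^ ?k * tt ^ Suc ?L - 1)"
    by (simp only: right_diff_distrib u)
  also have "\<dots> = (x * (- tt) * (qq ^ ?k * tt ^ ?L - 1)) / (x * (- tt) * (qq ^ ?k * tt ^ Suc ?L - 1))"
    using x by simp
  also have "\<dots> = (tt * x - y) / (tt * (x - y))"
    unfolding y by (rule arg_cong2 [where f = "(/)"]) (simp_all add: algebra_simps)
  finally show ?thesis .
qed

lemma sum_cyc:
  fixes h :: "nat \<Rightarrow> nat"
  assumes "1 \<le> n"
  shows "(\<Sum>k=1..n. h (cyc n k)) = (\<Sum>k=1..n. h k)"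
  by (rule sum.reindex_bij_betw [OF bij_cyc [OF assms]])

lemma leg_shift:
  assumes "1 \<le> n" "k \<in> {1..n}" "k < n"
  shows "leg n (comp_shift n \<eta>) k j = leg n \<eta> (Suc k) j"
  unfolding leg_sum sum_cyc [OF assms(1), symmetric, of "\<lambda>m. if m > Suc k \<and> j \<le> lookup \<eta> m \<and> lookup \<eta> m \<le> lookup \<eta> (Suc k)
     \<or> m < Suc k \<and> j \<le> lookup \<eta> m + 1 \<and> lookup \<eta> m + 1 \<le> lookup \<eta> (Suc k) then 1 else 0"]
  unfolding lookup_comp_shift [OF assms(1)]
  by (rule sum.cong) (use assms in \<open>auto simp: cyc_def\<close>)

lemma leg_shift_n:
  assumes "1 \<le> n"
  shows "leg n (comp_shift n \<eta>) n (Suc j) = leg n \<eta> 1 j"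
  unfolding leg_sum sum_cyc [OF assms(1), symmetric, of "\<lambda>m. if m > 1 \<and> j \<le> lookup \<eta> m \<and> lookup \<eta> m \<le> lookup \<eta> 1
     \<or> m < 1 \<and> j \<le> lookup \<eta> m + 1 \<and> lookup \<eta> m + 1 \<le> lookup \<eta> 1 then 1 else 0"]
  unfolding lookup_comp_shift [OF assms(1)]
  by (rule sum.cong) (use assms in \<open>auto simp: cyc_def\<close>)

text \<open>At the fictitious column 0 the leg of the first row counts all other rows that are not
  longer, while l' counts the longer ones.\<close>

lemma leg_leg':
  assumes "1 \<le> n"
  shows "leg n \<eta> 1 0 + leg' n \<eta> 1 = n - 1"
proof -
  have "leg n \<eta> 1 0 + leg' n \<eta> 1 = (\<Sum>k=1..n. if k = 1 then 0 else 1)"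
    unfolding leg_sum leg'_sum sum.distrib [symmetric] by (rule sum.cong) auto
  also have "\<dots> = (\<Sum>k\<in>{2..n}. 1)"
    by (rule sum.mono_neutral_cong_right) auto
  finally show ?thesis by simp
qed

text \<open>The shift keeps the factors of the old cells and adds one cell at the start of the last
  row, with arm \<eta>_1 and leg n - 1 - l'(1). The power of q in front is the one that raising puts
  before E.\<close>

lemma norm_factor_shift:
  assumes n: "1 \<le> n"
  shows "qq ^ lookup \<eta> 1 * (norm_factor n (comp_shift n \<eta>) / norm_factor n \<eta>)
     = tt ^ (n - 1) * spectral n \<eta> 1 - inverse qq"
proof -
  let ?s = "comp_shift n \<eta>" and ?a = "lookup \<eta> 1" and ?L = "leg n \<eta> 1 0"
  obtain m where m: "n = Suc m" using n by (cases n) auto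
  have split: "(\<Prod>i=1..n. h i) = (\<Prod>i=1..m. h i) * h n" for h :: "nat \<Rightarrow> qt_field"
    by (simp add: m)
  have split': "(\<Prod>i=1..Suc k. h i) = h 1 * (\<Prod>i=1..k. h (Suc i))" for h :: "nat \<Rightarrow> qt_field" and k
    using prod.atLeast_Suc_atMost [of 1 "Suc k" h] prod.shift_bounds_cl_Suc_ivl [of h 1 k] by simp
  define R where "R = (\<Prod>k=1..m. \<Prod>j=1..lookup \<eta> (Suc k). cell_factor n \<eta> (Suc k) j)"
  define S where "S = (\<Prod>j=1..?a. cell_factor n \<eta> 1 j)"
  have 1: "norm_factor n \<eta> = S * R"
    unfolding norm_factor_def R_def S_def unfolding m split' ..
  have "(\<Prod>k=1..m. \<Prod>j=1..lookup ?s k. cell_factor n ?s k j) = R"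
    unfolding R_def
    by (rule prod.cong) (auto simp: cell_factor_def arm_def leg_shift n m)
  moreover have "(\<Prod>j=1..lookup ?s n. cell_factor n ?s n j) = (tt ^ ?L - inverse qq ^ Suc ?a) * S"
  proof -
    have "cell_factor n ?s n (Suc j) = cell_factor n \<eta> 1 j" for j
      using n by (simp add: cell_factor_def arm_def leg_shift_n)
    moreover have "cell_factor n ?s n 1 = tt ^ ?L - inverse qq ^ Suc ?a"
      using n leg_shift_n [OF n, of \<eta> 0] by (simp add: cell_factor_def arm_def flip: One_nat_def)
    ultimately show ?thesis using n by (simp only: lookup_comp_shift_simps split' S_def)
  qed
  ultimately have 2: "norm_factor n ?s = R * ((tt ^ ?L - inverse qq ^ Suc ?a) * S)"
    unfolding norm_factor_def split by simp
  have "S * R \<noteq> 0" using norm_factor_neq_0 [of n \<eta>] unfolding 1 .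
  hence "qq ^ ?a * (norm_factor n ?s / norm_factor n \<eta>) = qq ^ ?a * (tt ^ ?L - inverse qq ^ Suc ?a)"
    unfolding 1 2 by simp
  also have "\<dots> = qq ^ ?a * tt ^ ?L - inverse qq * (qq * inverse qq) ^ ?a"
    by (simp only: right_diff_distrib power_Suc power_mult_distrib ac_simps)
  also have "\<dots> = qq ^ ?a * tt ^ ?L - inverse qq" by simp
  also have "qq ^ ?a * tt ^ ?L = tt ^ (n - 1) * spectral n \<eta> 1"
    unfolding leg_leg' [OF n, of \<eta>, symmetric] by (simp add: spectral_altdef power_add)
  finally show ?thesis .
qed


section \<open>The action on normalised Macdonald polynomials\<close>

text \<open>The coefficients of T_i^{-1} on the basis F are \<open>diag_coeff\<close> and
  \<open>swap_coeff\<close>. Inverting q and t takes them, at spectral values x and y, to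
  \<open>a_hat x y\<close> and \<open>b_hat y x\<close>.\<close>

definition diag_coeff :: "qt_field \<Rightarrow> qt_field \<Rightarrow> qt_field" where
  "diag_coeff x y = (tt - 1) * y / (tt * (x - y))"

definition swap_coeff :: "qt_field \<Rightarrow> qt_field \<Rightarrow> qt_field" where
  "swap_coeff x y = (tt * x - y) / (tt * (x - y))"

context
  fixes n :: nat
  assumes n: "1 \<le> n"
begin

definition macdonald_F :: "expo \<Rightarrow> mpoly" where
  "macdonald_F \<eta> = Const (inverse (norm_factor n \<eta>)) * macdonald_E n \<eta>"

lemma E_eq_F: "macdonald_E n \<eta> = Const (norm_factor n \<eta>) * macdonald_F \<eta>"
  by (simp add: macdonald_F_def)

lemma raise_F:
  assumes "composition n \<eta>"
  shows "raise_op n (macdonald_F \<eta>) = Const (tt ^ (n - 1) * spectral n \<eta> 1 - inverse qq) * macdonald_F (comp_shift n \<eta>)"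
proof -
  have "raise_op n (macdonald_F \<eta>)
     = Const (inverse (norm_factor n \<eta>)) * (Const (qq ^ lookup \<eta> 1) * (Const (norm_factor n (comp_shift n \<eta>)) * macdonald_F (comp_shift n \<eta>)))"
    unfolding macdonald_F_def [of \<eta>] linear_op_Const [OF linear_raise [OF n]] raise_E [OF n assms]
      E_eq_F [of "comp_shift n \<eta>"] ..
  also have "\<dots> = Const (qq ^ lookup \<eta> 1 * (norm_factor n (comp_shift n \<eta>) / norm_factor n \<eta>)) * macdonald_F (comp_shift n \<eta>)"
    by (simp only: Const_mult divide_inverse) (simp only: ac_simps)
  finally show ?thesis unfolding norm_factor_shift [OF n] .
qed

text \<open>On E the coefficient at the exchanged composition is 1 at an ascent, so on F it is the
  ratio of the norm factors.\<close>

lemma hecke_inv_F_less: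
  assumes i: "1 \<le> i" "i < n" and \<eta>: "composition n \<eta>" and less: "lookup \<eta> i < lookup \<eta> (Suc i)"
  defines "x \<equiv> spectral n \<eta> i" and "y \<equiv> spectral n \<eta> (Suc i)"
  shows "hecke_inv i (macdonald_F \<eta>) = Const (diag_coeff x y) * macdonald_F \<eta> + Const (swap_coeff x y) * macdonald_F (comp_swap i \<eta>)"
proof -
  have xy: "x \<noteq> y" unfolding x_def y_def using i by (rule spectral_adjacent_neq [OF n])
  let ?c = "(tt - 1) * x / (x - y)" and ?N = "norm_factor n"
  have "hecke_inv i (macdonald_E n \<eta>)
     = Const (inverse tt) * (Const ?c * macdonald_E n \<eta> + Const tt * macdonald_E n (comp_swap i \<eta>) - Const (tt - 1) * macdonald_E n \<eta>)"
    unfolding hecke_inv_def hecke_E_less [OF n i \<eta> less] x_def y_def by (simp add: Const_diff)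
  also have "\<dots> = Const (inverse tt * (?c - (tt - 1))) * macdonald_E n \<eta> + Const (inverse tt * tt) * macdonald_E n (comp_swap i \<eta>)"
    by (simp only: Const_mult Const_diff) (simp only: algebra_simps)
  also have "inverse tt * (?c - (tt - 1)) = diag_coeff x y"
    using xy by (simp add: diag_coeff_def divide_simps) (simp add: algebra_simps)
  finally have E: "hecke_inv i (macdonald_E n \<eta>) = Const (diag_coeff x y) * macdonald_E n \<eta> + macdonald_E n (comp_swap i \<eta>)"
    by simp
  have "hecke_inv i (macdonald_F \<eta>) = Const (inverse (?N \<eta>)) * (Const (diag_coeff x y) * macdonald_E n \<eta> + Const (?N (comp_swap i \<eta>)) * macdonald_F (comp_swap i \<eta>))"
    unfolding macdonald_F_def [of \<eta>] linear_op_Const [OF linear_hecke_inv] E E_eq_F [of "comp_swap i \<eta>"] ..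
  also have "\<dots> = Const (diag_coeff x y) * macdonald_F \<eta> + Const (?N (comp_swap i \<eta>) / ?N \<eta>) * macdonald_F (comp_swap i \<eta>)"
    unfolding macdonald_F_def [of \<eta>] by (simp only: Const_mult divide_inverse) (simp only: algebra_simps)
  also have "?N (comp_swap i \<eta>) / ?N \<eta> = swap_coeff x y"
    unfolding norm_factor_swap [OF i less] swap_coeff_def x_def y_def ..
  finally show ?thesis .
qed

lemma hecke_inv_square: "hecke_inv i (hecke_inv i f) = Const (inverse tt) * f - Const (inverse tt * (tt - 1)) * hecke_inv i f"
proof -
  have "hecke_inv i (hecke_inv i f) = Const (inverse tt) * (hecke_T i (hecke_inv i f) - (Const tt - 1) * hecke_inv i f)"
    by (rule hecke_inv_def)
  also have "\<dots> = Const (inverse tt) * f - Const (inverse tt) * (Const (tt - 1) * hecke_inv i f)"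
    by (simp add: Const_diff right_diff_distrib)
  finally show ?thesis by (simp only: Const_mult mult.assoc)
qed

lemma spectral_less_neq:
  assumes "lookup \<eta> i < lookup \<eta> j"
  shows "tt * spectral n \<eta> i \<noteq> spectral n \<eta> j"
proof
  assume "tt * spectral n \<eta> i = spectral n \<eta> j"
  hence "qq ^ lookup \<eta> i * tt ^ Suc (leg' n \<eta> j) = qq ^ lookup \<eta> j * tt ^ leg' n \<eta> i"
    by (simp add: spectral_altdef divide_simps ac_simps)
  thus False using assms unfolding qt_monomial_eq_iff by simp
qed

text \<open>At a descent, T_i^{-1} is applied to the ascent formula of the exchanged composition;
  the quadratic relation then yields the action on F_\<eta>, with the same two functions as
  coefficients. For equal parts x = t y makes the diagonal coefficient 1 / t.\<close>

lemma hecke_inv_F: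
  assumes i: "1 \<le> i" "i < n" and \<eta>: "composition n \<eta>"
  defines "x \<equiv> spectral n \<eta> i" and "y \<equiv> spectral n \<eta> (Suc i)"
  shows "hecke_inv i (macdonald_F \<eta>) = Const (diag_coeff x y) * macdonald_F \<eta>
     + Const (if lookup \<eta> i = lookup \<eta> (Suc i) then 0 else swap_coeff x y) * macdonald_F (comp_swap i \<eta>)"
proof -
  have xy: "x \<noteq> y" unfolding x_def y_def using i by (rule spectral_adjacent_neq [OF n])
  consider "lookup \<eta> i < lookup \<eta> (Suc i)" | "lookup \<eta> i = lookup \<eta> (Suc i)" | "lookup \<eta> i > lookup \<eta> (Suc i)"
    by linarith
  thus ?thesis
  proof cases
    case 1
    thus ?thesis using hecke_inv_F_less [OF i \<eta> 1] by (simp add: x_def y_def)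
  next
    case 2
    have "x = tt * y" unfolding x_def y_def using i 2 by (intro spectral_adjacent) auto
    moreover have "y \<noteq> 0" by (simp add: y_def)
    ultimately have d: "diag_coeff x y = inverse tt"
      using xy by (simp add: diag_coeff_def divide_simps) (simp add: algebra_simps)
    have "hecke_T i (macdonald_F \<eta>) = Const tt * macdonald_F \<eta>"
      by (simp add: macdonald_F_def hecke_T_Const hecke_E_equal [OF n i \<eta> 2] mult.left_commute)
    hence "macdonald_F \<eta> = Const tt * hecke_inv i (macdonald_F \<eta>)"
      by (metis hecke_inv_T linear_op_Const linear_hecke_inv)
    hence "hecke_inv i (macdonald_F \<eta>) = Const (inverse tt) * macdonald_F \<eta>"
      by (metis Const_mult_eq_iff tt_neq_0)
    thus ?thesis using 2 d by simp
  next
    case 3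
    let ?s = "comp_swap i \<eta>"
    have s: "lookup ?s i < lookup ?s (Suc i)" using 3 by simp
    have comp: "composition n ?s" using i \<eta> by (rule composition_swap)
    have sp: "spectral n ?s i = y" "spectral n ?s (Suc i) = x"
      using 3 i by (simp_all add: spectral_swap x_def y_def)
    define a b c where "a = diag_coeff y x" and "b = swap_coeff y x" and "c = inverse tt * (tt - 1)"
    \<comment> \<open>The numerator t y - x is nonzero because x and y carry different powers of
      q.\<close>
    have b: "b \<noteq> 0" using spectral_less_neq [OF s] xy by (simp add: b_def swap_coeff_def sp)
    have H: "hecke_inv i (macdonald_F ?s) = Const a * macdonald_F ?s + Const b * macdonald_F \<eta>"
      using hecke_inv_F_less [OF i comp s] unfolding sp comp_swap_swap a_def b_def .
    have "Const b * hecke_inv i (macdonald_F \<eta>) = hecke_inv i (hecke_inv i (macdonald_F ?s)) - Const a * hecke_inv i (macdonald_F ?s)"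
      unfolding arg_cong [OF H, of "hecke_inv i"] linear_op_add [OF linear_hecke_inv] linear_op_Const [OF linear_hecke_inv] by simp
    also have "hecke_inv i (hecke_inv i (macdonald_F ?s)) = Const (inverse tt) * macdonald_F ?s - Const c * (Const a * macdonald_F ?s + Const b * macdonald_F \<eta>)"
      unfolding hecke_inv_square c_def unfolding H ..
    also have "Const (inverse tt) * macdonald_F ?s - Const c * (Const a * macdonald_F ?s + Const b * macdonald_F \<eta>) - Const a * hecke_inv i (macdonald_F ?s)
      = Const (- (c + a) * b) * macdonald_F \<eta> + Const (inverse tt - (c + a) * a) * macdonald_F ?s"
      unfolding H by (simp only: Const_mult Const_diff Const_add single_uminus) (simp add: algebra_simps)
    also have "- (c + a) * b = b * diag_coeff x y"
    proof -
      have "x - y \<noteq> 0" "y - x \<noteq> 0" using xy by simp_all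
      hence "- (c + a) = diag_coeff x y"
        by (simp add: a_def c_def diag_coeff_def divide_simps) (simp add: algebra_simps)
      thus ?thesis by (simp add: mult.commute)
    qed
    also have "inverse tt - (c + a) * a = b * swap_coeff x y"
    proof -
      have "x - y \<noteq> 0" "y - x \<noteq> 0" using xy by simp_all
      thus ?thesis
        unfolding a_def b_def c_def diag_coeff_def swap_coeff_def
        by (simp add: divide_simps) (simp add: algebra_simps)
    qed
    finally have "Const b * hecke_inv i (macdonald_F \<eta>) = Const b * (Const (diag_coeff x y) * macdonald_F \<eta> + Const (swap_coeff x y) * macdonald_F ?s)"
      by (simp only: Const_mult) (simp only: algebra_simps)
    hence "hecke_inv i (macdonald_F \<eta>) = Const (diag_coeff x y) * macdonald_F \<eta> + Const (swap_coeff x y) * macdonald_F ?s"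
      using b by (metis Const_inverse_mult(1))
    thus ?thesis using 3 by simp
  qed
qed

end


section \<open>Expansion of the raising operators\<close>

text \<open>How the coefficients of an expansion in F change under T_i^{-1}. This is the transpose
  of the action on the basis, hence the exchange coefficient takes its arguments in the order of the
  source \<open>comp_swap i \<nu>\<close>.\<close>

definition step_inv :: "nat \<Rightarrow> nat \<Rightarrow> (expo \<Rightarrow> qt_field) \<Rightarrow> expo \<Rightarrow> qt_field" where
  "step_inv n i c \<nu> = diag_coeff (spectral n \<nu> i) (spectral n \<nu> (Suc i)) * c \<nu>
     + (if lookup \<nu> i = lookup \<nu> (Suc i) then 0
        else swap_coeff (spectral n \<nu> (Suc i)) (spectral n \<nu> i) * c (comp_swap i \<nu>))"

text \<open>Belongs to the operator t^{-1} T_i = T_i^{-1} + 1 - t^{-1}; the n - i factors t^{-1}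
  make up the power of t in L_i.\<close>

definition step_up :: "nat \<Rightarrow> nat \<Rightarrow> (expo \<Rightarrow> qt_field) \<Rightarrow> expo \<Rightarrow> qt_field" where
  "step_up n i c \<nu> = step_inv n i c \<nu> + (1 - inverse tt) * c \<nu>"

lemma step_inv_neq_0:
  "step_inv n i c \<nu> \<noteq> 0 \<Longrightarrow> c \<nu> \<noteq> 0 \<or> lookup \<nu> i \<noteq> lookup \<nu> (Suc i) \<and> c (comp_swap i \<nu>) \<noteq> 0"
  by (rule ccontr) (auto simp: step_inv_def split: if_splits)

lemma step_up_neq_0:
  "step_up n i c \<nu> \<noteq> 0 \<Longrightarrow> c \<nu> \<noteq> 0 \<or> lookup \<nu> i \<noteq> lookup \<nu> (Suc i) \<and> c (comp_swap i \<nu>) \<noteq> 0"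
  by (rule ccontr) (auto simp: step_up_def step_inv_def split: if_splits)

text \<open>The sum over the fibre picks the unique preimage under the shift and is 0 where there is
  none.\<close>

definition step_raise :: "nat \<Rightarrow> (expo \<Rightarrow> qt_field) \<Rightarrow> expo \<Rightarrow> qt_field" where
  "step_raise n c \<nu> = (\<Sum>\<kappa>\<in>{\<kappa>. comp_shift n \<kappa> = \<nu>}. (tt ^ (n - 1) * spectral n \<kappa> 1 - inverse qq) * c \<kappa>)"

context
  fixes n :: nat
  assumes n: "1 \<le> n"
begin

text \<open>The coefficients vanish off degree d, which makes the expansion unique as a function on
  all exponents.\<close>

definition expands :: "nat \<Rightarrow> mpoly \<Rightarrow> (expo \<Rightarrow> qt_field) \<Rightarrow> bool" where
  "expands d f c \<longleftrightarrow> (\<forall>\<nu>. c \<nu> \<noteq> 0 \<longrightarrow> \<nu> \<in> comps n d) \<and> f = (\<Sum>\<nu>\<in>comps n d. Const (c \<nu>) * macdonald_F n \<nu>)"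

lemma triangular_F: "triangular n (macdonald_F n)"
  using triangular_E [OF n] by (simp add: triangular_def macdonald_F_def [OF n] lookup_Const_mult)

lemma expands_unique:
  assumes "expands d f c" "expands d f c'"
  shows "c = c'"
proof
  fix \<nu>
  show "c \<nu> = c' \<nu>"
  proof (cases "\<nu> \<in> comps n d")
    case True
    thus ?thesis using assms triangular_unique [OF triangular_F, of c d c' \<nu>] by (auto simp: expands_def)
  next
    case False
    thus ?thesis using assms unfolding expands_def by metis
  qed
qed

lemma expands_exists:
  assumes "homogeneous n d f"
  obtains c where "expands d f c"
proof -
  obtain c where c: "f = (\<Sum>\<nu>\<in>comps n d. Const (c \<nu>) * macdonald_F n \<nu>)"
    using triangular_spans [OF triangular_F assms] by blast
  have "expands d f (\<lambda>\<nu>. if \<nu> \<in> comps n d then c \<nu> else 0)"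
    unfolding expands_def c by (auto intro!: sum.cong)
  thus ?thesis by (rule that)
qed

lemma expands_F:
  assumes "\<eta> \<in> comps n d"
  shows "expands d (macdonald_F n \<eta>) (\<lambda>\<nu>. if \<nu> = \<eta> then 1 else 0)"
proof -
  have "(\<Sum>\<nu>\<in>comps n d. Const (if \<nu> = \<eta> then 1 else 0) * macdonald_F n \<nu>) = (\<Sum>\<nu>\<in>comps n d. if \<nu> = \<eta> then macdonald_F n \<nu> else 0)"
    by (rule sum.cong) auto
  thus ?thesis using assms by (auto simp: expands_def)
qed

lemma expands_add:
  assumes "expands d f c" "expands d g c'"
  shows "expands d (f + g) (\<lambda>\<nu>. c \<nu> + c' \<nu>)"
  unfolding expands_def
proof (intro conjI allI impI)
  show "f + g = (\<Sum>\<nu>\<in>comps n d. Const (c \<nu> + c' \<nu>) * macdonald_F n \<nu>)"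
    using assms by (simp only: expands_def Const_add distrib_right sum.distrib)
  show "\<nu> \<in> comps n d" if "c \<nu> + c' \<nu> \<noteq> 0" for \<nu>
    using that assms unfolding expands_def by (metis add.right_neutral)
qed

lemma expands_Const:
  assumes "expands d f c"
  shows "expands d (Const a * f) (\<lambda>\<nu>. a * c \<nu>)"
  unfolding expands_def
proof (intro conjI allI impI)
  show "Const a * f = (\<Sum>\<nu>\<in>comps n d. Const (a * c \<nu>) * macdonald_F n \<nu>)"
    using assms by (simp only: expands_def Const_mult mult.assoc sum_distrib_left)
  show "\<nu> \<in> comps n d" if "a * c \<nu> \<noteq> 0" for \<nu>
    using that assms unfolding expands_def by (metis mult_zero_right)
qed

lemma comps_swap:
  assumes "1 \<le> i" "i < n"
  shows "comp_swap i \<nu> \<in> comps n d \<longleftrightarrow> \<nu> \<in> comps n d"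
proof -
  have "comp_swap i \<mu> \<in> comps n d" if "\<mu> \<in> comps n d" for \<mu>
    using that assms by (simp add: comps_def composition_swap csize_swap)
  from this [of \<nu>] this [of "comp_swap i \<nu>"] show ?thesis by auto
qed

lemma expands_hecke_inv:
  assumes i: "1 \<le> i" "i < n" and c: "expands d f c"
  shows "expands d (hecke_inv i f) (step_inv n i c)"
  unfolding expands_def
proof (intro conjI allI impI)
  show "\<nu> \<in> comps n d" if "step_inv n i c \<nu> \<noteq> 0" for \<nu>
  proof -
    have "c \<nu> \<noteq> 0 \<or> c (comp_swap i \<nu>) \<noteq> 0"
      using step_inv_neq_0 [OF that] by blast
    thus ?thesis using c comps_swap [OF i] unfolding expands_def by blast
  qed
  define a where "a \<nu> = diag_coeff (spectral n \<nu> i) (spectral n \<nu> (Suc i))" for \<nu>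
  define b where "b \<nu> = (if lookup \<nu> i = lookup \<nu> (Suc i) then 0 else swap_coeff (spectral n \<nu> i) (spectral n \<nu> (Suc i)))" for \<nu>
  have "hecke_inv i f = (\<Sum>\<nu>\<in>comps n d. Const (c \<nu>) * hecke_inv i (macdonald_F n \<nu>))"
    using c by (simp only: expands_def linear_op_sum [OF linear_hecke_inv] linear_op_Const [OF linear_hecke_inv])
  also have "\<dots> = (\<Sum>\<nu>\<in>comps n d. Const (a \<nu> * c \<nu>) * macdonald_F n \<nu> + Const (b \<nu> * c \<nu>) * macdonald_F n (comp_swap i \<nu>))"
    using hecke_inv_F [OF n i]
    by (intro sum.cong) (simp_all add: comps_def a_def b_def Const_mult distrib_left ac_simps)
  also have "\<dots> = (\<Sum>\<nu>\<in>comps n d. Const (a \<nu> * c \<nu>) * macdonald_F n \<nu>)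
      + (\<Sum>\<nu>\<in>comps n d. Const (b \<nu> * c \<nu>) * macdonald_F n (comp_swap i \<nu>))"
    by (rule sum.distrib)
  also have "(\<Sum>\<nu>\<in>comps n d. Const (b \<nu> * c \<nu>) * macdonald_F n (comp_swap i \<nu>))
      = (\<Sum>\<nu>\<in>comps n d. Const (b (comp_swap i \<nu>) * c (comp_swap i \<nu>)) * macdonald_F n \<nu>)"
    by (rule sum.reindex_bij_witness [of _ "comp_swap i" "comp_swap i"]) (simp_all add: comps_swap [OF i])
  also have "(\<Sum>\<nu>\<in>comps n d. Const (a \<nu> * c \<nu>) * macdonald_F n \<nu>) + \<dots>
      = (\<Sum>\<nu>\<in>comps n d. Const (a \<nu> * c \<nu> + b (comp_swap i \<nu>) * c (comp_swap i \<nu>)) * macdonald_F n \<nu>)"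
    by (simp only: Const_add distrib_right sum.distrib)
  also have "\<dots> = (\<Sum>\<nu>\<in>comps n d. Const (step_inv n i c \<nu>) * macdonald_F n \<nu>)"
    using spectral_swap [OF i]
    by (intro sum.cong) (auto simp: step_inv_def a_def b_def)
  finally show "hecke_inv i f = (\<Sum>\<nu>\<in>comps n d. Const (step_inv n i c \<nu>) * macdonald_F n \<nu>)" .
qed

lemma expands_hecke_T:
  assumes i: "1 \<le> i" "i < n" and c: "expands d f c"
  shows "expands d (Const (inverse tt) * hecke_T i f) (step_up n i c)"
proof -
  have "Const (inverse tt) * hecke_T i f
      = Const (inverse tt) * (Const tt * hecke_inv i f) + Const (inverse tt) * (Const (tt - 1) * f)"
    by (subst hecke_T_via_inv) (simp add: distrib_left Const_diff)
  also have "\<dots> = hecke_inv i f + Const (inverse tt * (tt - 1)) * f"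
    by (simp add: Const_mult mult.assoc)
  also have "inverse tt * (tt - 1) = 1 - inverse tt" by (simp add: right_diff_distrib)
  finally have eq: "Const (inverse tt) * hecke_T i f = hecke_inv i f + Const (1 - inverse tt) * f" .
  show ?thesis
    unfolding eq step_up_def [abs_def]
    by (intro expands_add expands_hecke_inv expands_Const i c)
qed

lemma comp_shift_fiber: "{\<kappa>. comp_shift n \<kappa> = comp_shift n \<mu>} = {\<mu>}"
  using comp_shift_inj [OF n] by auto

lemma step_raise_shift: "step_raise n c (comp_shift n \<kappa>) = (tt ^ (n - 1) * spectral n \<kappa> 1 - inverse qq) * c \<kappa>"
  by (simp add: step_raise_def comp_shift_fiber)

lemma step_raise_neq_0:
  assumes "step_raise n c \<nu> \<noteq> 0"
  obtains \<kappa> where "\<nu> = comp_shift n \<kappa>" "c \<kappa> \<noteq> 0"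
proof -
  from assms obtain \<kappa> where \<kappa>: "\<kappa> \<in> {\<kappa>. comp_shift n \<kappa> = \<nu>}"
    "(tt ^ (n - 1) * spectral n \<kappa> 1 - inverse qq) * c \<kappa> \<noteq> 0"
    unfolding step_raise_def by (rule sum.not_neutral_contains_not_neutral)
  from \<kappa>(1) have "\<nu> = comp_shift n \<kappa>" by (rule CollectE) (rule sym)
  moreover from \<kappa>(2) have "c \<kappa> \<noteq> 0" by simp
  ultimately show ?thesis by (rule that)
qed

lemma expands_raise:
  assumes c: "expands d f c"
  shows "expands (Suc d) (raise_op n f) (step_raise n c)"
  unfolding expands_def
proof (intro conjI allI impI)
  show supp: "\<nu> \<in> comps n (Suc d)" if nz: "step_raise n c \<nu> \<noteq> 0" for \<nu>
  proof -
    obtain \<kappa> where "\<nu> = comp_shift n \<kappa>" "c \<kappa> \<noteq> 0" using nz by (rule step_raise_neq_0)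
    thus ?thesis using c n unfolding expands_def comps_def by (auto simp: composition_shift csize_shift)
  qed
  have "raise_op n f = (\<Sum>\<nu>\<in>comps n d. Const (c \<nu>) * raise_op n (macdonald_F n \<nu>))"
    using c by (simp only: expands_def linear_op_sum [OF linear_raise [OF n]] linear_op_Const [OF linear_raise [OF n]])
  also have "\<dots> = (\<Sum>\<nu>\<in>comps n d. Const (step_raise n c (comp_shift n \<nu>)) * macdonald_F n (comp_shift n \<nu>))"
    using raise_F [OF n] by (intro sum.cong) (simp_all add: comps_def step_raise_shift Const_mult ac_simps)
  also have "\<dots> = (\<Sum>\<nu>\<in>comp_shift n ` comps n d. Const (step_raise n c \<nu>) * macdonald_F n \<nu>)"
    using comp_shift_inj [OF n] by (subst sum.reindex) (auto intro: inj_onI)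
  also have "\<dots> = (\<Sum>\<nu>\<in>comps n (Suc d). Const (step_raise n c \<nu>) * macdonald_F n \<nu>)"
  proof (rule sum.mono_neutral_left)
    show "comp_shift n ` comps n d \<subseteq> comps n (Suc d)"
      using n by (auto simp: comps_def composition_shift csize_shift)
    show "\<forall>\<nu>\<in>comps n (Suc d) - comp_shift n ` comps n d. Const (step_raise n c \<nu>) * macdonald_F n \<nu> = 0"
    proof
      fix \<nu> assume \<nu>: "\<nu> \<in> comps n (Suc d) - comp_shift n ` comps n d"
      have "step_raise n c \<nu> = 0"
      proof (rule ccontr)
        assume "step_raise n c \<nu> \<noteq> 0"
        then obtain \<kappa> where "\<nu> = comp_shift n \<kappa>" "c \<kappa> \<noteq> 0" by (rule step_raise_neq_0)
        thus False using c \<nu> unfolding expands_def by blast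
      qed
      thus "Const (step_raise n c \<nu>) * macdonald_F n \<nu> = 0" by simp
    qed
  qed simp
  finally show "raise_op n f = (\<Sum>\<nu>\<in>comps n (Suc d). Const (step_raise n c \<nu>) * macdonald_F n \<nu>)" .
qed

lemma expands_foldr_inv:
  assumes "set xs \<subseteq> {1..<n}" "expands d f c"
  shows "expands d (foldr hecke_inv xs f) (foldr (step_inv n) xs c)"
  using assms by (induction xs) (auto intro: expands_hecke_inv)

lemma expands_foldr_up:
  assumes "set xs \<subseteq> {1..<n}" "expands d f c"
  shows "expands d (Const (inverse tt ^ length xs) * foldr hecke_T xs f) (foldr (step_up n) xs c)"
  using assms
proof (induction xs)
  case (Cons i xs)
  have "expands d (Const (inverse tt) * hecke_T i (Const (inverse tt ^ length xs) * foldr hecke_T xs f))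
     (step_up n i (foldr (step_up n) xs c))"
    using Cons by (intro expands_hecke_T) auto
  thus ?case by (simp add: hecke_T_Const Const_mult mult.assoc)
qed simp

text \<open>These are the coefficients of T_j^{-1} ... T_(i-1)^{-1} F_\<eta>. In the same way
  \<open>upper_coeff i \<eta> j\<close> belongs to L_i F_\<eta> with the chain of T's begun only at
  j, so j = i gives L_i F_\<eta> itself.\<close>

definition lower_coeff :: "nat \<Rightarrow> expo \<Rightarrow> nat \<Rightarrow> expo \<Rightarrow> qt_field" where
  "lower_coeff i \<eta> j = foldr (step_inv n) [j..<i] (\<lambda>\<nu>. if \<nu> = \<eta> then 1 else 0)"

definition upper_coeff :: "nat \<Rightarrow> expo \<Rightarrow> nat \<Rightarrow> expo \<Rightarrow> qt_field" where
  "upper_coeff i \<eta> j = foldr (step_up n) [j..<n] (step_raise n (lower_coeff i \<eta> 1))"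

lemma pieri_relation:
  assumes \<eta>: "composition n \<eta>" and C: "expands (Suc (csize n \<eta>)) (var_sum n * macdonald_F n \<eta>) C"
    and i: "i \<in> {1..n}"
  shows "(spectral n \<nu> i - spectral n \<eta> i) * C \<nu> = (qq - 1) * upper_coeff i \<eta> i \<nu>"
proof -
  let ?d = "csize n \<eta>" and ?x = "spectral n \<eta> i"
  have YF: "cherednik_Y n i (macdonald_F n \<mu>) = Const (spectral n \<mu> i) * macdonald_F n \<mu>" if "composition n \<mu>" for \<mu>
    using eigen_Const [OF n E_eigen [OF n that]] i unfolding macdonald_F_def [OF n] eigen_def by blast
  have "expands ?d (hecke_dn i (macdonald_F n \<eta>)) (lower_coeff i \<eta> 1)"
    unfolding hecke_dn_def lower_coeff_def
    using i \<eta> by (intro expands_foldr_inv expands_F) (auto simp: comps_def)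
  hence "expands (Suc ?d) (Const (inverse tt ^ (n - i)) * hecke_up i n (raise_op n (hecke_dn i (macdonald_F n \<eta>)))) (upper_coeff i \<eta> i)"
    unfolding hecke_up_def upper_coeff_def
    using i expands_foldr_up [of "[i..<n]", OF _ expands_raise] by auto
  moreover have "inverse tt ^ (n - i) = tt powi (int i - int n)"
    using i by (simp add: power_int_def nat_diff_distrib)
  ultimately have U: "expands (Suc ?d) (Const (tt powi (int i - int n)) * hecke_up i n (raise_op n (hecke_dn i (macdonald_F n \<eta>))))
      (upper_coeff i \<eta> i)" by simp
  have "var_sum n * cherednik_Y n i (macdonald_F n \<eta>) = Const ?x * (var_sum n * macdonald_F n \<eta>)"
    by (simp add: YF [OF \<eta>] mult.left_commute)
  hence Y: "cherednik_Y n i (var_sum n * macdonald_F n \<eta>) = Const ?x * (var_sum n * macdonald_F n \<eta>)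
      + Const (qq - 1) * (Const (tt powi (int i - int n)) * hecke_up i n (raise_op n (hecke_dn i (macdonald_F n \<eta>))))"
    using Y_var_sum [OF n, of i "macdonald_F n \<eta>"] i by simp
  have "expands (Suc ?d) (cherednik_Y n i (var_sum n * macdonald_F n \<eta>)) (\<lambda>\<nu>. ?x * C \<nu> + (qq - 1) * upper_coeff i \<eta> i \<nu>)"
    unfolding Y by (intro expands_add expands_Const C U)
  moreover have "expands (Suc ?d) (cherednik_Y n i (var_sum n * macdonald_F n \<eta>)) (\<lambda>\<nu>. spectral n \<nu> i * C \<nu>)"
    unfolding expands_def
  proof (intro conjI allI impI)
    show "\<nu> \<in> comps n (Suc ?d)" if "spectral n \<nu> i * C \<nu> \<noteq> 0" for \<nu>
      using that C unfolding expands_def by auto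
    have "cherednik_Y n i (var_sum n * macdonald_F n \<eta>) = cherednik_Y n i (\<Sum>\<nu>\<in>comps n (Suc ?d). Const (C \<nu>) * macdonald_F n \<nu>)"
      using C unfolding expands_def by simp
    also have "\<dots> = (\<Sum>\<nu>\<in>comps n (Suc ?d). Const (C \<nu>) * cherednik_Y n i (macdonald_F n \<nu>))"
      by (simp only: linear_op_sum [OF linear_Y [OF n]] linear_op_Const [OF linear_Y [OF n]])
    also have "\<dots> = (\<Sum>\<nu>\<in>comps n (Suc ?d). Const (spectral n \<nu> i * C \<nu>) * macdonald_F n \<nu>)"
      by (intro sum.cong) (simp_all add: YF comps_def Const_mult ac_simps)
    finally show "cherednik_Y n i (var_sum n * macdonald_F n \<eta>) = (\<Sum>\<nu>\<in>comps n (Suc ?d). Const (spectral n \<nu> i * C \<nu>) * macdonald_F n \<nu>)" .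
  qed
  ultimately have "(\<lambda>\<nu>. ?x * C \<nu> + (qq - 1) * upper_coeff i \<eta> i \<nu>) = (\<lambda>\<nu>. spectral n \<nu> i * C \<nu>)"
    by (rule expands_unique)
  from fun_cong [OF this, of \<nu>] show ?thesis by (simp add: algebra_simps)
qed

end


section \<open>Paths\<close>

definition next_in :: "nat set \<Rightarrow> nat \<Rightarrow> nat" where
  "next_in I j = (LEAST k. k \<in> I \<and> j \<le> k)"

text \<open>\<open>carry I i \<eta> j\<close> is the composition reached from \<open>\<eta>\<close> after the steps \<open>i - 1, \<dots>, j\<close>, where
  the steps in \<open>I\<close> use the diagonal term and the others exchange two neighbours.
  \<open>carry_perm\<close> describes the resulting order of the entries.\<close>

definition carry :: "nat set \<Rightarrow> nat \<Rightarrow> expo \<Rightarrow> nat \<Rightarrow> expo" where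
  "carry I i \<eta> j = foldr (\<lambda>k \<kappa>. if k \<in> I then \<kappa> else comp_swap k \<kappa>) [j..<i] \<eta>"

definition cycle_in :: "nat set \<Rightarrow> nat \<Rightarrow> nat" where
  "cycle_in I k = (if k \<in> I then next_in I (Suc k) else k)"

definition carry_perm :: "nat set \<Rightarrow> nat \<Rightarrow> nat \<Rightarrow> nat \<Rightarrow> nat" where
  "carry_perm I i j k = (if k < j then k else if k = j then next_in I j
     else if k \<le> i then cycle_in I (k - 1) else k)"

text \<open>All exchanges on the path from i - 1 down to j meet unequal parts. For i = Max I and j =
  1 this is the first condition of maximality.\<close>

definition gaps_ok :: "nat set \<Rightarrow> nat \<Rightarrow> expo \<Rightarrow> nat \<Rightarrow> bool" where
  "gaps_ok I i \<eta> j \<longleftrightarrow> (\<forall>k\<in>{j..<i} - I. lookup \<eta> k \<noteq> lookup \<eta> (next_in I k))"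

lemma carry_step: "j < i \<Longrightarrow> carry I i \<eta> j = (if j \<in> I then carry I i \<eta> (Suc j) else comp_swap j (carry I i \<eta> (Suc j)))"
  by (simp add: carry_def upt_conv_Cons)

lemma carry_refl [simp]: "carry I i \<eta> i = \<eta>"
  by (simp add: carry_def)

lemma next_in_mem: "j \<in> I \<Longrightarrow> next_in I j = j"
  unfolding next_in_def by (rule Least_equality) auto

lemma next_in_not_mem: "j \<notin> I \<Longrightarrow> next_in I j = next_in I (Suc j)"
  unfolding next_in_def by (rule arg_cong [of _ _ Least]) (auto simp: fun_eq_iff Suc_le_eq le_less)

lemma next_in_bounds:
  assumes "i \<in> I" "j \<le> i"
  shows "next_in I j \<in> I" "j \<le> next_in I j" "next_in I j \<le> i"
  using LeastI [of "\<lambda>k. k \<in> I \<and> j \<le> k" i] Least_le [of "\<lambda>k. k \<in> I \<and> j \<le> k" i] assms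
  unfolding next_in_def by auto

lemma carry_perm_step:
  assumes "j < i"
  shows "carry_perm I i j k = (if j \<in> I then carry_perm I i (Suc j) k else carry_perm I i (Suc j) (transpose j (Suc j) k))"
  using assms next_in_mem [of j I] next_in_not_mem [of j I]
  by (auto simp: carry_perm_def cycle_in_def transpose_def)

lemma carry_perm_refl: "i \<in> I \<Longrightarrow> carry_perm I i i k = k"
  by (simp add: carry_perm_def next_in_mem)

lemma lookup_carry:
  assumes "i \<in> I" "j \<le> i"
  shows "lookup (carry I i \<eta> j) k = lookup \<eta> (carry_perm I i j k)"
  using assms(2)
proof (induction "i - j" arbitrary: j k)
  case 0
  thus ?case using assms(1) by (simp add: carry_perm_refl)
next
  case (Suc d)
  hence "lookup (carry I i \<eta> (Suc j)) m = lookup \<eta> (carry_perm I i (Suc j) m)" for m by simp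
  with Suc show ?case by (simp add: carry_step carry_perm_step [of j i I k] lookup_comp_swap)
qed

text \<open>When step j is due, place j is still untouched and place j + 1 holds the part carried
  down from the next element of I.\<close>

lemma carry_values:
  assumes "i \<in> I" "j < i" "j \<notin> I"
  shows "lookup (carry I i \<eta> (Suc j)) j = lookup \<eta> j"
    "lookup (carry I i \<eta> (Suc j)) (Suc j) = lookup \<eta> (next_in I j)"
  using assms by (simp_all add: lookup_carry carry_perm_def next_in_not_mem)

text \<open>Spectral values follow the parts through an exchange only if the parts differ, which
  \<open>gaps_ok\<close> provides at each step.\<close>

lemma spectral_carry:
  assumes "i \<in> I" "i \<le> n" "1 \<le> j" "j \<le> i" "gaps_ok I i \<eta> j"
  shows "spectral n (carry I i \<eta> j) k = spectral n \<eta> (carry_perm I i j k)"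
  using assms(3-5)
proof (induction "i - j" arbitrary: j k)
  case 0
  thus ?case using assms(1) by (simp add: carry_perm_refl)
next
  case (Suc d)
  hence IH: "spectral n (carry I i \<eta> (Suc j)) m = spectral n \<eta> (carry_perm I i (Suc j) m)" for m
    by (simp add: gaps_ok_def)
  have j: "j < i" using Suc by simp
  show ?case
  proof (cases "j \<in> I")
    case True
    thus ?thesis using IH j by (simp add: carry_step carry_perm_step [of j i I k])
  next
    case False
    have "lookup (carry I i \<eta> (Suc j)) j \<noteq> lookup (carry I i \<eta> (Suc j)) (Suc j)"
      unfolding carry_values [OF assms(1) j False] using Suc j False by (simp add: gaps_ok_def)
    thus ?thesis using IH j False Suc.prems assms(2)
      by (simp add: carry_step carry_perm_step [of j i I k] spectral_swap)
  qed
qed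

context
  fixes n :: nat and \<eta> :: expo and i :: nat
  assumes n: "1 \<le> n" and \<eta>: "composition n \<eta>" and i: "1 \<le> i" "i \<le> n"
begin

section \<open>The steps below i\<close>

lemma lower_coeff_refl: "lower_coeff n i \<eta> i \<kappa> = (if \<kappa> = \<eta> then 1 else 0)"
  by (simp add: lower_coeff_def [OF n])

lemma lower_coeff_step: "j < i \<Longrightarrow> lower_coeff n i \<eta> j = step_inv n j (lower_coeff n i \<eta> (Suc j))"
  by (simp add: lower_coeff_def [OF n] upt_conv_Cons)

lemma carry_insert:
  assumes "j < k"
  shows "carry (insert j I) i \<eta> k = carry I i \<eta> k"
  unfolding carry_def using assms by (intro foldr_cong) auto

lemma next_in_insert: "j < k \<Longrightarrow> next_in (insert j I) k = next_in I k"
  unfolding next_in_def by (rule arg_cong [of _ _ Least]) auto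

text \<open>Read step by step downwards: a diagonal term puts j into I, while an exchange leaves j
  out and has a nonzero coefficient only at unequal parts.\<close>

lemma lower_coeff_support:
  assumes "1 \<le> j" "j \<le> i" "lower_coeff n i \<eta> j \<kappa> \<noteq> 0"
  shows "\<exists>I. i \<in> I \<and> I \<subseteq> {j..i} \<and> gaps_ok I i \<eta> j \<and> \<kappa> = carry I i \<eta> j"
  using assms
proof (induction "i - j" arbitrary: j \<kappa>)
  case 0
  hence [simp]: "j = i" by simp
  have "\<kappa> = \<eta>" using 0(4) lower_coeff_refl [of \<kappa>] by (simp split: if_splits)
  thus ?case by (intro exI [of _ "{i}"]) (simp add: gaps_ok_def)
next
  case (Suc d)
  hence j: "1 \<le> j" "j < i" by auto
  let ?c = "lower_coeff n i \<eta> (Suc j)"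
  have IH: "\<exists>I. i \<in> I \<and> I \<subseteq> {Suc j..i} \<and> gaps_ok I i \<eta> (Suc j) \<and> \<mu> = carry I i \<eta> (Suc j)" if "?c \<mu> \<noteq> 0" for \<mu>
    using Suc that by simp
  have "step_inv n j ?c \<kappa> \<noteq> 0" using Suc.prems j by (simp add: lower_coeff_step)
  then consider "?c \<kappa> \<noteq> 0" | "lookup \<kappa> j \<noteq> lookup \<kappa> (Suc j)" "?c (comp_swap j \<kappa>) \<noteq> 0"
    using step_inv_neq_0 by blast
  thus ?case
  proof cases
    case 1
    then obtain I where I: "i \<in> I" "I \<subseteq> {Suc j..i}" "gaps_ok I i \<eta> (Suc j)" "\<kappa> = carry I i \<eta> (Suc j)"
      using IH by blast
    have "gaps_ok (insert j I) i \<eta> j"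
      unfolding gaps_ok_def
    proof
      fix k assume k: "k \<in> {j..<i} - insert j I"
      hence "j < k" by auto
      thus "lookup \<eta> k \<noteq> lookup \<eta> (next_in (insert j I) k)"
        using I(3) k by (auto simp: gaps_ok_def next_in_insert)
    qed
    moreover have "carry (insert j I) i \<eta> j = \<kappa>"
      using I j by (simp add: carry_step carry_insert)
    ultimately show ?thesis using I j by (intro exI [of _ "insert j I"]) auto
  next
    case 2
    then obtain I where I: "i \<in> I" "I \<subseteq> {Suc j..i}" "gaps_ok I i \<eta> (Suc j)" "comp_swap j \<kappa> = carry I i \<eta> (Suc j)"
      using IH by blast
    have jI: "j \<notin> I" using I by auto
    have "lookup \<eta> j \<noteq> lookup \<eta> (next_in I j)"
      using carry_values [OF I(1) j(2) jI, of \<eta>] 2(1) unfolding I(4) [symmetric] by simp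
    note ne = this
    have "gaps_ok I i \<eta> j"
      unfolding gaps_ok_def
    proof
      fix k assume k: "k \<in> {j..<i} - I"
      show "lookup \<eta> k \<noteq> lookup \<eta> (next_in I k)"
        using I(3) k ne by (cases "k = j") (auto simp: gaps_ok_def)
    qed
    moreover have "\<kappa> = carry I i \<eta> j"
      using j jI by (simp add: carry_step I(4) [symmetric])
    moreover have "I \<subseteq> {j..i}" using I by auto
    ultimately show ?thesis using I by blast
  qed
qed

lemma lower_coeff_spectral:
  assumes "1 \<le> j" "j \<le> i" "lower_coeff n i \<eta> j \<kappa> \<noteq> 0" "k < j \<or> i < k"
  shows "spectral n \<kappa> k = spectral n \<eta> k"
proof -
  obtain I where I: "i \<in> I" "gaps_ok I i \<eta> j" "\<kappa> = carry I i \<eta> j"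
    using lower_coeff_support [OF assms(1-3)] by blast
  have "carry_perm I i j k = k" using assms by (auto simp: carry_perm_def)
  thus ?thesis unfolding I(3) using I assms i by (simp add: spectral_carry)
qed

definition path_weight :: "nat set \<Rightarrow> nat \<Rightarrow> qt_field" where
  "path_weight I k = (if k \<in> I then diag_coeff (spectral n \<eta> k) (spectral n \<eta> (next_in I (Suc k)))
     else swap_coeff (spectral n \<eta> k) (spectral n \<eta> (next_in I k)))"

text \<open>One of the two terms of each step vanishes: before step j, place j still carries its
  label x_j, and of the two possible sources, \<kappa> and its exchange, only the one prescribed by
  I has this label there.\<close>

lemma lower_coeff_value:
  assumes I: "i \<in> I" "I \<subseteq> {1..i}" and j: "1 \<le> j" "j \<le> i" and gaps: "gaps_ok I i \<eta> j"
  shows "lower_coeff n i \<eta> j (carry I i \<eta> j) = (\<Prod>k=j..<i. path_weight I k)"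
  using j gaps
proof (induction "i - j" arbitrary: j)
  case 0
  hence [simp]: "j = i" by simp
  show ?case by (simp add: lower_coeff_refl)
next
  case (Suc d)
  hence j: "1 \<le> j" "j < i" by auto
  have gaps': "gaps_ok I i \<eta> (Suc j)" using Suc.prems by (simp add: gaps_ok_def)
  let ?c = "lower_coeff n i \<eta> (Suc j)" and ?\<kappa> = "carry I i \<eta> j"
  have IH: "?c (carry I i \<eta> (Suc j)) = (\<Prod>k=Suc j..<i. path_weight I k)"
    using Suc gaps' by simp
  have zero: "?c \<mu> = 0" if "spectral n \<mu> j \<noteq> spectral n \<eta> j" for \<mu>
    using lower_coeff_spectral [of "Suc j" \<mu> j] that j by fastforce
  have perm: "spectral n ?\<kappa> k = spectral n \<eta> (carry_perm I i j k)" for k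
    using I i j Suc.prems by (intro spectral_carry) auto
  have prod: "(\<Prod>k=j..<i. path_weight I k) = path_weight I j * (\<Prod>k=Suc j..<i. path_weight I k)"
    using j by (intro prod.atLeast_Suc_lessThan) simp
  have in_range: "{j, Suc j} \<subseteq> {1..n}" using j i by auto
  have eq: "lower_coeff n i \<eta> j ?\<kappa> = step_inv n j ?c ?\<kappa>" using j by (simp add: lower_coeff_step)
  show ?case
  proof (cases "j \<in> I")
    case True
    have \<kappa>: "?\<kappa> = carry I i \<eta> (Suc j)" using j True by (simp add: carry_step)
    have s: "spectral n ?\<kappa> j = spectral n \<eta> j" "spectral n ?\<kappa> (Suc j) = spectral n \<eta> (next_in I (Suc j))"
      using j True by (simp_all add: perm carry_perm_def next_in_mem cycle_in_def)
    have "?c (comp_swap j ?\<kappa>) = 0" if "lookup ?\<kappa> j \<noteq> lookup ?\<kappa> (Suc j)"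
    proof (rule zero)
      have "spectral n (comp_swap j ?\<kappa>) j = spectral n ?\<kappa> (Suc j)"
        using that j i by (simp add: spectral_swap)
      moreover have "spectral n ?\<kappa> (Suc j) \<noteq> spectral n ?\<kappa> j"
        using spectral_inj [of "Suc j" n j ?\<kappa>] in_range by auto
      ultimately show "spectral n (comp_swap j ?\<kappa>) j \<noteq> spectral n \<eta> j" using s by simp
    qed
    hence "lower_coeff n i \<eta> j ?\<kappa> = path_weight I j * ?c ?\<kappa>"
      unfolding eq step_inv_def s path_weight_def using True by auto
    thus ?thesis unfolding \<kappa> IH prod .
  next
    case False
    have \<kappa>: "?\<kappa> = comp_swap j (carry I i \<eta> (Suc j))" using j False by (simp add: carry_step)
    have s: "spectral n ?\<kappa> j = spectral n \<eta> (next_in I j)" "spectral n ?\<kappa> (Suc j) = spectral n \<eta> j"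
      using j False by (simp_all add: perm carry_perm_def cycle_in_def)
    have ne: "lookup ?\<kappa> j \<noteq> lookup ?\<kappa> (Suc j)"
      unfolding \<kappa> lookup_comp_swap_simps carry_values [OF I(1) j(2) False]
      using bspec [OF Suc.prems(3) [unfolded gaps_ok_def], of j] j False by auto
    have "?c ?\<kappa> = 0"
      by (rule zero) (use s spectral_inj [of "Suc j" n j ?\<kappa>] in_range in auto)
    hence "lower_coeff n i \<eta> j ?\<kappa> = path_weight I j * ?c (comp_swap j ?\<kappa>)"
      unfolding eq step_inv_def s path_weight_def using ne False by simp
    thus ?thesis unfolding \<kappa> comp_swap_swap IH prod .
  qed
qed

section \<open>The raising step and the steps from i on\<close>

lemma upper_coeff_n: "upper_coeff n i \<eta> n = step_raise n (lower_coeff n i \<eta> 1)"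
  by (simp add: upper_coeff_def [OF n])

lemma upper_coeff_step: "j < n \<Longrightarrow> upper_coeff n i \<eta> j = step_up n j (upper_coeff n i \<eta> (Suc j))"
  by (simp add: upper_coeff_def [OF n] upt_conv_Cons)

text \<open>The steps below i leave the labels above i alone, the shift lowers them by one place,
  and the steps down to j do not reach the places below j.\<close>

lemma upper_coeff_spectral:
  assumes "i \<le> j" "j \<le> n" "upper_coeff n i \<eta> j \<xi> \<noteq> 0" "i \<le> k" "k < j"
  shows "spectral n \<xi> k = spectral n \<eta> (Suc k)"
  using assms
proof (induction "n - j" arbitrary: j \<xi>)
  case 0
  hence [simp]: "j = n" by simp
  from 0 have "step_raise n (lower_coeff n i \<eta> 1) \<xi> \<noteq> 0" by (simp add: upper_coeff_n)
  with n obtain \<kappa> where \<kappa>: "\<xi> = comp_shift n \<kappa>" "lower_coeff n i \<eta> 1 \<kappa> \<noteq> 0"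
    by (rule step_raise_neq_0)
  have "spectral n \<xi> k = spectral n \<kappa> (Suc k)"
    using 0 i \<kappa>(1) n by (simp add: spectral_shift)
  thus ?case using lower_coeff_spectral [of 1 \<kappa> "Suc k"] \<kappa>(2) 0 i by simp
next
  case (Suc d)
  hence j: "j < n" by simp
  let ?c = "upper_coeff n i \<eta> (Suc j)"
  have IH: "spectral n \<mu> k = spectral n \<eta> (Suc k)" if "?c \<mu> \<noteq> 0" for \<mu>
    using Suc.hyps(1) [of "Suc j" \<mu>] Suc.hyps(2) Suc.prems j that by simp
  have "step_up n j ?c \<xi> \<noteq> 0" using Suc.prems j by (simp add: upper_coeff_step)
  then consider "?c \<xi> \<noteq> 0" | "lookup \<xi> j \<noteq> lookup \<xi> (Suc j)" "?c (comp_swap j \<xi>) \<noteq> 0"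
    using step_up_neq_0 by blast
  thus ?case
  proof cases
    case 2
    have "spectral n (comp_swap j \<xi>) k = spectral n \<xi> k"
      using 2(1) Suc.prems i j by (simp add: spectral_swap transpose_def)
    thus ?thesis using IH [OF 2(2)] by simp
  qed (rule IH)
qed

text \<open>Exchanges at i, ..., j - 1 in this order carry the part at place i of \<nu> to place j:
  they undo the steps j - 1, ..., i of a path of exchanges that ends in \<nu>.\<close>

definition shift_out :: "expo \<Rightarrow> nat \<Rightarrow> expo" where
  "shift_out \<nu> j = fold comp_swap [i..<j] \<nu>"

definition shift_perm :: "nat \<Rightarrow> nat \<Rightarrow> nat" where
  "shift_perm j k = (if i \<le> k \<and> k < j then Suc k else if k = j then i else k)"

lemma shift_out_step: "i \<le> j \<Longrightarrow> shift_out \<nu> (Suc j) = comp_swap j (shift_out \<nu> j)"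
  by (simp add: shift_out_def)

lemma shift_perm_step: "i \<le> j \<Longrightarrow> shift_perm (Suc j) k = shift_perm j (transpose j (Suc j) k)"
  by (auto simp: shift_perm_def transpose_def)

lemma lookup_shift_out: "i \<le> j \<Longrightarrow> lookup (shift_out \<nu> j) k = lookup \<nu> (shift_perm j k)"
proof (induction j arbitrary: k rule: nat_induct_at_least)
  case base
  show ?case by (simp add: shift_out_def shift_perm_def)
next
  case (Suc j)
  thus ?case by (simp add: shift_out_step shift_perm_step lookup_comp_swap)
qed

lemma spectral_shift_out:
  assumes "i \<le> j" "j \<le> n" "\<forall>m\<in>{i<..j}. lookup \<nu> i \<noteq> lookup \<nu> m"
  shows "spectral n (shift_out \<nu> j) k = spectral n \<nu> (shift_perm j k)"
  using assms
proof (induction j arbitrary: k rule: nat_induct_at_least)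
  case base
  show ?case by (simp add: shift_out_def shift_perm_def)
next
  case (Suc j)
  have "lookup (shift_out \<nu> j) j \<noteq> lookup (shift_out \<nu> j) (Suc j)"
    using Suc by (simp add: lookup_shift_out shift_perm_def)
  moreover have "spectral n (shift_out \<nu> j) m = spectral n \<nu> (shift_perm j m)" for m
    using Suc by simp
  ultimately show ?case
    using Suc i by (simp add: shift_out_step shift_perm_step spectral_swap)
qed

text \<open>Beyond i, \<nu> has the labels of \<eta>, while after raising these stand one place
  lower. Each step must move one of them up, so it is an exchange, and it contributes 0 if the two
  parts are equal.\<close>

lemma upper_coeff_path:
  assumes tail: "\<And>m. i < m \<Longrightarrow> m \<le> n \<Longrightarrow> spectral n \<nu> m = spectral n \<eta> m"
    and j: "i \<le> j" "j \<le> n"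
  shows "upper_coeff n i \<eta> i \<nu> = (if \<forall>m\<in>{i<..j}. lookup \<nu> i \<noteq> lookup \<nu> m
     then (\<Prod>m\<in>{i<..j}. swap_coeff (spectral n \<eta> m) (spectral n \<nu> i)) * upper_coeff n i \<eta> j (shift_out \<nu> j) else 0)"
  using j
proof (induction j rule: nat_induct_at_least)
  case base
  show ?case by (simp add: shift_out_def)
next
  case (Suc j)
  let ?\<xi> = "shift_out \<nu> j" and ?c = "upper_coeff n i \<eta> (Suc j)"
  have range: "{i<..Suc j} = insert (Suc j) {i<..j}" using Suc by auto
  show ?case
  proof (cases "\<forall>m\<in>{i<..j}. lookup \<nu> i \<noteq> lookup \<nu> m")
    case True
    have s: "spectral n ?\<xi> k = spectral n \<nu> (shift_perm j k)" for k
      using Suc True by (intro spectral_shift_out) auto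
    have l: "lookup ?\<xi> j = lookup \<nu> i" "lookup ?\<xi> (Suc j) = lookup \<nu> (Suc j)"
      using Suc by (simp_all add: lookup_shift_out shift_perm_def)
    have sj: "spectral n ?\<xi> j = spectral n \<nu> i" "spectral n ?\<xi> (Suc j) = spectral n \<eta> (Suc j)"
      using Suc tail [of "Suc j"] by (simp_all add: s shift_perm_def)
    \<comment> \<open>For the diagonal term, place j would have to hold the label of \<eta> at j +
      1, which is that of \<nu> at j + 1. It holds the label of \<nu> at i instead, and the labels
      of \<nu> are distinct.\<close>
    have "?c ?\<xi> = 0"
    proof (rule ccontr)
      assume "?c ?\<xi> \<noteq> 0"
      hence "spectral n ?\<xi> j = spectral n \<eta> (Suc j)"
        using Suc by (intro upper_coeff_spectral [of "Suc j"]) auto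
      hence "spectral n \<nu> i = spectral n \<nu> (Suc j)" using sj tail [of "Suc j"] Suc by simp
      thus False using spectral_inj [of i n "Suc j" \<nu>] Suc i by simp
    qed
    hence "upper_coeff n i \<eta> j ?\<xi> = (if lookup \<nu> i = lookup \<nu> (Suc j) then 0
       else swap_coeff (spectral n \<eta> (Suc j)) (spectral n \<nu> i) * ?c (shift_out \<nu> (Suc j)))"
      using Suc by (simp add: upper_coeff_step step_up_def step_inv_def l sj shift_out_step)
    thus ?thesis using Suc True unfolding range by simp
  next
    case False
    thus ?thesis using Suc unfolding range by auto
  qed
qed

end


section \<open>The Pieri coefficients\<close>

lemma elt_cover:
  assumes "finite I" "k \<in> I"
  obtains m where "m \<in> {1..card I}" "k = elt I m"
proof -
  from assms have "k \<in> set (sorted_list_of_set I)" by simp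
  then obtain m where "m < card I" "k = sorted_list_of_set I ! m"
    by (auto simp: in_set_conv_nth)
  thus ?thesis by (intro that [of "Suc m"]) (auto simp: elt_def)
qed

lemma elt_mono: "finite I \<Longrightarrow> 1 \<le> k \<Longrightarrow> k \<le> m \<Longrightarrow> m \<le> card I \<Longrightarrow> elt I k \<le> elt I m"
  using elt_less [of I k m] by (cases "k = m") auto

lemma elt_less_iff:
  assumes "finite I" "k \<in> {1..card I}" "m \<in> {1..card I}"
  shows "elt I k < elt I m \<longleftrightarrow> k < m"
  using assms elt_less [of I k m] elt_mono [of I m k] by (cases "k < m") (auto simp: not_less)

text \<open>Connects the enumeration t_u of the statement with \<open>next_in\<close>, by which the
  paths are described.\<close>

lemma next_in_elt:
  assumes I: "finite I" and u: "u \<in> {1..card I}" and j: "elt I (u - 1) < j" "j \<le> elt I u"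
  shows "next_in I j = elt I u"
  unfolding next_in_def
proof (rule Least_equality)
  show "elt I u \<in> I \<and> j \<le> elt I u" using elt_in [OF I u] j by simp
next
  fix k assume k: "k \<in> I \<and> j \<le> k"
  then obtain m where m: "m \<in> {1..card I}" "k = elt I m" using elt_cover [OF I, of k] by blast
  have "\<not> m \<le> u - 1"
  proof
    assume "m \<le> u - 1"
    hence "elt I m \<le> elt I (u - 1)" using m u I by (intro elt_mono) auto
    thus False using k j m by simp
  qed
  thus "elt I u \<le> k" using m u I by (auto intro: elt_mono)
qed

context
  fixes I :: "nat set" and n :: nat
  assumes I: "I \<noteq> {}" "I \<subseteq> {1..n}"
begin

lemma fin_I: "finite I"
  using I by (meson finite_atLeastAtMost finite_subset)

lemma card_I: "1 \<le> card I"
proof -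
  have "card I > 0" using I fin_I card_gt_0_iff by blast
  thus ?thesis by simp
qed

lemma elt_last: "elt I (card I) = Max I"
proof (rule Max_eqI [symmetric])
  show "elt I (card I) \<in> I" using card_I by (intro elt_in fin_I) simp
  show "k \<le> elt I (card I)" if k: "k \<in> I" for k
  proof -
    obtain m where "m \<in> {1..card I}" "k = elt I m" using fin_I k by (rule elt_cover)
    thus ?thesis using elt_mono [OF fin_I, of m "card I"] by simp
  qed
qed (rule fin_I)

lemma Max_I: "Max I \<in> I" "1 \<le> Max I" "Max I \<le> n"
  using I Max_in [OF fin_I I(1)] by auto

lemma le_Max: "k \<in> I \<Longrightarrow> k \<le> Max I"
  by (rule Max_ge [OF fin_I])

lemma elt_pos: "u \<in> {1..card I} \<Longrightarrow> 1 \<le> elt I u"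
  using subsetD [OF I(2) elt_in [OF fin_I]] by simp

lemma elt_first: "elt I 1 = next_in I 1"
  using card_I elt_pos [of 1] by (intro next_in_elt [symmetric] fin_I) (auto simp: elt_def)

lemma gap_cover:
  assumes "1 \<le> j" "j \<le> Max I"
  obtains u where "u \<in> {1..card I}" "elt I (u - 1) < j" "j \<le> elt I u"
proof -
  note nb = next_in_bounds [OF Max_I(1) assms(2)]
  obtain u where u: "u \<in> {1..card I}" "next_in I j = elt I u" using elt_cover [OF fin_I nb(1)] by blast
  have "elt I (u - 1) < j"
  proof (cases "u = 1")
    case True
    thus ?thesis using assms(1) by (simp add: elt_def)
  next
    case False
    hence u1: "u - 1 \<in> {1..card I}" using u by auto
    show ?thesis
    proof (rule ccontr)
      assume "\<not> elt I (u - 1) < j"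
      hence "next_in I j \<le> elt I (u - 1)"
        unfolding next_in_def using elt_in [OF fin_I u1] by (intro Least_le) auto
      moreover have "elt I (u - 1) < elt I u" using u u1 by (intro elt_less fin_I) auto
      ultimately show False using u by simp
    qed
  qed
  thus ?thesis using that u nb by simp
qed

text \<open>The first condition says that the exchanges below Max I meet unequal parts, the second
  that the raised part differs from all parts it is moved past afterwards.\<close>

lemma maximal_set_iff:
  "maximal_set n \<eta> I \<longleftrightarrow> gaps_ok I (Max I) \<eta> 1 \<and> (\<forall>j\<in>{Max I<..n}. lookup \<eta> j \<noteq> lookup \<eta> (next_in I 1) + 1)"
proof -
  have "(\<forall>u\<in>{1..card I}. \<forall>j\<in>{elt I (u - 1)<..<elt I u}. lookup \<eta> j \<noteq> lookup \<eta> (elt I u))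
      \<longleftrightarrow> gaps_ok I (Max I) \<eta> 1" (is "?L \<longleftrightarrow> ?R")
  proof
    assume L: ?L
    show ?R unfolding gaps_ok_def
    proof
      fix k assume k: "k \<in> {1..<Max I} - I"
      then obtain u where u: "u \<in> {1..card I}" "elt I (u - 1) < k" "k \<le> elt I u"
        using gap_cover [of k] by auto
      have "k \<noteq> elt I u" using k elt_in [OF fin_I u(1)] by auto
      thus "lookup \<eta> k \<noteq> lookup \<eta> (next_in I k)"
        using L u next_in_elt [OF fin_I u] by auto
    qed
  next
    assume R: ?R
    show ?L
    proof (intro ballI)
      fix u j assume u: "u \<in> {1..card I}" and j: "j \<in> {elt I (u - 1)<..<elt I u}"
      have next_j: "next_in I j = elt I u" using u j by (intro next_in_elt fin_I) auto
      have "j \<notin> I" using next_j j next_in_mem [of j I] by auto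
      moreover have "j < Max I" using j le_Max [OF elt_in [OF fin_I u]] by simp
      ultimately show "lookup \<eta> j \<noteq> lookup \<eta> (elt I u)"
        using R j unfolding gaps_ok_def next_j [symmetric] by auto
    qed
  qed
  thus ?thesis using I unfolding maximal_set_def by (auto simp: elt_last elt_first)
qed

lemma next_in_Suc:
  assumes "k \<in> {1..<card I}"
  shows "next_in I (Suc (elt I k)) = elt I (k + 1)"
  using assms elt_less [OF fin_I, of k "k + 1"] by (intro next_in_elt fin_I) auto

lemma lookup_c_set_next:
  "lookup (c_set I \<eta>) j = (if j = Max I then Suc (lookup \<eta> (next_in I 1)) else lookup \<eta> (cycle_in I j))"
proof (cases "j \<in> I")
  case False
  thus ?thesis using Max_I fin_I by (auto simp: lookup_c_set cycle_in_def)
next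
  case True
  then obtain m where m: "m \<in> {1..card I}" "j = elt I m" using elt_cover [OF fin_I] by blast
  show ?thesis
  proof (cases "j = Max I")
    case True
    thus ?thesis using lookup_c_set_last [OF fin_I I(1), of \<eta>] by (simp add: elt_last elt_first)
  next
    case False
    hence "m \<in> {1..<card I}" using m by (cases "m = card I") (auto simp: elt_last)
    thus ?thesis using False True m lookup_c_set_inner [OF fin_I, of m \<eta>]
      by (simp add: cycle_in_def next_in_Suc)
  qed
qed

text \<open>Matches factors of \<open>A_fun\<close> with the places below Max I where the path keeps
  the composition; \<open>prod_gaps\<close> matches factors of \<open>B_tilde\<close> with the
  exchanges there.\<close>

lemma prod_stay: "(\<Prod>u\<in>{1..<card I}. h (elt I u) (elt I (u + 1))) = (\<Prod>k\<in>I - {Max I}. h k (next_in I (Suc k)))"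
  for h :: "nat \<Rightarrow> nat \<Rightarrow> qt_field"
proof (rule prod.reindex_cong [symmetric, of "elt I"])
  show "inj_on (elt I) {1..<card I}"
  proof (rule linorder_inj_onI)
    fix x y assume "x < y" "x \<in> {1..<card I}" "y \<in> {1..<card I}"
    with elt_less [OF fin_I, of x y] show "elt I x \<noteq> elt I y" by auto
  qed auto
  show "I - {Max I} = elt I ` {1..<card I}"
  proof
    show "I - {Max I} \<subseteq> elt I ` {1..<card I}"
    proof
      fix k assume k: "k \<in> I - {Max I}"
      then obtain m where "m \<in> {1..card I}" "k = elt I m" using elt_cover [OF fin_I, of k] by blast
      moreover have "m \<noteq> card I" using k calculation by (auto simp: elt_last)
      ultimately show "k \<in> elt I ` {1..<card I}" by auto
    qed
    show "elt I ` {1..<card I} \<subseteq> I - {Max I}"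
    proof
      fix k assume "k \<in> elt I ` {1..<card I}"
      then obtain u where u: "u \<in> {1..<card I}" "k = elt I u" by blast
      hence "elt I u < elt I (card I)" by (intro elt_less fin_I) auto
      thus "k \<in> I - {Max I}" using u elt_in [OF fin_I, of u] by (auto simp: elt_last)
    qed
  qed
qed (simp add: next_in_Suc)

text \<open>The gaps between consecutive elements are disjoint and fill the places below Max I
  outside I.\<close>

lemma prod_gaps: "(\<Prod>u=1..card I. \<Prod>j\<in>{elt I (u - 1)<..<elt I u}. h (elt I u) j) = (\<Prod>k\<in>{1..<Max I} - I. h (next_in I k) k)"
  for h :: "nat \<Rightarrow> nat \<Rightarrow> qt_field"
proof -
  let ?g = "\<lambda>u. {elt I (u - 1)<..<elt I u}"
  have nxt: "next_in I j = elt I u" if "u \<in> {1..card I}" "j \<in> ?g u" for u j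
    using that by (intro next_in_elt fin_I) auto
  have inj: "u = v" if "u \<in> {1..card I}" "v \<in> {1..card I}" "elt I u = elt I v" for u v
    using that elt_less_iff [OF fin_I, of u v] elt_less_iff [OF fin_I, of v u] by (cases u v rule: linorder_cases) auto
  have "(\<Prod>u=1..card I. \<Prod>j\<in>?g u. h (elt I u) j) = (\<Prod>u=1..card I. \<Prod>j\<in>?g u. h (next_in I j) j)"
    using nxt by (intro prod.cong) auto
  also have "\<dots> = (\<Prod>j\<in>(\<Union>u\<in>{1..card I}. ?g u). h (next_in I j) j)"
  proof (rule prod.UNION_disjoint [symmetric])
    show "\<forall>u\<in>{1..card I}. \<forall>v\<in>{1..card I}. u \<noteq> v \<longrightarrow> ?g u \<inter> ?g v = {}"
    proof (intro ballI impI equals0I)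
      fix u v j assume uv: "u \<in> {1..card I}" "v \<in> {1..card I}" "u \<noteq> v" and j: "j \<in> ?g u \<inter> ?g v"
      hence "elt I u = elt I v" using nxt [of u j] nxt [of v j] by simp
      thus False using inj uv by blast
    qed
  qed auto
  also have "(\<Union>u\<in>{1..card I}. ?g u) = {1..<Max I} - I"
  proof
    show "(\<Union>u\<in>{1..card I}. ?g u) \<subseteq> {1..<Max I} - I"
    proof
      fix j assume "j \<in> (\<Union>u\<in>{1..card I}. ?g u)"
      then obtain u where u: "u \<in> {1..card I}" "j \<in> ?g u" by blast
      have "j \<notin> I" using nxt [OF u] u next_in_mem [of j I] by auto
      moreover have "j < Max I" using u le_Max [OF elt_in [OF fin_I u(1)]] by simp
      ultimately show "j \<in> {1..<Max I} - I" using u by auto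
    qed
    show "{1..<Max I} - I \<subseteq> (\<Union>u\<in>{1..card I}. ?g u)"
    proof
      fix j assume j: "j \<in> {1..<Max I} - I"
      then obtain u where u: "u \<in> {1..card I}" "elt I (u - 1) < j" "j \<le> elt I u"
        using gap_cover [of j] by auto
      have "j \<noteq> elt I u" using j elt_in [OF fin_I u(1)] by auto
      thus "j \<in> (\<Union>u\<in>{1..card I}. ?g u)" using u by auto
    qed
  qed
  finally show ?thesis .
qed

end

context
  fixes n :: nat and \<eta> :: expo and C :: "expo \<Rightarrow> qt_field"
  assumes n: "1 \<le> n" and \<eta>: "composition n \<eta>"
    and C: "expands n (Suc (csize n \<eta>)) (var_sum n * macdonald_F n \<eta>) C"
begin

section \<open>Support and values of the Pieri coefficients\<close>

lemma shift_out_n: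
  assumes "1 \<le> i" "i \<le> n"
  shows "lookup (shift_out i \<nu> n) k = lookup \<nu> (if i \<le> k \<and> k < n then Suc k else if k = n then i else k)"
  using lookup_shift_out [OF n \<eta> assms, of n \<nu> k] assms by (simp add: shift_perm_def [OF n \<eta> assms])

lemma pieri_support:
  assumes nz: "C \<nu> \<noteq> 0"
  shows "\<exists>I. maximal_set n \<eta> I \<and> \<nu> = c_set I \<eta>"
proof -
  have "\<nu> \<in> comps n (Suc (csize n \<eta>))" using C nz by (simp add: expands_def [OF n])
  hence \<nu>: "composition n \<nu>" "csize n \<nu> = Suc (csize n \<eta>)" by (simp_all add: comps_def)
  let ?D = "{j\<in>{1..n}. spectral n \<nu> j \<noteq> spectral n \<eta> j}"
  have "?D \<noteq> {}"
  proof
    assume "?D = {}"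
    hence "\<nu> = \<eta>" by (intro spectral_determines [OF n \<eta> \<nu>(1)]) blast
    thus False using \<nu>(2) by simp
  qed
  define i where "i = Max ?D"
  have "i \<in> ?D" unfolding i_def using \<open>?D \<noteq> {}\<close> by (intro Max_in) auto
  hence i: "1 \<le> i" "i \<le> n" and ne: "spectral n \<nu> i \<noteq> spectral n \<eta> i" by auto
  have tail: "spectral n \<nu> m = spectral n \<eta> m" if "i < m" "m \<le> n" for m
  proof (rule ccontr)
    assume "spectral n \<nu> m \<noteq> spectral n \<eta> m"
    hence "m \<le> i" unfolding i_def using that by (intro Max_ge) auto
    thus False using that by simp
  qed
  \<comment> \<open>At this place the spectral difference in the Pieri relation is nonzero, so a
    nonzero coefficient needs a path from \<eta> to \<nu>.\<close>
  have "upper_coeff n i \<eta> i \<nu> \<noteq> 0"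
    using pieri_relation [OF n \<eta> C, of i \<nu>] i ne nz by auto
  hence distinct: "\<forall>m\<in>{i<..n}. lookup \<nu> i \<noteq> lookup \<nu> m"
    and up: "upper_coeff n i \<eta> n (shift_out i \<nu> n) \<noteq> 0"
    using upper_coeff_path [OF n \<eta> i tail, of n] i by (auto split: if_splits)
  from up have "step_raise n (lower_coeff n i \<eta> 1) (shift_out i \<nu> n) \<noteq> 0"
    by (simp add: upper_coeff_n [OF n \<eta> i])
  with n obtain \<kappa> where \<kappa>: "shift_out i \<nu> n = comp_shift n \<kappa>" "lower_coeff n i \<eta> 1 \<kappa> \<noteq> 0"
    by (rule step_raise_neq_0)
  obtain I where I: "i \<in> I" "I \<subseteq> {1..i}" "gaps_ok I i \<eta> 1" "\<kappa> = carry I i \<eta> 1"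
    using lower_coeff_support [OF n \<eta> i _ _ \<kappa>(2)] i by auto
  have I': "I \<noteq> {}" "I \<subseteq> {1..n}" using I i by auto
  have Max: "Max I = i"
    using I finite_subset [OF I(2)] by (intro Max_eqI) auto
  have l\<kappa>: "lookup \<kappa> k = lookup \<eta> (carry_perm I i 1 k)" for k
    unfolding I(4) using I i by (intro lookup_carry) auto
  have ls: "lookup \<nu> (if i \<le> k \<and> k < n then Suc k else if k = n then i else k)
     = lookup (comp_shift n \<kappa>) k" for k
    unfolding \<kappa>(1) [symmetric] shift_out_n [OF i] ..
  have last: "lookup \<nu> i = Suc (lookup \<eta> (next_in I 1))"
    using ls [of n] n by (simp add: l\<kappa> carry_perm_def)
  have "\<nu> = c_set I \<eta>"
  proof (rule poly_mapping_eqI)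
    fix k
    consider "k = i" | "i < k" "k \<le> n" | "1 \<le> k" "k < i" | "k \<notin> {1..n}" by fastforce
    thus "lookup \<nu> k = lookup (c_set I \<eta>) k"
    proof cases
      case 1
      thus ?thesis using last by (simp add: lookup_c_set_next [OF I'] Max)
    next
      case 2
      have "lookup \<nu> k = lookup \<eta> k" using tail [OF 2] by (simp add: spectral_eq_iff)
      moreover have "k \<notin> I" using 2 I by auto
      ultimately show ?thesis using 2 by (simp add: lookup_c_set_next [OF I'] Max cycle_in_def)
    next
      case 3
      have "lookup \<nu> k = lookup \<kappa> (Suc k)" using ls [of k] 3 i n by simp
      also have "\<dots> = lookup \<eta> (cycle_in I k)" using 3 by (simp add: l\<kappa> carry_perm_def)
      finally show ?thesis using 3 by (simp add: lookup_c_set_next [OF I'] Max)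
    next
      case 4
      hence "k \<notin> I" "k \<noteq> i" using I' i by auto
      thus ?thesis using 4 composition_outside [OF \<eta>] composition_outside [OF \<nu>(1)]
        by (simp add: lookup_c_set_next [OF I'] Max cycle_in_def)
    qed
  qed
  moreover have "maximal_set n \<eta> I"
    unfolding maximal_set_iff [OF I'] Max
  proof (intro conjI ballI I(3))
    fix j assume j: "j \<in> {i<..n}"
    hence "lookup \<nu> j = lookup \<eta> j" using tail [of j] by (simp add: spectral_eq_iff)
    thus "lookup \<eta> j \<noteq> lookup \<eta> (next_in I 1) + 1" using distinct j last by fastforce
  qed
  ultimately show ?thesis by blast
qed

lemma pieri_value:
  assumes max: "maximal_set n \<eta> I"
  defines "i \<equiv> Max I" and "x \<equiv> spectral n \<eta>" and "a \<equiv> next_in I 1"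
  shows "C (c_set I \<eta>) = (qq - 1) / (qq * x a - x i) * ((tt ^ (n - 1) * x a - inverse qq)
    * (\<Prod>k\<in>I - {i}. diag_coeff (x k) (x (next_in I (Suc k))))
    * (\<Prod>k\<in>{1..<i} - I. swap_coeff (x k) (x (next_in I k)))
    * (\<Prod>m\<in>{i<..n}. swap_coeff (x m) (qq * x a)))"
proof -
  have I: "I \<noteq> {}" "I \<subseteq> {1..n}" using max by (simp_all add: maximal_set_def)
  have gaps: "gaps_ok I i \<eta> 1" and upper: "\<forall>j\<in>{i<..n}. lookup \<eta> j \<noteq> lookup \<eta> a + 1"
    using max unfolding maximal_set_iff [OF I] i_def a_def by blast+
  have i: "1 \<le> i" "i \<le> n" "i \<in> I" using Max_I [OF I] by (simp_all add: i_def)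
  have Ii: "I \<subseteq> {1..i}" using I le_Max [OF I] by (auto simp: i_def)
  let ?\<nu> = "c_set I \<eta>"
  define \<kappa> where "\<kappa> = carry I i \<eta> 1"
  have l\<kappa>: "lookup \<kappa> k = lookup \<eta> (carry_perm I i 1 k)" for k
    unfolding \<kappa>_def using i by (intro lookup_carry) auto
  have s\<kappa>: "spectral n \<kappa> k = x (carry_perm I i 1 k)" for k
    unfolding \<kappa>_def x_def using i gaps by (intro spectral_carry) auto
  have l\<nu>: "lookup ?\<nu> j = (if j = i then Suc (lookup \<eta> a) else lookup \<eta> (cycle_in I j))" for j
    unfolding i_def a_def by (rule lookup_c_set_next [OF I])
  have out: "cycle_in I j = j" if "i < j \<or> j = 0" for j using that Ii by (auto simp: cycle_in_def)
  \<comment> \<open>Undoing the exchanges above i takes \<nu> back to the raised composition, so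
    this part of the path fits to the one below i.\<close>
  have out_eq: "shift_out i ?\<nu> n = comp_shift n \<kappa>"
  proof (rule poly_mapping_eqI)
    fix k
    consider "k = 0" | "1 \<le> k" "k < i" | "i \<le> k" "k < n" | "k = n" | "n < k" by linarith
    thus "lookup (shift_out i ?\<nu> n) k = lookup (comp_shift n \<kappa>) k"
    proof cases
      case 1
      thus ?thesis using i n out [of 0] by (simp add: shift_out_n l\<nu> lookup_comp_shift cyc_def l\<kappa> carry_perm_def)
    next
      case 2
      thus ?thesis using i n by (simp add: shift_out_n l\<nu> l\<kappa> carry_perm_def)
    next
      case 3
      thus ?thesis using i n out [of "Suc k"] by (simp add: shift_out_n l\<nu> l\<kappa> carry_perm_def)
    next
      case 4
      thus ?thesis using i n by (simp add: shift_out_n l\<nu> l\<kappa> carry_perm_def a_def)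
    next
      case 5
      thus ?thesis using i n out [of k]
        by (simp add: shift_out_n l\<nu> lookup_comp_shift cyc_def l\<kappa> carry_perm_def)
    qed
  qed
  have distinct: "\<forall>m\<in>{i<..n}. lookup ?\<nu> i \<noteq> lookup ?\<nu> m"
    using upper out by (auto simp: l\<nu>)
  have s\<nu>: "spectral n (comp_shift n \<kappa>) k = spectral n ?\<nu> (if i \<le> k \<and> k < n then Suc k else if k = n then i else k)" for k
    unfolding out_eq [symmetric]
    using spectral_shift_out [OF n \<eta> i(1,2,2) le_refl distinct, of k] by (simp add: shift_perm_def [OF n \<eta> i(1,2)])
  have s_i: "spectral n ?\<nu> i = qq * x a"
    using s\<nu> [of n] n by (simp add: spectral_shift s\<kappa> carry_perm_def a_def)
  have tail: "spectral n ?\<nu> m = spectral n \<eta> m" if m: "i < m" "m \<le> n" for m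
  proof -
    obtain k where "m = Suc k" using m by (cases m) auto
    thus ?thesis using s\<nu> [of k] m i n by (simp add: spectral_shift s\<kappa> carry_perm_def x_def)
  qed
  have s_low: "spectral n ?\<nu> k = x (cycle_in I k)" if "1 \<le> k" "k < i" for k
    using s\<nu> [of k] that i n by (simp add: spectral_shift s\<kappa> carry_perm_def)
  \<comment> \<open>If I has a second element, x_i is the label of \<nu> at the largest element of I
    below i, whereas q x_a is its label at i. Otherwise a = i, and q is not 1.\<close>
  have ne: "qq * x a \<noteq> x i"
  proof (cases "I = {i}")
    case True
    hence "a = i" using next_in_bounds [of i I 1] i by (simp add: a_def)
    thus ?thesis by (simp add: x_def)
  next
    case False
    let ?m = "Max (I - {i})"
    have fin: "finite (I - {i})" and nonempty: "I - {i} \<noteq> {}" using False i fin_I [OF I] by auto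
    have m: "?m \<in> I - {i}" using fin nonempty by (rule Max_in)
    hence m': "1 \<le> ?m" "?m < i" using Ii by auto
    have nb: "next_in I (Suc ?m) \<in> I" "Suc ?m \<le> next_in I (Suc ?m)"
      using next_in_bounds [OF i(3), of "Suc ?m"] m' by auto
    have "next_in I (Suc ?m) = i"
    proof (rule ccontr)
      assume "next_in I (Suc ?m) \<noteq> i"
      hence "next_in I (Suc ?m) \<le> ?m" using nb fin by (intro Max_ge) auto
      thus False using nb by simp
    qed
    hence "spectral n ?\<nu> ?m = x i" using s_low [OF m'] m by (simp add: cycle_in_def)
    moreover have "spectral n ?\<nu> ?m \<noteq> spectral n ?\<nu> i"
      using spectral_inj [of ?m n i ?\<nu>] m' i by auto
    ultimately show ?thesis using s_i by simp
  qed
  have "upper_coeff n i \<eta> i ?\<nu> = (\<Prod>m\<in>{i<..n}. swap_coeff (x m) (qq * x a)) * upper_coeff n i \<eta> n (comp_shift n \<kappa>)"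
    using upper_coeff_path [OF n \<eta> i(1,2) tail i(2) le_refl] distinct by (simp add: s_i out_eq x_def)
  also have "upper_coeff n i \<eta> n (comp_shift n \<kappa>) = (tt ^ (n - 1) * x a - inverse qq) * lower_coeff n i \<eta> 1 \<kappa>"
    by (simp add: upper_coeff_n [OF n \<eta> i(1,2)] step_raise_shift [OF n] s\<kappa> carry_perm_def a_def)
  also have "lower_coeff n i \<eta> 1 \<kappa> = (\<Prod>k=1..<i. path_weight n \<eta> I k)"
    unfolding \<kappa>_def using i Ii gaps by (intro lower_coeff_value [OF n \<eta> i(1,2)]) auto
  also have "\<dots> = (\<Prod>k\<in>I - {i}. path_weight n \<eta> I k) * (\<Prod>k\<in>{1..<i} - I. path_weight n \<eta> I k)"
  proof -
    have "I - {i} \<subseteq> {1..<i}" using Ii by fastforce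
    moreover have "{1..<i} - (I - {i}) = {1..<i} - I" by auto
    ultimately show ?thesis using prod.subset_diff [of "I - {i}" "{1..<i}" "path_weight n \<eta> I"] by (simp add: mult.commute)
  qed
  also have "(\<Prod>k\<in>I - {i}. path_weight n \<eta> I k) = (\<Prod>k\<in>I - {i}. diag_coeff (x k) (x (next_in I (Suc k))))"
    by (rule prod.cong) (auto simp: path_weight_def [OF n \<eta> i(1,2)] x_def)
  also have "(\<Prod>k\<in>{1..<i} - I. path_weight n \<eta> I k) = (\<Prod>k\<in>{1..<i} - I. swap_coeff (x k) (x (next_in I k)))"
    by (rule prod.cong) (auto simp: path_weight_def [OF n \<eta> i(1,2)] x_def)
  finally have U: "upper_coeff n i \<eta> i ?\<nu> = (\<Prod>m\<in>{i<..n}. swap_coeff (x m) (qq * x a)) * ((tt ^ (n - 1) * x a - inverse qq)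
    * ((\<Prod>k\<in>I - {i}. diag_coeff (x k) (x (next_in I (Suc k))))
    * (\<Prod>k\<in>{1..<i} - I. swap_coeff (x k) (x (next_in I k)))))" .
  have "(qq * x a - x i) * C ?\<nu> = (qq - 1) * upper_coeff n i \<eta> i ?\<nu>"
    using pieri_relation [OF n \<eta> C, of i ?\<nu>] i by (simp add: s_i x_def)
  moreover have "qq * x a - x i \<noteq> 0" using ne by simp
  ultimately have "C ?\<nu> = (qq - 1) / (qq * x a - x i) * upper_coeff n i \<eta> i ?\<nu>"
    by (simp add: nonzero_eq_divide_eq mult.commute)
  thus ?thesis unfolding U by (simp only: ac_simps)
qed

end


section \<open>Inverting \<open>q\<close> and \<open>t\<close>\<close>

locale hom_to_field =
  fixes h :: "'a::comm_ring_1 \<Rightarrow> 'b::field"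
  assumes add: "h (a + b) = h a + h b" and mult: "h (a * b) = h a * h b" and one: "h 1 = 1"
begin

lemma zero [simp]: "h 0 = 0"
proof -
  have "h 0 + h 0 = h 0" using add [of 0 0] unfolding add_0_left by (rule sym)
  thus ?thesis by (simp only: add_cancel_left_left)
qed

lemma uminus: "h (- a) = - h a"
  using add [of a "- a"] by (simp add: eq_neg_iff_add_eq_0 add.commute)

lemma diff: "h (a - b) = h a - h b"
  using add [of a "- b"] by (simp add: uminus)

lemma power: "h (a ^ k) = h a ^ k"
  by (induction k) (simp_all add: one mult)

lemma prod: "h (\<Prod>i\<in>A. f i) = (\<Prod>i\<in>A. h (f i))"
  by (induction A rule: infinite_finite_induct) (simp_all add: one mult)

lemma sum: "h (\<Sum>i\<in>A. f i) = (\<Sum>i\<in>A. h (f i))"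
  by (induction A rule: infinite_finite_induct) (simp_all add: add)

text \<open>Used twice, for the inner variable q and then for the outer variable t, it makes
  \<open>qt_eval\<close> a homomorphism.\<close>

lemma poly_hom: "hom_to_field (\<lambda>p. poly (map_poly h p) x)"
proof
  fix p r :: "'a poly"
  have pCons: "poly (map_poly h (pCons a p)) x = h a + x * poly (map_poly h p) x" for a p
    by (simp add: map_poly_pCons)
  show plus: "poly (map_poly h (p + r)) x = poly (map_poly h p) x + poly (map_poly h r) x" for p r
    by (induction p r rule: poly_induct2) (simp_all add: pCons add algebra_simps)
  have smult: "poly (map_poly h (smult a r)) x = h a * poly (map_poly h r) x" for a r
    by (simp add: map_poly_smult mult)
  show "poly (map_poly h (p * r)) x = poly (map_poly h p) x * poly (map_poly h r) x"
    by (induction p) (simp_all add: pCons plus smult algebra_simps)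
  show "poly (map_poly h 1) x = 1"
    by (simp add: one_pCons pCons one)
qed

end

locale field_hom_to_field = hom_to_field h for h :: "'a::field \<Rightarrow> 'b::field"
begin

lemma inverse: "h (inverse a) = inverse (h a)"
proof (cases "a = 0")
  case False
  hence "h a * h (inverse a) = 1" by (simp add: mult [symmetric] one)
  thus ?thesis by (metis inverse_unique)
qed simp

lemma divide: "h (a / b) = h a / h b"
  by (simp add: divide_inverse mult inverse)

lemma eq_0_iff [simp]: "h a = 0 \<longleftrightarrow> a = 0"
  using mult [of a "inverse a"] one by (cases "a = 0") auto

end

definition const_qt :: "rat \<Rightarrow> qt_field" where
  "const_qt r = Fract [:[:r:]:] 1"

lemma Fract_1_hom: "hom_to_field (\<lambda>p. Fract p 1 :: 'a::idom fract)"
  by standard (simp_all add: One_fract_def)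

lemma const_qt_hom: "hom_to_field const_qt"
  by standard (simp_all add: const_qt_def One_fract_def one_pCons)

lemma inner_hom: "hom_to_field (\<lambda>c. poly (map_poly const_qt c) x)"
  by (rule hom_to_field.poly_hom [OF const_qt_hom])

lemma qt_eval_altdef: "qt_eval p x y = poly (map_poly (\<lambda>c. poly (map_poly const_qt c) x) p) y"
  by (simp add: qt_eval_def const_qt_def [abs_def])

lemma qt_eval_hom: "hom_to_field (\<lambda>p. qt_eval p x y)"
  unfolding qt_eval_altdef by (rule hom_to_field.poly_hom [OF inner_hom])

lemma inner_at_qq: "poly (map_poly const_qt c) qq = Fract [:c:] 1"
proof (induction c)
  case (pCons a c)
  interpret const: hom_to_field const_qt by (rule const_qt_hom)
  have "poly (map_poly const_qt (pCons a c)) qq = const_qt a + qq * poly (map_poly const_qt c) qq"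
    by (simp add: map_poly_pCons)
  also have "\<dots> = Fract [:[:a:]:] 1 + Fract [:[:0, 1:]:] 1 * Fract [:c:] 1"
    by (subst pCons(2)) (simp only: const_qt_def qq_def)
  also have "\<dots> = Fract [:pCons a c:] 1" by simp
  finally show ?case .
qed (simp add: Zero_fract_def)

text \<open>Evaluation at 1 / q becomes, after clearing denominators, evaluation of the reflected
  polynomial at q, and this merely embeds it.\<close>

lemma inner_at_inverse_qq:
  "qq ^ degree c * poly (map_poly const_qt c) (inverse qq) = Fract [:reflect_poly c:] 1"
proof -
  interpret const: hom_to_field const_qt by (rule const_qt_hom)
  have inj: "const_qt r = 0 \<longleftrightarrow> r = 0" for r
    by (simp add: const_qt_def Zero_fract_def eq_fract)
  have deg: "degree (map_poly const_qt c) = degree c"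
    using inj by (intro degree_map_poly) simp
  have "map_poly const_qt (reflect_poly c) = reflect_poly (map_poly const_qt c)"
    by (rule poly_eqI) (simp add: coeff_map_poly coeff_reflect_poly deg)
  hence "Fract [:reflect_poly c:] 1 = poly (reflect_poly (map_poly const_qt c)) qq"
    by (simp add: inner_at_qq [symmetric])
  thus ?thesis by (simp add: poly_reflect_poly_nz deg)
qed

text \<open>Clearing denominators gives a polynomial \<open>r\<close> that represents q^N t^M p(1/q,
  1/t). It is nonzero because its coefficient at t^0 comes from the leading coefficient of p
  alone.\<close>

lemma qt_eval_inverse_neq_0:
  assumes "p \<noteq> 0"
  shows "qt_eval p (inverse qq) (inverse tt) \<noteq> 0"
proof -
  let ?g = "\<lambda>c. poly (map_poly const_qt c) (inverse qq)"
  interpret g: hom_to_field ?g by (rule inner_hom)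
  interpret Fr: hom_to_field "\<lambda>p. Fract p 1 :: qt_field" by (rule Fract_1_hom)
  define M where "M = degree p"
  \<comment> \<open>A common bound for the degrees in q of all coefficients.\<close>
  define N where "N = (\<Sum>k\<le>M. degree (coeff p k))"
  define r where "r = (\<Sum>k\<le>M. monom (monom 1 (N - degree (coeff p k)) * reflect_poly (coeff p k)) (M - k))"
  have N: "degree (coeff p k) \<le> N" if "k \<le> M" for k
    unfolding N_def using that by (intro member_le_sum) auto
  \<comment> \<open>Only k = M reaches t^0, and the reflection of a nonzero polynomial is
    nonzero.\<close>
  have "coeff r 0 = (\<Sum>k\<le>M. if k = M then monom 1 (N - degree (coeff p k)) * reflect_poly (coeff p k) else 0)"
    unfolding r_def coeff_sum by (intro sum.cong) auto
  also have "\<dots> = monom 1 (N - degree (lead_coeff p)) * reflect_poly (lead_coeff p)"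
    by (simp add: M_def)
  also have "\<dots> \<noteq> 0" using assms by (simp add: monom_eq_0_iff)
  finally have "r \<noteq> 0" by auto
  have monom_Fract: "Fract (monom c m) 1 = Fract [:c:] 1 * tt ^ m" for c m
  proof -
    have "monom c m = [:c:] * monom 1 m" by (simp add: smult_monom)
    thus ?thesis using qt_monomial [of 0 m] by (simp add: monom_altdef Fr.mult)
  qed
  have inner_monom: "Fract [:monom 1 m * c:] 1 = qq ^ m * Fract [:c:] 1" for m c
  proof -
    have eq: "[:monom 1 m * c:] = [:monom 1 m:] * [:c:]" by simp
    show ?thesis unfolding eq Fr.mult by (simp add: qq_power monom_altdef)
  qed
  have "Fract r 1 = (\<Sum>k\<le>M. qq ^ N * tt ^ M * (?g (coeff p k) * inverse tt ^ k))"
    unfolding r_def Fr.sum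
  proof (rule sum.cong [OF refl])
    fix k assume "k \<in> {..M}"
    hence k: "k \<le> M" by simp
    have "Fract (monom (monom 1 (N - degree (coeff p k)) * reflect_poly (coeff p k)) (M - k)) 1
      = qq ^ (N - degree (coeff p k)) * (qq ^ degree (coeff p k) * ?g (coeff p k)) * tt ^ (M - k)"
      by (simp only: monom_Fract inner_monom inner_at_inverse_qq)
    also have "\<dots> = qq ^ (N - degree (coeff p k) + degree (coeff p k)) * ?g (coeff p k) * tt ^ (M - k)"
      by (simp only: power_add mult.assoc)
    also have "tt ^ (M - k) = tt ^ M * inverse tt ^ k"
      using k by (simp add: power_diff power_inverse divide_inverse)
    finally show "Fract (monom (monom 1 (N - degree (coeff p k)) * reflect_poly (coeff p k)) (M - k)) 1
      = qq ^ N * tt ^ M * (?g (coeff p k) * inverse tt ^ k)"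
      using N [OF k] by (simp add: ac_simps)
  qed
  also have "\<dots> = qq ^ N * tt ^ M * (\<Sum>k\<le>M. ?g (coeff p k) * inverse tt ^ k)"
    by (simp add: sum_distrib_left)
  also have "(\<Sum>k\<le>M. ?g (coeff p k) * inverse tt ^ k) = qt_eval p (inverse qq) (inverse tt)"
  proof -
    have "degree (map_poly ?g p) \<le> M" 
      by (intro degree_le) (simp add: coeff_map_poly M_def coeff_eq_0)
    hence "poly (map_poly ?g p) (inverse tt) = (\<Sum>k\<le>M. coeff (map_poly ?g p) k * inverse tt ^ k)"
      unfolding poly_altdef by (intro sum.mono_neutral_left) (auto simp: coeff_eq_0)
    thus ?thesis by (simp add: qt_eval_altdef coeff_map_poly)
  qed
  finally have "Fract r 1 = qq ^ N * tt ^ M * qt_eval p (inverse qq) (inverse tt)" .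
  moreover have "Fract r 1 \<noteq> (0 :: qt_field)"
  proof
    assume "Fract r 1 = (0 :: qt_field)"
    hence "Fract r 1 = Fract (0 :: rat poly poly) 1" unfolding Zero_fract_def .
    with eq_fract(1) [of 1 1 r 0] have "r * 1 = 0 * 1" by simp
    thus False using \<open>r \<noteq> 0\<close> by simp
  qed
  ultimately show ?thesis by (metis mult_zero_right)
qed

text \<open>The definition evaluates the normalised fraction. Cross-multiplication admits any other
  representative, since by \<open>qt_eval_inverse_neq_0\<close> no denominator becomes 0.\<close>

lemma invert_qt_Fract:
  assumes "b \<noteq> 0"
  shows "invert_qt (Fract a b) = qt_eval a (inverse qq) (inverse tt) / qt_eval b (inverse qq) (inverse tt)"
proof -
  interpret \<phi>: hom_to_field "\<lambda>p. qt_eval p (inverse qq) (inverse tt)" by (rule qt_eval_hom)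
  obtain c d where cd: "quot_of_fract (Fract a b) = (c, d)" by (cases "quot_of_fract (Fract a b)")
  have "(c, d) \<in> normalized_fracts" unfolding cd [symmetric] by simp
  hence "d \<noteq> 0" by (auto simp: normalized_fracts_def)
  have "Fract c d = Fract a b"
    using quot_to_fract_quot_of_fract [of "Fract a b"] \<open>d \<noteq> 0\<close> unfolding cd by (simp add: quot_to_fract_def)
  hence "c * b = a * d" using assms \<open>d \<noteq> 0\<close> by (simp add: eq_fract)
  hence "qt_eval c (inverse qq) (inverse tt) * qt_eval b (inverse qq) (inverse tt)
    = qt_eval a (inverse qq) (inverse tt) * qt_eval d (inverse qq) (inverse tt)"
    by (simp add: \<phi>.mult [symmetric])
  thus ?thesis
    using qt_eval_inverse_neq_0 [OF assms] qt_eval_inverse_neq_0 [OF \<open>d \<noteq> 0\<close>]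
    by (simp add: invert_qt_def cd frac_eq_eq)
qed

lemma invert_qt_hom: "field_hom_to_field invert_qt"
proof
  interpret \<phi>: hom_to_field "\<lambda>p. qt_eval p (inverse qq) (inverse tt)" by (rule qt_eval_hom)
  fix x y :: qt_field
  obtain a b where x: "x = Fract a b" "b \<noteq> 0" by (cases x)
  obtain c d where y: "y = Fract c d" "d \<noteq> 0" by (cases y)
  note nz = qt_eval_inverse_neq_0 [OF x(2)] qt_eval_inverse_neq_0 [OF y(2)]
  show "invert_qt (x + y) = invert_qt x + invert_qt y"
    using x y nz by (simp add: invert_qt_Fract \<phi>.add \<phi>.mult add_frac_eq)
  show "invert_qt (x * y) = invert_qt x * invert_qt y"
    using x y nz by (simp add: invert_qt_Fract \<phi>.mult)
  show "invert_qt 1 = 1"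
    by (simp add: One_fract_def invert_qt_Fract \<phi>.one)
qed

interpretation inv_qt: field_hom_to_field invert_qt
  by (rule invert_qt_hom)

lemma invert_qt_qq [simp]: "invert_qt qq = inverse qq"
  and invert_qt_tt [simp]: "invert_qt tt = inverse tt"
proof -
  interpret const: hom_to_field const_qt by (rule const_qt_hom)
  interpret \<phi>: hom_to_field "\<lambda>p. qt_eval p (inverse qq) (inverse tt)" by (rule qt_eval_hom)
  interpret g: hom_to_field "\<lambda>c. poly (map_poly const_qt c) (inverse qq)" by (rule inner_hom)
  have "qt_eval [:[:0, 1:]:] (inverse qq) (inverse tt) = inverse qq"
    by (simp add: qt_eval_altdef map_poly_pCons const.one)
  thus "invert_qt qq = inverse qq"
    using invert_qt_Fract [of 1 "[:[:0, 1:]:]", folded qq_def] by (simp add: \<phi>.one)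
  have "qt_eval [:0, 1:] (inverse qq) (inverse tt) = inverse tt"
    by (simp add: qt_eval_altdef map_poly_pCons g.one)
  thus "invert_qt tt = inverse tt"
    using invert_qt_Fract [of 1 "[:0, 1:]", folded tt_def] by (simp add: \<phi>.one)
qed

lemma invert_qt_spectral: "invert_qt (spectral n \<eta> i) = inverse (spectral n \<eta> i)"
  by (simp add: spectral_altdef inv_qt.divide inv_qt.power power_inverse)
     (simp add: divide_inverse mult.commute)

lemma invert_qt_diag_coeff:
  assumes "x \<noteq> 0" "y \<noteq> 0" "invert_qt x = inverse x" "invert_qt y = inverse y"
  shows "invert_qt (diag_coeff x y) = a_hat x y"
proof -
  have "invert_qt (diag_coeff x y) = (inverse tt - 1) * inverse y / (inverse tt * (inverse x - inverse y))"
    by (simp add: diag_coeff_def inv_qt.divide inv_qt.mult inv_qt.diff inv_qt.one assms(3,4))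
  also have "\<dots> = a_hat x y"
  proof (cases "x = y")
    case False
    hence "x - y \<noteq> 0" "y - x \<noteq> 0" by simp_all
    thus ?thesis using assms(1,2) unfolding a_hat_def by (simp add: divide_simps) (simp add: algebra_simps)
  \<comment> \<open>For x = y both sides are 0 by the convention for division by 0.\<close>
  qed (simp add: a_hat_def)
  finally show ?thesis .
qed

lemma invert_qt_swap_coeff:
  assumes "x \<noteq> 0" "y \<noteq> 0" "invert_qt x = inverse x" "invert_qt y = inverse y"
  shows "invert_qt (swap_coeff x y) = b_hat y x"
proof -
  have "invert_qt (swap_coeff x y) = (inverse tt * inverse x - inverse y) / (inverse tt * (inverse x - inverse y))"
    by (simp add: swap_coeff_def inv_qt.divide inv_qt.mult inv_qt.diff inv_qt.one assms(3,4))
  also have "\<dots> = b_hat y x"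
  proof (cases "x = y")
    case False
    hence "x - y \<noteq> 0" "y - x \<noteq> 0" by simp_all
    thus ?thesis using assms(1,2) unfolding b_hat_def by (simp add: divide_simps)
  qed (simp add: b_hat_def)
  finally show ?thesis .
qed

lemma invert_qt_norm_factor: "invert_qt (norm_factor n \<eta>) = inverse tt ^ total_leg n \<eta> * d_prime n \<eta>"
proof -
  have "invert_qt (cell_factor n \<eta> i j) = inverse tt ^ leg n \<eta> i j * (1 - qq ^ (arm \<eta> i j + 1) * tt ^ leg n \<eta> i j)" for i j
  proof -
    have "invert_qt (cell_factor n \<eta> i j) = inverse tt ^ leg n \<eta> i j - qq ^ Suc (arm \<eta> i j)"
      by (simp add: cell_factor_def inv_qt.diff inv_qt.power inv_qt.inverse inv_qt.mult)
    also have "qq ^ Suc (arm \<eta> i j) = inverse tt ^ leg n \<eta> i j * (qq ^ (arm \<eta> i j + 1) * tt ^ leg n \<eta> i j)"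
      by (simp add: power_inverse divide_simps power_add)
    finally show ?thesis by (simp add: right_diff_distrib)
  qed
  thus ?thesis
    by (simp add: norm_factor_def inv_qt.prod prod.distrib total_leg_def d_prime_def power_sum)
qed

lemma lookup_map_invert: "lookup (Poly_Mapping.map invert_qt f) \<mu> = invert_qt (lookup f \<mu>)"
  by (simp add: Poly_Mapping.map.rep_eq when_def)

lemma map_invert_add: "Poly_Mapping.map invert_qt (f + g) = Poly_Mapping.map invert_qt f + Poly_Mapping.map invert_qt g"
  by (rule poly_mapping_eqI) (simp only: lookup_add lookup_map_invert inv_qt.add)

lemma map_invert_sum: "Poly_Mapping.map invert_qt (\<Sum>k\<in>A. h k) = (\<Sum>k\<in>A. Poly_Mapping.map invert_qt (h k))"
  by (rule poly_mapping_eqI) (simp only: lookup_sum lookup_map_invert inv_qt.sum)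

lemma map_invert_Const: "Poly_Mapping.map invert_qt (Const c * f) = Const (invert_qt c) * Poly_Mapping.map invert_qt f"
  by (rule poly_mapping_eqI) (simp only: lookup_Const_mult lookup_map_invert inv_qt.mult)

lemma map_invert_single: "Poly_Mapping.map invert_qt (single \<mu> c) = single \<mu> (invert_qt c)"
  by (rule poly_mapping_eqI) (simp add: lookup_map_invert lookup_single when_def)

lemma map_invert_mult: "Poly_Mapping.map invert_qt (f * g) = Poly_Mapping.map invert_qt f * Poly_Mapping.map invert_qt g"
  for f g :: mpoly
proof (induction f rule: mpoly_induct)
  case (monomial \<mu> c)
  show ?case
  proof (induction g rule: mpoly_induct)
    case (monomial \<nu> d)
    show ?case by (simp add: mult_single map_invert_single inv_qt.mult)
  qed (simp add: distrib_left map_invert_add)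
qed (simp add: distrib_right map_invert_add)


section \<open>The generating series\<close>

lemma Sum_any_shift:
  fixes g :: mseries and l q :: expo
  shows "(\<Sum>r. (g r when l + q = l + r)) = g q"
proof -
  have "(g r when l + q = l + r) = (g q when r = q)" for r by (auto simp: when_def)
  thus ?thesis by simp
qed

lemma Sum_any_no_shift:
  fixes g :: mseries
  assumes "\<nexists>q. k = l + q \<and> g q \<noteq> 0"
  shows "(\<Sum>q. (g q when k = l + q)) = 0"
proof -
  have "(g q when k = l + q) = 0" for q using assms by (auto simp: when_def)
  thus ?thesis by simp
qed

text \<open>As g is free of the i-th variable, the only contributing decomposition gives its whole
  power to the first factor.\<close>

lemma prod_fun_series_in_var:
  fixes g :: mseries
  assumes g: "\<And>q. g q \<noteq> 0 \<Longrightarrow> lookup q i = 0"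
  shows "prod_fun (series_in_var S i) g \<mu> = fps_nth S (lookup \<mu> i) * g (\<mu> - single i (lookup \<mu> i))"
proof -
  let ?l = "single i (lookup \<mu> i)"
  have split: "\<mu> = ?l + (\<mu> - ?l)"
    by (rule poly_mapping_eqI) (auto simp: lookup_add lookup_minus lookup_single when_def)
  have "series_in_var S i l * (\<Sum>q. (g q when \<mu> = l + q))
      = (fps_nth S (lookup \<mu> i) * g (\<mu> - ?l) when l = ?l)" for l
  proof (cases "l = ?l")
    case True
    have "(\<Sum>q. (g q when \<mu> = ?l + q)) = g (\<mu> - ?l)"
      using Sum_any_shift [of g ?l "\<mu> - ?l"] unfolding split [symmetric] .
    moreover have "keys ?l \<subseteq> {i}" by simp
    ultimately show ?thesis using True by (simp add: series_in_var_def)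
  next
    case False
    have "\<nexists>q. \<mu> = l + q \<and> g q \<noteq> 0" if "keys l \<subseteq> {i}"
    proof
      assume "\<exists>q. \<mu> = l + q \<and> g q \<noteq> 0"
      then obtain q where q: "\<mu> = l + q" "g q \<noteq> 0" by blast
      have "l = ?l"
      proof (rule poly_mapping_eqI)
        fix k
        show "lookup l k = lookup ?l k"
        proof (cases "k = i")
          case True
          thus ?thesis using q(1) g [OF q(2)] by (simp add: lookup_add)
        next
          case False
          hence "k \<notin> keys l" using that by auto
          thus ?thesis using False by (simp add: in_keys_iff lookup_single_not_eq)
        qed
      qed
      thus False using False by simp
    qed
    thus ?thesis using False Sum_any_no_shift [of \<mu> l g] by (auto simp: series_in_var_def)
  qed
  thus ?thesis by (simp add: prod_fun_def)
qed

lemma foldr_series_in_var: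
  assumes "distinct xs"
  shows "foldr prod_fun (map (series_in_var S) xs) (lookup (1 :: mpoly)) \<mu>
    = (if keys \<mu> \<subseteq> set xs then \<Prod>i\<in>set xs. fps_nth S (lookup \<mu> i) else 0)"
  using assms
proof (induction xs arbitrary: \<mu>)
  case Nil
  show ?case by (simp add: lookup_one when_def)
next
  case (Cons a xs)
  let ?g = "foldr prod_fun (map (series_in_var S) xs) (lookup (1 :: mpoly))"
  have g: "?g q = (if keys q \<subseteq> set xs then \<Prod>i\<in>set xs. fps_nth S (lookup q i) else 0)" for q
    using Cons by simp
  have "lookup q a = 0" if "?g q \<noteq> 0" for q
    using that Cons.prems by (auto simp: g in_keys_iff split: if_splits)
  hence "foldr prod_fun (map (series_in_var S) (a # xs)) (lookup (1 :: mpoly)) \<mu>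
     = fps_nth S (lookup \<mu> a) * ?g (\<mu> - single a (lookup \<mu> a))"
    by (simp add: prod_fun_series_in_var)
  moreover have rest: "lookup (\<mu> - single a (lookup \<mu> a)) i = (if i = a then 0 else lookup \<mu> i)" for i
    by (simp add: lookup_minus lookup_single when_def)
  moreover have "keys (\<mu> - single a (lookup \<mu> a)) \<subseteq> set xs \<longleftrightarrow> keys \<mu> \<subseteq> set (a # xs)"
  proof -
    have "keys (\<mu> - single a (lookup \<mu> a)) = keys \<mu> - {a}"
      by (rule set_eqI) (simp add: in_keys_iff rest)
    thus ?thesis by auto
  qed
  moreover have "(\<Prod>i\<in>set xs. fps_nth S (if i = a then 0 else lookup \<mu> i)) = (\<Prod>i\<in>set xs. fps_nth S (lookup \<mu> i))"
    using Cons.prems by (intro prod.cong) auto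
  ultimately show ?case using Cons.prems by (simp add: g)
qed

lemma prod_inv_qpoch_eq:
  "prod_inv_qpoch n \<mu> = (if composition n \<mu> then \<Prod>i=1..n. fps_nth inv_qpoch (lookup \<mu> i) else 0)"
proof -
  have "set [1..<Suc n] = {1..n}" by auto
  thus ?thesis unfolding prod_inv_qpoch_def composition_def
    by (subst foldr_series_in_var) simp_all
qed

lemma csize_1_obtain:
  assumes "composition n q" "csize n q = 1"
  obtains i where "i \<in> {1..n}" "q = single i 1"
proof -
  from assms(2) have "(\<Sum>i=1..n. lookup q i) \<noteq> 0" by (simp add: csize_def)
  then obtain i where i: "i \<in> {1..n}" "lookup q i \<noteq> 0" by (rule sum.not_neutral_contains_not_neutral)
  have "lookup q i + (\<Sum>j\<in>{1..n} - {i}. lookup q j) = 1"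
    using assms(2) sum.remove [of "{1..n}" i "lookup q"] i by (simp add: csize_def)
  hence 1: "lookup q i = 1" "(\<Sum>j\<in>{1..n} - {i}. lookup q j) = 0" using i(2) by linarith+
  have "q = single i 1"
  proof (rule composition_eqI [OF assms(1) composition_single [OF i(1)]])
    fix j assume "j \<in> {1..n}"
    thus "lookup q j = lookup (single i 1) j"
      using 1 by (cases "j = i") (auto simp: lookup_single_not_eq)
  qed
  with i show ?thesis by (intro that)
qed

lemma composition_add_iff: "composition n (\<mu> + \<nu>) \<longleftrightarrow> composition n \<mu> \<and> composition n \<nu>"
proof
  assume "composition n (\<mu> + \<nu>)"
  hence "k \<in> {1..n}" if "lookup \<mu> k > 0 \<or> lookup \<nu> k > 0" for k
    using that by (intro composition_support [of n "\<mu> + \<nu>" k]) (auto simp: lookup_add)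
  thus "composition n \<mu> \<and> composition n \<nu>" by (blast intro: compositionI)
qed (simp add: composition_add)

lemma lookup_var_sum:
  assumes "1 \<le> n" "i \<in> {1..n}"
  shows "lookup (var_sum n) (single i 1) = 1"
proof -
  have "lookup (var_sum n) (single i 1) = (\<Sum>k=1..n. if k = i then 1 else 0)"
    unfolding var_sum_def [OF assms(1)] lookup_sum
  proof (rule sum.cong [OF refl])
    fix k
    have "single k (1::nat) = single i 1 \<longleftrightarrow> k = i" by (metis lookup_single_eq lookup_single_not_eq zero_neq_one)
    thus "lookup (Var k) (single i 1) = (if k = i then 1 else 0)" by (simp add: lookup_single when_def)
  qed
  thus ?thesis using assms(2) by simp
qed

lemma generating_series_support:
  assumes P: "homogeneous n d P" and nz: "prod_fun (lookup P) (prod_inv_qpoch n) \<mu> \<noteq> 0"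
  shows "composition n \<mu>"
proof -
  from nz obtain l where l: "lookup P l * (\<Sum>q. (prod_inv_qpoch n q when \<mu> = l + q)) \<noteq> 0"
    unfolding prod_fun_def by (rule Sum_any.not_neutral_obtains_not_neutral)
  then obtain q where "\<mu> = l + q" "prod_inv_qpoch n q \<noteq> 0"
    using Sum_any_no_shift [of \<mu> l "prod_inv_qpoch n"] by auto
  moreover have "composition n l" using P l by (auto simp: homogeneous_def comps_def)
  ultimately show ?thesis by (auto simp: prod_inv_qpoch_eq composition_add_iff split: if_splits)
qed

text \<open>P is homogeneous of degree d, so in degree d + 1 only the linear part of the product of
  the q-series contributes, and that is e_1 / (1 - q).\<close>

lemma generating_series_next:
  assumes n: "1 \<le> n" and P: "homogeneous n d P" and \<mu>: "\<mu> \<in> comps n (Suc d)"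
  shows "prod_fun (lookup P) (prod_inv_qpoch n) \<mu> = lookup (Const (1 / (1 - qq)) * (var_sum n * P)) \<mu>"
proof -
  let ?H = "Const (1 / (1 - qq)) * var_sum n"
  have "lookup P l * (\<Sum>q. (prod_inv_qpoch n q when \<mu> = l + q)) = lookup P l * (\<Sum>q. (lookup ?H q when \<mu> = l + q))" for l
  proof (cases "lookup P l = 0")
    case False
    hence l: "composition n l" "csize n l = d" using P by (auto simp: homogeneous_def comps_def)
    have "(prod_inv_qpoch n q when \<mu> = l + q) = (lookup ?H q when \<mu> = l + q)" for q
    proof (cases "\<mu> = l + q")
      case True
      hence q: "composition n q" "csize n q = 1"
        using \<mu> l by (auto simp: comps_def csize_add composition_add_iff)
      then obtain i where i: "i \<in> {1..n}" "q = single i 1" by (rule csize_1_obtain)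
      have "prod_inv_qpoch n q = (\<Prod>k=1..n. fps_nth inv_qpoch (lookup q k))"
        using q by (simp add: prod_inv_qpoch_eq)
      also have "\<dots> = (\<Prod>k=1..n. if k = i then 1 / (1 - qq) else 1)"
        by (rule prod.cong) (auto simp: i(2) inv_qpoch_def lookup_single when_def)
      also have "\<dots> = 1 / (1 - qq)" using i(1) by simp
      finally show ?thesis using i n by (simp add: lookup_Const_mult lookup_var_sum)
    qed simp
    thus ?thesis by simp
  qed simp
  hence "prod_fun (lookup P) (prod_inv_qpoch n) \<mu> = prod_fun (lookup P) (lookup ?H) \<mu>"
    unfolding prod_fun_def by (simp only:)
  also have "\<dots> = lookup (P * ?H) \<mu>" by (simp add: times_poly_mapping.rep_eq)
  finally show ?thesis by (simp add: ac_simps)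
qed

text \<open>Only \<nu> of the size of \<mu> contribute to the coefficient at \<mu>, so all sums are
  finite and the identity of series splits into its homogeneous degrees.\<close>

lemma triangular_series:
  fixes G :: mseries and e :: "expo \<Rightarrow> mpoly"
  assumes tri: "triangular n e" and G: "\<And>\<mu>. G \<mu> \<noteq> 0 \<Longrightarrow> composition n \<mu>"
  shows "series_sums (\<lambda>\<nu> \<mu>. c \<nu> * lookup (e \<nu>) \<mu>) {\<nu>. composition n \<nu>} G
    \<longleftrightarrow> (\<forall>d. \<forall>\<mu>\<in>comps n d. G \<mu> = lookup (\<Sum>\<nu>\<in>comps n d. Const (c \<nu>) * e \<nu>) \<mu>)"
proof -
  have supp: "{\<nu>\<in>{\<nu>. composition n \<nu>}. c \<nu> * lookup (e \<nu>) \<mu> \<noteq> 0} \<subseteq> (if composition n \<mu> then comps n (csize n \<mu>) else {})" for \<mu>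
  proof
    fix \<nu> assume "\<nu> \<in> {\<nu>\<in>{\<nu>. composition n \<nu>}. c \<nu> * lookup (e \<nu>) \<mu> \<noteq> 0}"
    hence "composition n \<nu>" "lookup (e \<nu>) \<mu> \<noteq> 0" by simp_all
    hence "rank_le n \<mu> \<nu>" using tri unfolding triangular_def by blast
    thus "\<nu> \<in> (if composition n \<mu> then comps n (csize n \<mu>) else {})"
      by (simp add: rank_le_def comps_def)
  qed
  have fin: "finite {\<nu>\<in>{\<nu>. composition n \<nu>}. c \<nu> * lookup (e \<nu>) \<mu> \<noteq> 0}" for \<mu>
    by (rule finite_subset [OF supp]) simp
  have sum: "(\<Sum>\<nu>\<in>{\<nu>\<in>{\<nu>. composition n \<nu>}. c \<nu> * lookup (e \<nu>) \<mu> \<noteq> 0}. c \<nu> * lookup (e \<nu>) \<mu>)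
     = (if composition n \<mu> then lookup (\<Sum>\<nu>\<in>comps n (csize n \<mu>). Const (c \<nu>) * e \<nu>) \<mu> else 0)" for \<mu>
  proof (cases "composition n \<mu>")
    case True
    have "(\<Sum>\<nu>\<in>{\<nu>\<in>{\<nu>. composition n \<nu>}. c \<nu> * lookup (e \<nu>) \<mu> \<noteq> 0}. c \<nu> * lookup (e \<nu>) \<mu>)
      = (\<Sum>\<nu>\<in>comps n (csize n \<mu>). c \<nu> * lookup (e \<nu>) \<mu>)"
    proof (rule sum.mono_neutral_left [OF finite_comps])
      show "{\<nu>\<in>{\<nu>. composition n \<nu>}. c \<nu> * lookup (e \<nu>) \<mu> \<noteq> 0} \<subseteq> comps n (csize n \<mu>)"
        using supp [of \<mu>] True by simp
    qed (auto simp: comps_def)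
    thus ?thesis using True by (simp add: lookup_sum lookup_Const_mult)
  next
    case False
    hence "{\<nu>\<in>{\<nu>. composition n \<nu>}. c \<nu> * lookup (e \<nu>) \<mu> \<noteq> 0} = {}" using supp [of \<mu>] by simp
    thus ?thesis using False by (simp only: sum.empty if_False)
  qed
  have "series_sums (\<lambda>\<nu> \<mu>. c \<nu> * lookup (e \<nu>) \<mu>) {\<nu>. composition n \<nu>} G
    \<longleftrightarrow> (\<forall>\<mu>. G \<mu> = (if composition n \<mu> then lookup (\<Sum>\<nu>\<in>comps n (csize n \<mu>). Const (c \<nu>) * e \<nu>) \<mu> else 0))"
    unfolding series_sums_def sum by (simp only: fin simp_thms)
  also have "\<dots> \<longleftrightarrow> (\<forall>\<mu>. composition n \<mu> \<longrightarrow> G \<mu> = lookup (\<Sum>\<nu>\<in>comps n (csize n \<mu>). Const (c \<nu>) * e \<nu>) \<mu>)"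
  proof (rule iff_allI)
    fix \<mu>
    show "G \<mu> = (if composition n \<mu> then lookup (\<Sum>\<nu>\<in>comps n (csize n \<mu>). Const (c \<nu>) * e \<nu>) \<mu> else 0)
      \<longleftrightarrow> (composition n \<mu> \<longrightarrow> G \<mu> = lookup (\<Sum>\<nu>\<in>comps n (csize n \<mu>). Const (c \<nu>) * e \<nu>) \<mu>)"
      using G [of \<mu>] by (cases "composition n \<mu>") (simp_all only: if_True if_False simp_thms, blast)
  qed
  finally show ?thesis by (auto simp: comps_def)
qed

definition series_part :: "nat \<Rightarrow> mseries \<Rightarrow> nat \<Rightarrow> mpoly" where
  "series_part n G d = (\<Sum>\<mu>\<in>comps n d. single \<mu> (G \<mu>))"

lemma lookup_series_part: "lookup (series_part n G d) \<mu> = (if \<mu> \<in> comps n d then G \<mu> else 0)"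
  by (simp add: series_part_def lookup_sum lookup_single when_def sum.delta')

lemma triangular_expansion:
  assumes "triangular n e" and G: "\<And>\<mu>. G \<mu> \<noteq> 0 \<Longrightarrow> composition n \<mu>"
  shows "series_sums (\<lambda>\<nu> \<mu>. c \<nu> * lookup (e \<nu>) \<mu>) {\<nu>. composition n \<nu>} G
    \<longleftrightarrow> (\<forall>d. series_part n G d = (\<Sum>\<nu>\<in>comps n d. Const (c \<nu>) * e \<nu>))"
proof -
  have part: "(\<forall>\<mu>\<in>comps n d. G \<mu> = lookup (\<Sum>\<nu>\<in>comps n d. Const (c \<nu>) * e \<nu>) \<mu>)
    \<longleftrightarrow> series_part n G d = (\<Sum>\<nu>\<in>comps n d. Const (c \<nu>) * e \<nu>)"
    (is "_ \<longleftrightarrow> _ = ?S") for d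
  proof -
    have hom: "homogeneous n d (\<Sum>\<nu>\<in>comps n d. Const (c \<nu>) * e \<nu>)"
      by (intro homogeneous_sum homogeneous_Const triangular_homogeneous [OF assms(1)])
    show ?thesis
    proof
      assume L: "\<forall>\<mu>\<in>comps n d. G \<mu> = lookup ?S \<mu>"
      show "series_part n G d = ?S"
      proof (rule poly_mapping_eqI)
        fix \<mu>
        show "lookup (series_part n G d) \<mu> = lookup ?S \<mu>"
        proof (cases "\<mu> \<in> comps n d")
          case True
          from bspec [OF L True] show ?thesis by (simp only: lookup_series_part True if_True)
        next
          case False
          hence "lookup ?S \<mu> = 0" using hom unfolding homogeneous_def by blast
          thus ?thesis by (simp only: lookup_series_part False if_False)
        qed
      qed
    next
      assume eq: "series_part n G d = ?S"
      show "\<forall>\<mu>\<in>comps n d. G \<mu> = lookup ?S \<mu>"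
      proof
        fix \<mu> assume "\<mu> \<in> comps n d"
        thus "G \<mu> = lookup ?S \<mu>"
          unfolding eq [symmetric] by (simp only: lookup_series_part if_True)
      qed
    qed
  qed
  show ?thesis unfolding part [symmetric] by (rule triangular_series [OF assms])
qed


section \<open>The binomial coefficients of consecutive degrees\<close>

lemma qt_binomial_eq:
  assumes n: "1 \<le> n" and \<eta>: "composition n \<eta>"
    and C: "expands n (Suc (csize n \<eta>)) (var_sum n * macdonald_F n \<eta>) C"
    and \<nu>: "\<nu> \<in> comps n (Suc (csize n \<eta>))"
  shows "qt_binomial n \<nu> \<eta> = invert_qt (C \<nu>) / (1 - qq)"
proof -
  define w where "w \<nu> = tt powi (int (total_leg n \<nu>) - int (total_leg n \<eta>)) * (d_prime n \<eta> / d_prime n \<nu>)" for \<nu>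
  define e where "e \<nu> = Const (w \<nu>) * macdonald_E_inv n \<nu>" for \<nu>
  let ?N = "norm_factor n" and ?G = "prod_fun (lookup (macdonald_E_inv n \<eta>)) (prod_inv_qpoch n)"
  let ?d = "Suc (csize n \<eta>)"
  \<comment> \<open>The norm factor was chosen so that the weight of the defining identity arises by
    inverting a ratio of norms; up to a common factor, the series is thus expanded in the inverted
    F.\<close>
  have w: "w \<nu> = invert_qt (?N \<eta> / ?N \<nu>)" for \<nu>
    unfolding w_def inv_qt.divide invert_qt_norm_factor
    by (simp add: power_int_diff power_inverse divide_inverse ac_simps)
  have w0: "w \<nu> \<noteq> 0" for \<nu> unfolding w by simp
  have Einv: "lookup (macdonald_E_inv n \<nu>) \<mu> = invert_qt (lookup (macdonald_E n \<nu>) \<mu>)" for \<nu> \<mu>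
    by (simp add: macdonald_E_inv_def lookup_map_invert)
  have tri: "triangular n e"
    using triangular_E [OF n] w0 by (simp add: triangular_def e_def lookup_Const_mult Einv)
  have hom: "homogeneous n (csize n \<eta>) (macdonald_E_inv n \<eta>)"
    using homogeneous_E [OF n \<eta>] by (simp add: homogeneous_def Einv)
  have G: "?G \<mu> \<noteq> 0 \<Longrightarrow> composition n \<mu>" for \<mu>
    by (rule generating_series_support [OF hom])
  have binomials: "is_qt_binomials n \<eta> c \<longleftrightarrow> (\<forall>d. series_part n ?G d = (\<Sum>\<nu>\<in>comps n d. Const (c \<nu>) * e \<nu>))" for c
  proof -
    have "is_qt_binomials n \<eta> c \<longleftrightarrow> series_sums (\<lambda>\<nu> \<mu>. c \<nu> * lookup (e \<nu>) \<mu>) {\<nu>. composition n \<nu>} ?G"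
      unfolding is_qt_binomials_def e_def lookup_Const_mult w_def by (simp only: mult.assoc)
    also have "\<dots> \<longleftrightarrow> (\<forall>d. series_part n ?G d = (\<Sum>\<nu>\<in>comps n d. Const (c \<nu>) * e \<nu>))"
      by (rule triangular_expansion [OF tri G])
    finally show ?thesis .
  qed
  \<comment> \<open>Coefficients are found degree by degree. Every composition belongs to one
    degree, so they combine to one function, set to 0 off compositions as the normalisation
    demands.\<close>
  have "\<exists>c. \<forall>d. series_part n ?G d = (\<Sum>\<nu>\<in>comps n d. Const (c d \<nu>) * e \<nu>)"
  proof (rule choice, rule allI)
    fix d
    have "homogeneous n d (series_part n ?G d)"
      by (simp add: homogeneous_def lookup_series_part)
    thus "\<exists>c. series_part n ?G d = (\<Sum>\<nu>\<in>comps n d. Const (c \<nu>) * e \<nu>)"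
      by (rule triangular_spans [OF tri])
  qed
  then obtain c0 where c0: "\<And>d. series_part n ?G d = (\<Sum>\<nu>\<in>comps n d. Const (c0 d \<nu>) * e \<nu>)" by blast
  define c where "c \<nu> = (if composition n \<nu> then c0 (csize n \<nu>) \<nu> else 0)" for \<nu>
  have c: "series_part n ?G d = (\<Sum>\<nu>\<in>comps n d. Const (c \<nu>) * e \<nu>)" for d
    unfolding c0 by (rule sum.cong) (auto simp: c_def comps_def)
  have "(THE c. is_qt_binomials n \<eta> c \<and> (\<forall>\<nu>. \<not> composition n \<nu> \<longrightarrow> c \<nu> = 0)) = c"
  proof (rule the_equality)
    show "is_qt_binomials n \<eta> c \<and> (\<forall>\<nu>. \<not> composition n \<nu> \<longrightarrow> c \<nu> = 0)"
      unfolding binomials using c by (simp add: c_def)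
  next
    fix c' assume c': "is_qt_binomials n \<eta> c' \<and> (\<forall>\<nu>. \<not> composition n \<nu> \<longrightarrow> c' \<nu> = 0)"
    show "c' = c"
    proof
      fix \<nu>
      show "c' \<nu> = c \<nu>"
      proof (cases "composition n \<nu>")
        case True
        have "(\<Sum>\<nu>\<in>comps n (csize n \<nu>). Const (c' \<nu>) * e \<nu>) = (\<Sum>\<nu>\<in>comps n (csize n \<nu>). Const (c \<nu>) * e \<nu>)"
          by (rule conjunct1 [OF c' [unfolded binomials c], THEN spec, symmetric])
        thus ?thesis by (rule triangular_unique [OF tri]) (simp add: comps_def True)
      qed (use c' in \<open>simp add: c_def\<close>)
    qed
  qed
  hence binom: "qt_binomial n \<nu> \<eta> = c \<nu>" by (simp add: qt_binomial_def)
  have inv_var_sum: "Poly_Mapping.map invert_qt (var_sum n) = var_sum n"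
    unfolding var_sum_def [OF n] map_invert_sum map_invert_single inv_qt.one ..
  have inv_F: "Poly_Mapping.map invert_qt (macdonald_F n \<mu>) = Const (inverse (invert_qt (?N \<mu>))) * macdonald_E_inv n \<mu>" for \<mu>
    by (simp add: macdonald_F_def [OF n] map_invert_Const inv_qt.inverse macdonald_E_inv_def)
  have "var_sum n * macdonald_F n \<eta> = (\<Sum>\<nu>\<in>comps n ?d. Const (C \<nu>) * macdonald_F n \<nu>)"
    using C by (simp add: expands_def [OF n])
  \<comment> \<open>The Pieri expansion is inverted coefficientwise; e_1 has coefficients 1 and
    stays as it is.\<close>
  from arg_cong [OF this, of "Poly_Mapping.map invert_qt"]
  have "var_sum n * (Const (inverse (invert_qt (?N \<eta>))) * macdonald_E_inv n \<eta>)
     = (\<Sum>\<nu>\<in>comps n ?d. Const (invert_qt (C \<nu>)) * (Const (inverse (invert_qt (?N \<nu>))) * macdonald_E_inv n \<nu>))"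
    by (simp only: map_invert_mult map_invert_sum map_invert_single inv_var_sum inv_F)
  note F_inv = this
  have "Const (invert_qt (?N \<eta>) / (1 - qq)) * (var_sum n * (Const (inverse (invert_qt (?N \<eta>))) * macdonald_E_inv n \<eta>))
     = (\<Sum>\<nu>\<in>comps n ?d. Const (invert_qt (C \<nu>) / (1 - qq)) * e \<nu>)"
  proof -
    have w': "w \<nu> = invert_qt (?N \<eta>) * inverse (invert_qt (?N \<nu>))" for \<nu>
      unfolding w inv_qt.divide by (rule divide_inverse)
    show ?thesis
      unfolding F_inv by (simp only: sum_distrib_left e_def w' divide_inverse Const_mult) (simp only: ac_simps)
  qed
  moreover have "Const (invert_qt (?N \<eta>) / (1 - qq)) * (var_sum n * (Const (inverse (invert_qt (?N \<eta>))) * macdonald_E_inv n \<eta>))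
     = Const (1 / (1 - qq)) * (var_sum n * macdonald_E_inv n \<eta>)"
  proof -
    have "Const (invert_qt (?N \<eta>) / (1 - qq)) * (var_sum n * (Const (inverse (invert_qt (?N \<eta>))) * macdonald_E_inv n \<eta>))
      = Const (invert_qt (?N \<eta>) / (1 - qq) * inverse (invert_qt (?N \<eta>))) * (var_sum n * macdonald_E_inv n \<eta>)"
      by (simp only: Const_mult) (simp only: ac_simps)
    also have "invert_qt (?N \<eta>) / (1 - qq) * inverse (invert_qt (?N \<eta>)) = 1 / (1 - qq)"
      by (simp add: divide_inverse)
    finally show ?thesis .
  qed
  ultimately have next_part: "Const (1 / (1 - qq)) * (var_sum n * macdonald_E_inv n \<eta>)
     = (\<Sum>\<nu>\<in>comps n ?d. Const (invert_qt (C \<nu>) / (1 - qq)) * e \<nu>)" by simp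
  have "series_part n ?G ?d = Const (1 / (1 - qq)) * (var_sum n * macdonald_E_inv n \<eta>)" (is "_ = ?R")
  proof (rule poly_mapping_eqI)
    fix \<mu>
    have "homogeneous n ?d ?R" by (intro homogeneous_Const homogeneous_var_sum n hom)
    hence out: "\<mu> \<notin> comps n ?d \<Longrightarrow> lookup ?R \<mu> = 0" unfolding homogeneous_def by blast
    show "lookup (series_part n ?G ?d) \<mu> = lookup ?R \<mu>"
    proof (cases "\<mu> \<in> comps n ?d")
      case True
      thus ?thesis by (simp only: lookup_series_part if_True generating_series_next [OF n hom])
    next
      case False
      thus ?thesis by (simp only: lookup_series_part if_False out [OF False])
    qed
  qed
  hence "(\<Sum>\<nu>\<in>comps n ?d. Const (c \<nu>) * e \<nu>) = (\<Sum>\<nu>\<in>comps n ?d. Const (invert_qt (C \<nu>) / (1 - qq)) * e \<nu>)"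
    unfolding next_part [symmetric] c [symmetric] .
  from triangular_unique [OF tri this \<nu>] show ?thesis unfolding binom .
qed

theorem proposition9:
  fixes n :: nat and \<eta> \<nu> :: "nat \<Rightarrow>\<^sub>0 nat"
  assumes "n \<ge> 1"
    and "composition n \<eta>" and "composition n \<nu>"
    and "csize n \<nu> = csize n \<eta> + 1"
  shows "(\<forall>I. maximal_set n \<eta> I \<and> \<nu> = c_set I \<eta> \<longrightarrow>
            qt_binomial n \<nu> \<eta>
              = - (A_fun I (spectral n \<eta>) * B_tilde n I (spectral n \<eta>)) / (tt - 1)) \<and>
         ((\<nexists>I. maximal_set n \<eta> I \<and> \<nu> = c_set I \<eta>) \<longrightarrow> qt_binomial n \<nu> \<eta> = 0)"
proof -
  note n = assms(1) and \<eta> = assms(2)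
  let ?x = "spectral n \<eta>"
  have "homogeneous n (Suc (csize n \<eta>)) (var_sum n * macdonald_F n \<eta>)"
    unfolding macdonald_F_def [OF n] using n \<eta> by (intro homogeneous_var_sum homogeneous_Const homogeneous_E)
  with n obtain C where C: "expands n (Suc (csize n \<eta>)) (var_sum n * macdonald_F n \<eta>) C"
    by (rule expands_exists)
  have "\<nu> \<in> comps n (Suc (csize n \<eta>))" using assms by (simp add: comps_def)
  note binom = qt_binomial_eq [OF n \<eta> C this]
  have "qt_binomial n \<nu> \<eta> = - (A_fun I ?x * B_tilde n I ?x) / (tt - 1)"
    if max: "maximal_set n \<eta> I" and \<nu>: "\<nu> = c_set I \<eta>" for I
  proof -
    have I: "I \<noteq> {}" "I \<subseteq> {1..n}" using max by (simp_all add: maximal_set_def)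
    define i a where "i = Max I" and "a = next_in I 1"
    define A where "A = (\<Prod>k\<in>I - {i}. a_hat (?x k) (?x (next_in I (Suc k))))"
    define B where "B = (\<Prod>k\<in>{1..<i} - I. b_hat (?x (next_in I k)) (?x k))"
    define B' where "B' = (\<Prod>m\<in>{i<..n}. b_hat (qq * ?x a) (?x m))"
    define T where "T = inverse tt ^ (n - 1)"
    have inv_qx: "invert_qt (qq * ?x a) = inverse (qq * ?x a)"
      by (simp add: inv_qt.mult invert_qt_spectral)
    define P where "P = (\<Prod>k\<in>I - {i}. diag_coeff (?x k) (?x (next_in I (Suc k))))"
    define Q where "Q = (\<Prod>k\<in>{1..<i} - I. swap_coeff (?x k) (?x (next_in I k)))"
    define Q' where "Q' = (\<Prod>m\<in>{i<..n}. swap_coeff (?x m) (qq * ?x a))"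
    define R where "R = tt ^ (n - 1) * ?x a - inverse qq"
    have "C \<nu> = (qq - 1) / (qq * ?x a - ?x i) * (R * P * Q * Q')"
      unfolding \<nu> pieri_value [OF n \<eta> C max, folded i_def a_def] P_def Q_def Q'_def R_def ..
    moreover have "invert_qt P = A"
      by (simp add: P_def A_def inv_qt.prod invert_qt_diag_coeff invert_qt_spectral)
    moreover have "invert_qt Q = B"
      by (simp add: Q_def B_def inv_qt.prod invert_qt_swap_coeff invert_qt_spectral)
    moreover have "invert_qt Q' = B'"
      unfolding Q'_def B'_def inv_qt.prod
      by (intro prod.cong refl invert_qt_swap_coeff inv_qx) (simp_all add: invert_qt_spectral)
    moreover have "invert_qt R = T * inverse (?x a) - qq"
      by (simp add: R_def T_def inv_qt.diff inv_qt.mult inv_qt.power inv_qt.inverse invert_qt_spectral)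
    ultimately have "invert_qt (C \<nu>)
      = (inverse qq - 1) / (inverse (qq * ?x a) - inverse (?x i)) * ((T * inverse (?x a) - qq) * A * B * B')"
      by (simp only: inv_qt.mult [of "_ / _"] inv_qt.mult [of _ Q'] inv_qt.mult [of _ Q] inv_qt.mult [of R]
          inv_qt.divide inv_qt.diff inv_qt.one inv_qx invert_qt_qq invert_qt_spectral)
    hence 1: "qt_binomial n \<nu> \<eta>
      = (inverse qq - 1) / (inverse (qq * ?x a) - inverse (?x i)) * ((T * inverse (?x a) - qq) * A * B * B') / (1 - qq)"
      unfolding binom by simp
    have T: "tt powi (- int n + 1) = T"
    proof -
      have "- int n + 1 = - int (n - 1)" using n by simp
      thus ?thesis by (simp only: power_int_minus power_int_of_nat T_def power_inverse)
    qed
    have 2: "A_fun I ?x = a_hat (?x i / qq) (?x a) * A"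
      unfolding A_fun_def Let_def elt_last [OF I] elt_first [OF I] A_def i_def a_def
      using prod_stay [OF I, of "\<lambda>k m. a_hat (?x k) (?x m)"] by simp
    have 3: "B_tilde n I ?x = (qq * ?x a - T) * B * B'"
      unfolding B_tilde_def Let_def elt_last [OF I] elt_first [OF I] B_def B'_def i_def a_def T
      using prod_gaps [OF I, of "\<lambda>k m. b_hat (?x k) (?x m)"] by simp
    show ?thesis
    \<comment> \<open>In the case of equality both sides are 0, as both contain a division by
      0.\<close>
    proof (cases "?x i = qq * ?x a")
      case True
      thus ?thesis unfolding 1 2 3 a_hat_def by simp
    next
      case False
      have nz: "?x i \<noteq> 0" "?x a \<noteq> 0" "1 - qq \<noteq> 0" "tt - 1 \<noteq> 0" "?x i - qq * ?x a \<noteq> 0" using False by simp_all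
      \<comment> \<open>The scalar 1 / (1 - q) of the generating series cancels against the inverted
        q - 1 and leaves 1 / q. The inverted spectral difference supplies the denominator of the
        outer \<open>a_hat\<close>, whose factor t - 1 is removed by the division by t - 1.\<close>
      have key: "(inverse qq - 1) / (inverse (qq * ?x a) - inverse (?x i)) * (T * inverse (?x a) - qq) / (1 - qq)
         = - (a_hat (?x i / qq) (?x a) * (qq * ?x a - T)) / (tt - 1)"
      proof -
        have "inverse qq - 1 = (1 - qq) / qq" "T * inverse (?x a) - qq = - (qq * ?x a - T) / ?x a"
          "inverse (qq * ?x a) - inverse (?x i) = (?x i - qq * ?x a) / (qq * ?x a * ?x i)"
          "?x i / qq - ?x a = (?x i - qq * ?x a) / qq"
          using nz by (simp_all add: field_simps)
        moreover have "u * (v - w) / z = - (u * (w - v) / z)" for u v w z :: qt_field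
        proof -
          have "u * (v - w) = - (u * (w - v))" by (simp add: algebra_simps)
          thus ?thesis by (simp only: divide_minus_left)
        qed
        from this [of "?x i" T "qq * ?x a" "?x i - qq * ?x a"] calculation
        show ?thesis unfolding a_hat_def using nz by simp
      qed
      have left: "k * (m * A * B * B') / r = k * m / r * (A * B * B')" for k m r
        by (simp only: divide_inverse ac_simps)
      have right: "- (h * z) / r * (A * B * B') = - (h * A * (z * B * B')) / r" for h z r
        by (simp add: ac_simps)
      show ?thesis unfolding 1 2 3 left key right ..
    qed
  qed
  moreover have "qt_binomial n \<nu> \<eta> = 0" if "\<nexists>I. maximal_set n \<eta> I \<and> \<nu> = c_set I \<eta>"
  proof -
    have "C \<nu> = 0" using pieri_support [OF n \<eta> C, of \<nu>] that by blast
    thus ?thesis unfolding binom by simp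
  qed
  ultimately show ?thesis by blast
qed

end
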